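(* Let $\Sigma$ be a hyperelliptic Riemann surface of genus $g\geq 3$ with a fixed nonsingular even spin structure $\xi_\epsilon$, let $P\in\Sigma$ be a standard point with a fixed enumeration $P_1,\dots,P_g$ of $\{\mathcal{A}_P\}$, and let $Q\neq R$ be any two vertices of the standard spin graph $\mathcal{S}_P$. Let $\sigma^C_{QR}:\{\mathcal{A}_Q\}\to\{\mathcal{A}_R\}$ be the bijection determined by the canonical path $C_{QR}$ with its canonical choice of faces, and $\sigma^C_{RQ}$ its inverse. Then $\sigma\mapsto\sigma^C_{QR}\,\sigma\,\sigma^C_{RQ}$ is a group isomorphism from the spin group $\mathtt{G}_Q$ onto the spin group $\mathtt{G}_R$; that is, $\mathtt{G}_R=\mathcal{A}d(\sigma^C_{QR})\,\mathtt{G}_Q$.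
   Context: Setting. $\Sigma$ is a compact hyperelliptic Riemann surface of genus $g$; $\widetilde{Q}$ denotes the image of $Q$ under the hyperelliptic involution. $\xi_\epsilon$ is a nonsingular even spin bundle: a line bundle with $\xi_\epsilon^{\otimes 2}\cong K_\Sigma$ and $h^0(\xi_\epsilon)=0$. For each $Q\in\Sigma$ there is, up to scalar, a unique meromorphic section of $\xi_\epsilon$ whose only pole is a simple pole at $Q$; its zero divisor $\mathcal{A}_Q$ is an effective divisor of degree $g$, and $\{\mathcal{A}_Q\}$ denotes the set of points of $\mathcal{A}_Q$. One has $R\in\{\mathcal{A}_Q\}$ iff $Q\in\{\mathcal{A}_R\}$. Spin graph. $\{\mathcal{S}_P\}$ is the smallest set of points containing $P$ such that $Q\in\{\mathcal{S}_P\}$ implies $\{\mathcal{A}_Q\}\subset\{\mathcal{S}_P\}$. The spin graph $\mathcal{S}_P$ has vertex set $\{\mathcal{S}_P\}$ and an edge $QR$ whenever $R\in\{\mathcal{A}_Q\}$. $P$ is a standard point (and $\mathcal{S}_P$ a standard spin graph) if $\{\mathcal{S}_P\}$ has $2g+2$ points. In that case, writing $\{\mathcal{A}_P\}=\{P_1,\dots,P_g\}$, the vertices are the distinct points $P,\widetilde P,P_k,\widetilde P_k$ ($1\le k\le g$), $\{\mathcal{A}_{P_k}\}=\{P\}\cup\{\widetilde P_j: j\ne k\}$, and $\{\mathcal{A}_{\widetilde Q}\}$ is the set of conjugates of the points of $\{\mathcal{A}_Q\}$; thus the edges are $PP_k$, $\widetilde P\widetilde P_k$, and $P_k\widetilde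 P_j$ ($j\neq k$). Orderings. The enumeration $P_1,\dots,P_g$ induces an enumeration $Q_1,\dots,Q_g$ of $\{\mathcal{A}_Q\}$ for each vertex $Q$: for $Q=P$ it is $P_1,\dots,P_g$; for $Q=\widetilde P$ it is $\widetilde P_1,\dots,\widetilde P_g$; for $Q=P_k$ it is $P$ followed by the $\widetilde P_j$ ($j\ne k$) in increasing order of $j$; for $Q=\widetilde P_k$ it is $\widetilde P$ followed by the $P_j$ ($j\neq k$) in increasing order of $j$. For every vertex $Q$ the vertices of the graph are $Q,\widetilde Q,Q_k,\widetilde Q_k$ ($1\le k\le g$). Faces. A face $F$ of a standard spin graph is a quadrangle ($4$-cycle) in the graph, no two of whose vertices are conjugate. Transport along an edge. Let $F$ be a face with vertices in cyclic order $V_1,V_2,V_3,V_4$. The bijection $\sigma^F_{V_1V_2}:\{\mathcal{A}_{V_1}\}\to\{\mathcal{A}_{V_2}\}$ is defined by $V_4\mapsto V_1$, $V_2\mapsto V_3$, $\widetilde V_3\mapsto\widetilde V_4$, and $T\mapsto\widetilde T$ for every other $T\in\{\mathcal{A}_{V_1}\}$. (The same rule, with the cyclic order read from the relevant edge, defines $\sigma^F_{VW}$ for every oriented edge $VW$ of $F$; $\sigma^F_{WV}$ is the inverse of $\sigma^F_{VW}$.) Spin groups. A spin chain at $Q$ is $\mathsf{W}_Q=\{\mathsf{L}_Q=QV_1V_2\dots V_NQ;\,F_1,\dots,F_{N+1}\}$, where $\mathsf{L}_Q$ is a loop (closed walk along edges of the graph) at $Q$ and $F_1,\dots,F_{N+1}$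 are faces with $QV_1\subset F_1$, $V_{i-1}V_i\subset F_i$ for $2\le i\le N$, and $V_NQ\subset F_{N+1}$. Put $\sigma^{\mathsf{W}_Q}=\sigma^{F_{N+1}}_{V_NQ}\circ\sigma^{F_N}_{V_{N-1}V_N}\circ\dots\circ\sigma^{F_1}_{QV_1}$, a permutation of $\{\mathcal{A}_Q\}$. The spin group $\mathtt{G}_Q$ is the set of all $\sigma^{\mathsf{W}_Q}$, a group under composition. Canonical path, faces, and $\sigma^C_{QR}$. (1) If $R=Q_i$ for some $i$: $C_{QR}=QQ_i$ with face $\overline F$ having vertices $Q,Q_i,\widetilde Q_k,Q_l$, where $l=\min(\{1,\dots,g\}\setminus\{i\})$ and $k=\min(\{1,\dots,g\}\setminus\{i,l\})$; $\sigma^C_{QR}=\sigma^{\overline F}_{QQ_i}$. (2) If $R=\widetilde Q_j$ for some $j$: let $i=\min(\{1,\dots,g\}\setminus\{j\})$, $C_{QR}=QQ_i\widetilde Q_j$; $\overline F_1$ is the face $\overline F$ of (1) for the edge $QQ_i$, and $\overline F_2$ is the face with vertices $Q_i,\widetilde Q_j,\widetilde Q,\widetilde Q_k$, where $k=\min(\{1,\dots,g\}\setminus\{i,j\})$; $\sigma^C_{QR}=\sigma^{\overline F_2}_{Q_i\widetilde Q_j}\circ\sigma^{\overline F_1}_{QQ_i}$. (3) If $R=\widetilde Q$: $C_{QR}=QQ_1\widetilde Q_2\widetilde Q$; the faces $\overline F_1,\overline F_2,\overline F_3$ have vertices $\{Q,Q_1,\widetilde Q_2,Q_3\}$, $\{Q_1,\widetilde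 Q_2,\widetilde Q,\widetilde Q_3\}$, $\{\widetilde Q_2,\widetilde Q,\widetilde Q_1,Q_3\}$ respectively; $\sigma^C_{QR}=\sigma^{\overline F_3}_{\widetilde Q_2\widetilde Q}\circ\sigma^{\overline F_2}_{Q_1\widetilde Q_2}\circ\sigma^{\overline F_1}_{QQ_1}$. *)

theory Defs
  imports
    "HOL-Complex_Analysis.Complex_Analysis"
    "HOL-Library.Function_Algebras"
    "HOL-Algebra.Bij"
begin

section \<open>Compact Riemann surfaces\<close>

text \<open>
  The points of the surface are the elements of a Hausdorff type \<^typ>\<open>'a\<close>; its complex structure is
  given by an atlas, a set of charts \<open>(U, z)\<close> with \<open>z\<close> a coordinate on the open set \<open>U\<close>.
\<close>

type_synonym 'a chart = "'a set \<times> ('a \<Rightarrow> complex)"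

abbreviation cdom :: "'a chart \<Rightarrow> 'a set" where
  "cdom c \<equiv> fst c"

abbreviation coord :: "'a chart \<Rightarrow> 'a \<Rightarrow> complex" where
  "coord c \<equiv> snd c"

definition cparam :: "'a chart \<Rightarrow> complex \<Rightarrow> 'a" where
  "cparam c = inv_into (cdom c) (coord c)"

definition holomorphic_atlas :: "('a::t2_space) chart set \<Rightarrow> bool" where
  "holomorphic_atlas A \<longleftrightarrow>
     (\<Union>c\<in>A. cdom c) = UNIV \<and>
     (\<forall>c\<in>A. open (cdom c) \<and> open (coord c ` cdom c) \<and>
            homeomorphism (cdom c) (coord c ` cdom c) (coord c) (cparam c)) \<and>
     (\<forall>c\<in>A. \<forall>d\<in>A. (coord d \<circ> cparam c) holomorphic_on (coord c ` (cdom c \<inter> cdom d)))"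

definition compact_riemann_surface :: "('a::t2_space) chart set \<Rightarrow> bool" where
  "compact_riemann_surface A \<longleftrightarrow>
     holomorphic_atlas A \<and> compact (UNIV :: 'a set) \<and> connected (UNIV :: 'a set)"

section \<open>Holomorphic line bundles and their sections\<close>

text \<open>
  A line bundle is given by a cocycle \<open>t\<close> of transition functions relative to the atlas, and a
  section by its local representatives \<open>s c\<close>, with \<open>s c = t c d * s d\<close> on overlaps. As every holomorphic
  line bundle on an open subset of the plane is trivial, every line bundle on the surface
  has such a description for any atlas.
\<close>

definition line_bundle :: "'a chart set \<Rightarrow> ('a chart \<Rightarrow> 'a chart \<Rightarrow> 'a \<Rightarrow> complex) \<Rightarrow> bool" where
  "line_bundle A t \<longleftrightarrow>
     (\<forall>c\<in>A. \<forall>d\<in>A. (t c d \<circ> cparam d) holomorphic_on (coord d ` (cdom c \<inter> cdom d)) \<and>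
                  (\<forall>p\<in>cdom c \<inter> cdom d. t c d p \<noteq> 0)) \<and>
     (\<forall>c\<in>A. \<forall>p\<in>cdom c. t c c p = 1) \<and>
     (\<forall>c\<in>A. \<forall>d\<in>A. \<forall>e\<in>A. \<forall>p\<in>cdom c \<inter> cdom d \<inter> cdom e. t c d p * t d e p = t c e p)"

definition tensor_bundle ::
  "('a chart \<Rightarrow> 'a chart \<Rightarrow> 'a \<Rightarrow> complex) \<Rightarrow> ('a chart \<Rightarrow> 'a chart \<Rightarrow> 'a \<Rightarrow> complex) \<Rightarrow>
   'a chart \<Rightarrow> 'a chart \<Rightarrow> 'a \<Rightarrow> complex" where
  "tensor_bundle t u = (\<lambda>c d p. t c d p * u c d p)"

definition bundle_iso ::
  "'a chart set \<Rightarrow> ('a chart \<Rightarrow> 'a chart \<Rightarrow> 'a \<Rightarrow> complex) \<Rightarrow>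
   ('a chart \<Rightarrow> 'a chart \<Rightarrow> 'a \<Rightarrow> complex) \<Rightarrow> bool" where
  "bundle_iso A t u \<longleftrightarrow>
     (\<exists>h. (\<forall>c\<in>A. (h c \<circ> cparam c) holomorphic_on (coord c ` cdom c) \<and> (\<forall>p\<in>cdom c. h c p \<noteq> 0)) \<and>
          (\<forall>c\<in>A. \<forall>d\<in>A. \<forall>p\<in>cdom c \<inter> cdom d. h c p * u c d p = t c d p * h d p))"

text \<open>
  The canonical bundle: \<open>f\<^sub>c dz\<^sub>c = f\<^sub>d dz\<^sub>d\<close> means \<open>f\<^sub>c = (dz\<^sub>d / dz\<^sub>c) f\<^sub>d\<close>.
\<close>

definition canonical_bundle :: "'a chart \<Rightarrow> 'a chart \<Rightarrow> 'a \<Rightarrow> complex" where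
  "canonical_bundle c d p = deriv (coord d \<circ> cparam c) (coord c p)"

text \<open>
  Local representatives of holomorphic sections are normalised to be zero outside their charts, so that a
  section is determined by its representatives as a function and \<open>holomorphic_sections A t\<close> is a
  complex vector space.
\<close>

definition holomorphic_sections ::
  "'a chart set \<Rightarrow> ('a chart \<Rightarrow> 'a chart \<Rightarrow> 'a \<Rightarrow> complex) \<Rightarrow> ('a chart \<Rightarrow> 'a \<Rightarrow> complex) set" where
  "holomorphic_sections A t =
     {s. (\<forall>c\<in>A. (s c \<circ> cparam c) holomorphic_on (coord c ` cdom c)) \<and>
         (\<forall>c\<in>A. \<forall>d\<in>A. \<forall>p\<in>cdom c \<inter> cdom d. s c p = t c d p * s d p) \<and>
         (\<forall>c p. c \<notin> A \<or> p \<notin> cdom c \<longrightarrow> s c p = 0)}"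

definition scale_section :: "complex \<Rightarrow> ('a chart \<Rightarrow> 'a \<Rightarrow> complex) \<Rightarrow> 'a chart \<Rightarrow> 'a \<Rightarrow> complex" where
  "scale_section a s = (\<lambda>c p. a * s c p)"

text \<open>
  \<open>has_h0 A t n\<close> says \<open>h\<^sup>0(t) = n\<close>. It is stated with a finite basis because the library's
  \<open>dim\<close> is also \<open>0\<close> for spaces of infinite dimension.
\<close>

definition has_h0 ::
  "'a chart set \<Rightarrow> ('a chart \<Rightarrow> 'a chart \<Rightarrow> 'a \<Rightarrow> complex) \<Rightarrow> nat \<Rightarrow> bool" where
  "has_h0 A t n \<longleftrightarrow>
     (\<exists>B. finite B \<and> card B = n \<and> \<not> module.dependent scale_section B \<and>
          module.span scale_section B = holomorphic_sections A t)"

definition has_genus :: "'a chart set \<Rightarrow> nat \<Rightarrow> bool" where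
  "has_genus A g \<longleftrightarrow> has_h0 A canonical_bundle g"

text \<open>
  \<open>nicely_meromorphic_on\<close> fixes the value at a pole to be \<open>0\<close> and removes removable singularities, so the
  transition law can be imposed at every point.
\<close>

definition meromorphic_section ::
  "'a chart set \<Rightarrow> ('a chart \<Rightarrow> 'a chart \<Rightarrow> 'a \<Rightarrow> complex) \<Rightarrow> ('a chart \<Rightarrow> 'a \<Rightarrow> complex) \<Rightarrow> bool" where
  "meromorphic_section A t s \<longleftrightarrow>
     (\<forall>c\<in>A. (s c \<circ> cparam c) nicely_meromorphic_on (coord c ` cdom c)) \<and>
     (\<forall>c\<in>A. \<forall>d\<in>A. \<forall>p\<in>cdom c \<inter> cdom d. s c p = t c d p * s d p)"

section \<open>The hyperelliptic involution\<close>

definition meromorphic_function :: "'a chart set \<Rightarrow> ('a \<Rightarrow> complex) \<Rightarrow> bool" where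
  "meromorphic_function A f \<longleftrightarrow>
     (\<forall>c\<in>A. (f \<circ> cparam c) nicely_meromorphic_on (coord c ` cdom c))"

text \<open>
  The value of a meromorphic function in the Riemann sphere, where \<^const>\<open>None\<close> is the point at infinity.
\<close>

definition sphere_value :: "'a chart set \<Rightarrow> ('a \<Rightarrow> complex) \<Rightarrow> 'a \<Rightarrow> complex option" where
  "sphere_value A f p =
     (if \<exists>c\<in>A. p \<in> cdom c \<and> is_pole (f \<circ> cparam c) (coord c p) then None else Some (f p))"

definition holomorphic_self_map :: "('a::topological_space) chart set \<Rightarrow> ('a \<Rightarrow> 'a) \<Rightarrow> bool" where
  "holomorphic_self_map A J \<longleftrightarrow>
     continuous_on UNIV J \<and>
     (\<forall>c\<in>A. \<forall>d\<in>A. (coord d \<circ> J \<circ> cparam c) holomorphic_on (coord c ` (cdom c \<inter> J -` cdom d)))"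

text \<open>
  The surface is a two-sheeted branched cover of the sphere by means of a meromorphic function \<open>x\<close>,
  and \<open>J\<close> is the nontrivial automorphism interchanging the sheets: the fibres of \<open>x\<close> are the
  orbits \<open>{Q, J Q}\<close>.
\<close>

definition hyperelliptic_involution :: "('a::topological_space) chart set \<Rightarrow> ('a \<Rightarrow> 'a) \<Rightarrow> bool" where
  "hyperelliptic_involution A J \<longleftrightarrow>
     holomorphic_self_map A J \<and> J \<circ> J = id \<and> J \<noteq> id \<and>
     (\<exists>x. meromorphic_function A x \<and>
          (\<forall>Q R. sphere_value A x R = sphere_value A x Q \<longleftrightarrow> R \<in> {Q, J Q}))"

section \<open>Nonsingular even spin bundles and the sets \<open>{A\<^sub>Q}\<close>\<close>

definition nonsingular_even_spin_bundle ::
  "'a chart set \<Rightarrow> ('a chart \<Rightarrow> 'a chart \<Rightarrow> 'a \<Rightarrow> complex) \<Rightarrow> bool" where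
  "nonsingular_even_spin_bundle A \<xi> \<longleftrightarrow>
     line_bundle A \<xi> \<and> bundle_iso A (tensor_bundle \<xi> \<xi>) canonical_bundle \<and> has_h0 A \<xi> 0"

definition simple_pole_section ::
  "'a chart set \<Rightarrow> ('a chart \<Rightarrow> 'a chart \<Rightarrow> 'a \<Rightarrow> complex) \<Rightarrow> 'a \<Rightarrow> ('a chart \<Rightarrow> 'a \<Rightarrow> complex) \<Rightarrow> bool" where
  "simple_pole_section A \<xi> Q s \<longleftrightarrow>
     meromorphic_section A \<xi> s \<and>
     (\<forall>c\<in>A. \<forall>p\<in>cdom c. is_pole (s c \<circ> cparam c) (coord c p) \<longleftrightarrow> p = Q) \<and>
     (\<forall>c\<in>A. Q \<in> cdom c \<longrightarrow> zorder (s c \<circ> cparam c) (coord c Q) = -1)"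

text \<open>
  The condition \<open>R \<noteq> Q\<close> is needed because representatives have the conventional value \<open>0\<close> at the pole \<open>Q\<close>.
\<close>

definition zero_points ::
  "'a chart set \<Rightarrow> ('a chart \<Rightarrow> 'a chart \<Rightarrow> 'a \<Rightarrow> complex) \<Rightarrow> 'a \<Rightarrow> 'a set" where
  "zero_points A \<xi> Q =
     {R. R \<noteq> Q \<and> (\<exists>s. simple_pole_section A \<xi> Q s \<and> (\<exists>c\<in>A. R \<in> cdom c \<and> s c R = 0))}"

section \<open>The spin graph\<close>

text \<open>
  From here on \<open>N Q\<close> stands for \<open>{A\<^sub>Q}\<close>, and \<open>J\<close> for the conjugation of points.
\<close>

inductive_set spin_vertices :: "('a \<Rightarrow> 'a set) \<Rightarrow> 'a \<Rightarrow> 'a set" for N P where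
  base: "P \<in> spin_vertices N P"
| step: "Q \<in> spin_vertices N P \<Longrightarrow> R \<in> N Q \<Longrightarrow> R \<in> spin_vertices N P"

definition spin_edges :: "('a \<Rightarrow> 'a set) \<Rightarrow> 'a \<Rightarrow> 'a set set" where
  "spin_edges N P = {{Q, R} | Q R. Q \<in> spin_vertices N P \<and> R \<in> N Q}"

definition standard_point :: "('a \<Rightarrow> 'a set) \<Rightarrow> nat \<Rightarrow> 'a \<Rightarrow> bool" where
  "standard_point N g P \<longleftrightarrow>
     finite (spin_vertices N P) \<and> card (spin_vertices N P) = 2 * g + 2"

text \<open>
  For a vertex \<open>Q\<close>, \<open>nbr J P Pt g Q i\<close> is \<open>Q\<^sub>i\<close>. The last case is \<open>Q = J (Pt k)\<close>. The index of
  the list is shifted since lists are indexed from \<open>0\<close>.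
\<close>

definition others :: "nat \<Rightarrow> nat \<Rightarrow> nat list" where
  "others g k = filter (\<lambda>j. j \<noteq> k) [1..<Suc g]"

definition nbr :: "('a \<Rightarrow> 'a) \<Rightarrow> 'a \<Rightarrow> (nat \<Rightarrow> 'a) \<Rightarrow> nat \<Rightarrow> 'a \<Rightarrow> nat \<Rightarrow> 'a" where
  "nbr J P Pt g Q i =
     (if Q = P then Pt i
      else if Q = J P then J (Pt i)
      else if Q \<in> Pt ` {1..g} then
        (let k = inv_into {1..g} Pt Q in (P # map (\<lambda>j. J (Pt j)) (others g k)) ! (i - 1))
      else
        (let k = inv_into {1..g} (J \<circ> Pt) Q in (J P # map Pt (others g k)) ! (i - 1)))"

section \<open>Faces and transport\<close>

text \<open>
  A \<open>4\<close>-cycle is represented by its set of edges.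
\<close>

definition quad :: "'a \<Rightarrow> 'a \<Rightarrow> 'a \<Rightarrow> 'a \<Rightarrow> 'a set set" where
  "quad V1 V2 V3 V4 = {{V1, V2}, {V2, V3}, {V3, V4}, {V4, V1}}"

definition is_face :: "('a \<Rightarrow> 'a set) \<Rightarrow> ('a \<Rightarrow> 'a) \<Rightarrow> 'a \<Rightarrow> 'a set set \<Rightarrow> bool" where
  "is_face N J P F \<longleftrightarrow>
     (\<exists>V1 V2 V3 V4. F = quad V1 V2 V3 V4 \<and> distinct [V1, V2, V3, V4] \<and> F \<subseteq> spin_edges N P \<and>
        (\<forall>V\<in>{V1, V2, V3, V4}. \<forall>W\<in>{V1, V2, V3, V4}. V \<noteq> W \<longrightarrow> V \<noteq> J W))"

text \<open>
  \<open>\<sigma>\<^sup>F\<close> along the oriented edge \<open>V1 V2\<close>; \<open>V3\<close> and \<open>V4\<close> are determined by \<open>F\<close>, \<open>V1\<close> and \<open>V2\<close>.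
  Only its values on \<open>{A}\<close> of \<open>V1\<close> matter.
\<close>

definition transport :: "('a \<Rightarrow> 'a) \<Rightarrow> 'a set set \<Rightarrow> 'a \<Rightarrow> 'a \<Rightarrow> 'a \<Rightarrow> 'a" where
  "transport J F V1 V2 T =
     (let (V3, V4) = (THE (V3, V4). F = quad V1 V2 V3 V4)
      in if T = V4 then V1
         else if T = V2 then V3
         else if T = J V3 then J V4
         else J T)"

section \<open>Spin groups\<close>

fun transport_along :: "('a \<Rightarrow> 'a) \<Rightarrow> 'a list \<Rightarrow> 'a set set list \<Rightarrow> 'a \<Rightarrow> 'a" where
  "transport_along J (V # W # Vs) (F # Fs) = transport_along J (W # Vs) Fs \<circ> transport J F V W"
| "transport_along J _ _ = id"

text \<open>
  \<open>Vs\<close> is the list of all vertices \<open>Q, V\<^sub>1, \<dots>, V\<^sub>N, Q\<close> of the loop.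
\<close>

definition spin_chain ::
  "('a \<Rightarrow> 'a set) \<Rightarrow> ('a \<Rightarrow> 'a) \<Rightarrow> 'a \<Rightarrow> 'a \<Rightarrow> 'a list \<Rightarrow> 'a set set list \<Rightarrow> bool" where
  "spin_chain N J P Q Vs Fs \<longleftrightarrow>
     length Vs \<ge> 2 \<and> hd Vs = Q \<and> last Vs = Q \<and> length Vs = Suc (length Fs) \<and>
     (\<forall>i<length Fs. {Vs ! i, Vs ! Suc i} \<in> spin_edges N P \<and>
                    is_face N J P (Fs ! i) \<and> {Vs ! i, Vs ! Suc i} \<in> Fs ! i)"

definition spin_perms :: "('a \<Rightarrow> 'a set) \<Rightarrow> ('a \<Rightarrow> 'a) \<Rightarrow> 'a \<Rightarrow> 'a \<Rightarrow> ('a \<Rightarrow> 'a) set" where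
  "spin_perms N J P Q =
     {restrict (transport_along J Vs Fs) (N Q) | Vs Fs. spin_chain N J P Q Vs Fs}"

definition spin_group :: "('a \<Rightarrow> 'a set) \<Rightarrow> ('a \<Rightarrow> 'a) \<Rightarrow> 'a \<Rightarrow> 'a \<Rightarrow> ('a \<Rightarrow> 'a) monoid" where
  "spin_group N J P Q = (BijGroup (N Q))\<lparr>carrier := spin_perms N J P Q\<rparr>"

section \<open>The canonical path and its transport\<close>

definition min_avoiding :: "nat \<Rightarrow> nat set \<Rightarrow> nat" where
  "min_avoiding g S = Min ({1..g} - S)"

text \<open>In the following \<open>q i\<close> is \<open>Q\<^sub>i\<close>.\<close>

definition canonical_face :: "('a \<Rightarrow> 'a) \<Rightarrow> nat \<Rightarrow> (nat \<Rightarrow> 'a) \<Rightarrow> 'a \<Rightarrow> nat \<Rightarrow> 'a set set" where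
  "canonical_face J g q Q i =
     (let l = min_avoiding g {i}; k = min_avoiding g {i, l}
      in quad Q (q i) (J (q k)) (q l))"

definition canonical_transport ::
  "('a \<Rightarrow> 'a) \<Rightarrow> 'a \<Rightarrow> (nat \<Rightarrow> 'a) \<Rightarrow> nat \<Rightarrow> 'a \<Rightarrow> 'a \<Rightarrow> 'a \<Rightarrow> 'a" where
  "canonical_transport J P Pt g Q R =
     (let q = nbr J P Pt g Q in
      if R \<in> q ` {1..g} then
        (let i = inv_into {1..g} q R
         in transport J (canonical_face J g q Q i) Q (q i))
      else if R \<in> (J \<circ> q) ` {1..g} then
        (let j = inv_into {1..g} (J \<circ> q) R;
             i = min_avoiding g {j};
             k = min_avoiding g {i, j}
         in transport J (quad (q i) (J (q j)) (J Q) (J (q k))) (q i) (J (q j)) \<circ>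
            transport J (canonical_face J g q Q i) Q (q i))
      else
        transport J (quad (J (q 2)) (J Q) (J (q 1)) (q 3)) (J (q 2)) (J Q) \<circ>
        transport J (quad (q 1) (J (q 2)) (J Q) (J (q 3))) (q 1) (J (q 2)) \<circ>
        transport J (quad Q (q 1) (J (q 2)) (q 3)) Q (q 1))"

end

theory Submission
  imports Defs
begin

text \<open>
  Let \<open>s\<close> be the section of \<open>\<xi>\<close> with a simple pole at \<open>P\<close> and divisor \<open>D\<close>, let \<open>\<omega> = s\<^sup>2\<close> be the
  associated differential and \<open>J\<close> the involution. Every fibre \<open>T + J T\<close> of the projection to the sphere is linearly
  equivalent to every other one. From \<open>J\<^sup>*\<omega> / \<omega>\<close> one obtains a function \<open>m\<close> with divisor \<open>J D - D\<close>;
  it turns \<open>D + J D\<close> into a canonical divisor, and the resulting holomorphic differentials bound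
  the number of zeros of \<open>s\<close> by the genus. So the zeros \<open>P\<^sub>1, \<dots>, P\<^sub>g\<close> of \<open>s\<close> are simple, and the products of
  \<open>s\<close> with \<open>m\<close> and with functions of divisor \<open>P + J P - P\<^sub>k - J P\<^sub>k\<close> are the sections with simple
  poles at \<open>J P\<close>, \<open>P\<^sub>k\<close> and \<open>J P\<^sub>k\<close>. Hence a standard spin graph is a complete bipartite graph minus the
  perfect matching of conjugate points. Transport along an edge is then bijective with inverse
  the transport along the reversed edge, and conjugation with the transport along any
  path of the graph, in particular the canonical one, is an isomorphism of spin groups.
\<close>

section \<open>Orders of meromorphic germs\<close>

text \<open>The argument uses neither Riemann-Roch nor degrees of divisors. Their place is taken by
  the maximum principle (a function without poles has zero divisor), by h^0 = 0 (a section times a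
  function never has an effective divisor, so a section with one simple pole is determined by that
  pole up to scalars), and by counting. The number of zeros of \<open>s\<close> is never computed:
  the enumeration \<open>Pt\<close> supplies g distinct zeros, while n zeros counted with
  multiplicity produce n independent holomorphic differentials, which leaves no room for a multiple
  zero. The existence of \<open>m\<close> is an instance of Hilbert 90 for the involution. The
  quotient of the pulled back differential by \<omega> has twice the desired divisor, and the square
  root can be extracted because the remaining error is an invariant divisor that is even at the
  branch points. These parities come from the derivative -1 of \<open>J\<close> at its fixed points.
  The number 2g + 2 in the notion of a standard point is the number of the names P, J P, P_k, J P_k,
  so these are pairwise distinct and the graph has no accidental coincidences.\<close>

definition ord_at :: "(complex \<Rightarrow> complex) \<Rightarrow> complex \<Rightarrow> int \<Rightarrow> bool" where
  "ord_at f z n \<longleftrightarrow>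
     (\<exists>u. u analytic_on {z} \<and> u z \<noteq> 0 \<and> (\<forall>\<^sub>F w in at z. f w = u w * (w - z) powi n))"

lemma ord_at_cong:
  assumes "ord_at f z n" "\<forall>\<^sub>F w in at z. f w = g w"
  shows "ord_at g z n"
proof -
  obtain u where u: "u analytic_on {z}" "u z \<noteq> 0" "\<forall>\<^sub>F w in at z. f w = u w * (w - z) powi n"
    using assms(1) unfolding ord_at_def by blast
  have "\<forall>\<^sub>F w in at z. g w = u w * (w - z) powi n"
    using u(3) assms(2) by eventually_elim simp
  with u show ?thesis unfolding ord_at_def by blast
qed

lemma analytic_at_nonzero_eventually:
  assumes "u analytic_on {z}" "u z \<noteq> (0::complex)"
  shows "\<forall>\<^sub>F w in nhds z. u w \<noteq> 0"
proof -
  have "(u \<longlongrightarrow> u z) (nhds z)"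
    using analytic_at_imp_isCont[OF assms(1)] by (simp add: continuous_within isCont_def tendsto_at_iff_tendsto_nhds)
  thus ?thesis using assms(2) by (rule tendsto_imp_eventually_ne)
qed

lemma ord_at_tendsto:
  assumes "ord_at f z n"
  obtains l where "l \<noteq> 0" "((\<lambda>w. f w * (w - z) powi (-n)) \<longlongrightarrow> l) (at z)"
proof -
  obtain u where u: "u analytic_on {z}" "u z \<noteq> 0" "\<forall>\<^sub>F w in at z. f w = u w * (w - z) powi n"
    using assms(1) unfolding ord_at_def by blast
  have "(u \<longlongrightarrow> u z) (at z)"
    using analytic_at_imp_isCont[OF u(1)] isCont_def by blast
  moreover have "\<forall>\<^sub>F w in at z. u w = f w * (w - z) powi (-n)"
    using u(3) eventually_neq_at_within[of z z]
    by eventually_elim (simp add: power_int_minus field_simps)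
  ultimately have "((\<lambda>w. f w * (w - z) powi (-n)) \<longlongrightarrow> u z) (at z)"
    by (rule Lim_transform_eventually)
  with u(2) that show ?thesis by blast
qed

lemma powi_tendsto_0: "k > 0 \<Longrightarrow> ((\<lambda>w. (w - z) powi k) \<longlongrightarrow> (0::complex)) (at z)"
proof -
  assume "k > 0"
  then obtain m where k: "k = int m" "m > 0" by (metis of_nat_0_less_iff pos_int_cases)
  have "((\<lambda>w. (w - z) ^ m) \<longlongrightarrow> (z - z) ^ m) (at z)" by (intro tendsto_intros)
  with k show ?thesis by (simp add: power_0_left)
qed

text \<open>If \<open>n < k\<close>, the given limit times a vanishing power of \<open>w - z\<close>
  would force the nonzero leading coefficient of \<open>f\<close> to be 0. Bounds on orders are
  later read off from limits in this way.\<close>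

lemma ord_at_ge:
  assumes "ord_at f z n" "((\<lambda>w. f w * (w - z) powi (-k)) \<longlongrightarrow> l) (at z)"
  shows "k \<le> n" "l = 0 \<Longrightarrow> k < n"
proof -
  obtain l' where l': "l' \<noteq> 0" "((\<lambda>w. f w * (w - z) powi (-n)) \<longlongrightarrow> l') (at z)"
    by (rule ord_at_tendsto[OF assms(1)])
  have A: "l' = 0" if "n < k"
  proof -
    have "((\<lambda>w. f w * (w - z) powi (-k) * (w - z) powi (k - n)) \<longlongrightarrow> l * 0) (at z)"
      by (intro tendsto_mult assms powi_tendsto_0) (use that in simp)
    moreover have "\<forall>\<^sub>F w in at z. f w * (w - z) powi (-k) * (w - z) powi (k - n) = f w * (w - z) powi (-n)"
      using eventually_neq_at_within[of z z]
      by eventually_elim (simp add: power_int_diff power_int_minus field_simps)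
    ultimately have "((\<lambda>w. f w * (w - z) powi (-n)) \<longlongrightarrow> l * 0) (at z)"
      by (rule Lim_transform_eventually)
    thus ?thesis using l'(2) tendsto_unique[OF at_neq_bot] by fastforce
  qed
  show le: "k \<le> n" using A l'(1) by linarith
  assume "l = 0"
  moreover have "l = l'" if "k = n" using assms(2) l'(2) that tendsto_unique[OF at_neq_bot] by blast
  ultimately show "k < n" using le l'(1) by (cases "k = n") auto
qed

lemma ord_at_unique:
  assumes n: "ord_at f z n" and m: "ord_at f z m"
  shows "n = m"
proof -
  obtain l where l: "((\<lambda>w. f w * (w - z) powi (-n)) \<longlongrightarrow> l) (at z)"
    by (rule ord_at_tendsto[OF n])
  obtain l' where l': "((\<lambda>w. f w * (w - z) powi (-m)) \<longlongrightarrow> l') (at z)"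
    by (rule ord_at_tendsto[OF m])
  show ?thesis using ord_at_ge(1)[OF n l'] ord_at_ge(1)[OF m l] by simp
qed

lemma ord_at_le_tendsto:
  assumes "ord_at f z n" "k \<le> n"
  obtains l where "((\<lambda>w. f w * (w - z) powi (-k)) \<longlongrightarrow> l) (at z)" "l = 0 \<longleftrightarrow> k < n"
proof -
  obtain l' where l': "l' \<noteq> 0" "((\<lambda>w. f w * (w - z) powi (-n)) \<longlongrightarrow> l') (at z)"
    by (rule ord_at_tendsto[OF assms(1)])
  show ?thesis
  proof (cases "k = n")
    case True thus ?thesis using that l' by auto
  next
    case False
    have "((\<lambda>w. f w * (w - z) powi (-n) * (w - z) powi (n - k)) \<longlongrightarrow> l' * 0) (at z)"
      by (intro tendsto_mult l' powi_tendsto_0) (use assms False in simp)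
    moreover have "\<forall>\<^sub>F w in at z. f w * (w - z) powi (-n) * (w - z) powi (n - k) = f w * (w - z) powi (-k)"
      using eventually_neq_at_within[of z z]
      by eventually_elim (simp add: power_int_diff power_int_minus field_simps)
    ultimately have "((\<lambda>w. f w * (w - z) powi (-k)) \<longlongrightarrow> l' * 0) (at z)"
      by (rule Lim_transform_eventually)
    thus ?thesis using that[of 0] False assms by simp
  qed
qed

lemma ord_at_nonzero:
  assumes "ord_at f z n" shows "\<forall>\<^sub>F w in at z. f w \<noteq> 0"
proof -
  obtain u where u: "u analytic_on {z}" "u z \<noteq> 0" "\<forall>\<^sub>F w in at z. f w = u w * (w - z) powi n"
    using assms(1) unfolding ord_at_def by blast
  have "\<forall>\<^sub>F w in at z. u w \<noteq> 0"
    using analytic_at_nonzero_eventually[OF u(1,2)] eventually_nhds_conv_at by blast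
  with u(3) eventually_neq_at_within[of z z] show ?thesis
    by eventually_elim simp
qed

lemma ord_at_mult:
  assumes "ord_at f z n" "ord_at g z m"
  shows "ord_at (\<lambda>w. f w * g w) z (n + m)"
proof -
  obtain u where u: "u analytic_on {z}" "u z \<noteq> 0" "\<forall>\<^sub>F w in at z. f w = u w * (w - z) powi n"
    using assms(1) unfolding ord_at_def by blast
  obtain v where v: "v analytic_on {z}" "v z \<noteq> 0" "\<forall>\<^sub>F w in at z. g w = v w * (w - z) powi m"
    using assms(2) unfolding ord_at_def by blast
  have "\<forall>\<^sub>F w in at z. f w * g w = (u w * v w) * (w - z) powi (n + m)"
    using u(3) v(3) eventually_neq_at_within[of z z]
    by eventually_elim (simp add: power_int_add)
  moreover have "(\<lambda>w. u w * v w) analytic_on {z}" using u v by (intro analytic_intros)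
  ultimately show ?thesis using u v unfolding ord_at_def
    by (intro exI[of _ "\<lambda>w. u w * v w"]) auto
qed

lemma ord_at_power_int:
  assumes "ord_at f z n" shows "ord_at (\<lambda>w. f w powi k) z (k * n)"
proof -
  obtain u where u: "u analytic_on {z}" "u z \<noteq> 0" "\<forall>\<^sub>F w in at z. f w = u w * (w - z) powi n"
    using assms(1) unfolding ord_at_def by blast
  have "(\<lambda>w. u w powi k) analytic_on {z}" using u by (intro analytic_intros) auto
  moreover have "\<forall>\<^sub>F w in at z. f w powi k = u w powi k * (w - z) powi (k * n)"
    using u(3) by eventually_elim (simp add: power_int_mult_distrib power_int_mult mult.commute[of k])
  ultimately show ?thesis using u(2) unfolding ord_at_def by (intro exI[of _ "\<lambda>w. u w powi k"]) auto
qed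

lemma ord_at_inverse: "ord_at f z n \<Longrightarrow> ord_at (\<lambda>w. inverse (f w)) z (-n)"
  using ord_at_power_int[of f z n "-1"] by (simp add: power_int_minus)

lemma ord_at_divide:
  assumes "ord_at f z n" "ord_at g z m"
  shows "ord_at (\<lambda>w. f w / g w) z (n - m)"
  using ord_at_mult[OF assms(1) ord_at_inverse[OF assms(2)]] by (simp add: field_simps)

lemma ord_at_analytic_nonzero: "u analytic_on {z} \<Longrightarrow> u z \<noteq> 0 \<Longrightarrow> ord_at u z 0"
  unfolding ord_at_def by (intro exI[of _ u]) auto

lemma ord_at_imp_meromorphic:
  assumes "ord_at f z n" shows "f meromorphic_on {z}"
proof -
  obtain u where u: "u analytic_on {z}" "u z \<noteq> 0" "\<forall>\<^sub>F w in at z. f w = u w * (w - z) powi n"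
    using assms(1) unfolding ord_at_def by blast
  have "(\<lambda>w. u w * (w - z) powi n) meromorphic_on {z}"
    using u(1) by (intro meromorphic_intros analytic_on_imp_meromorphic_on) auto
  thus ?thesis using u(3)
    by (subst meromorphic_on_cong[where g = "\<lambda>w. u w * (w - z) powi n"]) auto
qed

lemma meromorphic_imp_ord_at:
  assumes "f meromorphic_on {z}"
  shows "(\<forall>\<^sub>F w in at z. f w = 0) \<or> (\<exists>n. ord_at f z n)"
proof (cases "\<exists>\<^sub>F w in at z. f w \<noteq> 0")
  case True
  have "isolated_singularity_at f z" "not_essential f z"
    using assms by (auto simp: meromorphic_at_iff)
  from zorder_exist[OF this True] obtain r where
    r: "r > 0" "zor_poly f z z \<noteq> 0" "zor_poly f z holomorphic_on cball z r"
       "\<And>w. w \<in> cball z r - {z} \<Longrightarrow> f w = zor_poly f z w * (w - z) powi zorder f z"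
    by blast
  have "zor_poly f z analytic_on {z}"
    using r(1,3) by (meson analytic_at ball_subset_cball centre_in_ball holomorphic_on_subset open_ball)
  moreover have "\<forall>\<^sub>F w in at z. f w = zor_poly f z w * (w - z) powi zorder f z"
    unfolding eventually_at using r(1,4) by (intro exI[of _ r]) (auto simp: dist_commute)
  ultimately show ?thesis using r(2) unfolding ord_at_def by blast
next
  case False
  thus ?thesis by (simp add: not_frequently)
qed

lemma ord_at_zorder:
  assumes "ord_at f z n" shows "zorder f z = n"
proof -
  obtain u where u: "u analytic_on {z}" "u z \<noteq> 0" "\<forall>\<^sub>F w in at z. f w = u w * (w - z) powi n"
    using assms(1) unfolding ord_at_def by blast
  obtain S where S: "open S" "z \<in> S" "u holomorphic_on S" using u(1) by (auto simp: analytic_at)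
  obtain T where T: "open T" "z \<in> T" "\<And>w. w \<in> T \<Longrightarrow> w \<noteq> z \<Longrightarrow> f w = u w * (w - z) powi n"
    using u(3) unfolding eventually_at_topological by auto
  show ?thesis
    by (rule zorder_eqI[of "S \<inter> T" z u]) (use S T u in \<open>auto intro: holomorphic_on_subset\<close>)
qed

lemma ord_at_pole_iff:
  assumes "ord_at f z n" shows "is_pole f z \<longleftrightarrow> n < 0"
proof
  assume "n < 0"
  with assms show "is_pole f z"
    using neg_zorder_imp_is_pole[of f z] ord_at_imp_meromorphic[OF assms] ord_at_zorder[OF assms]
      eventually_frequently[OF at_neq_bot ord_at_nonzero[OF assms]]
    by (simp add: meromorphic_at_iff)
next
  assume p: "is_pole f z"
  have "isolated_singularity_at f z" using ord_at_imp_meromorphic[OF assms] by (simp add: meromorphic_at_iff)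
  thus "n < 0" using isolated_pole_imp_neg_zorder[OF _ p] ord_at_zorder[OF assms] by simp
qed

lemma ord_at_0_tendsto:
  assumes "ord_at f z n" "0 \<le> n"
  obtains l where "(f \<longlongrightarrow> l) (at z)" "l = 0 \<longleftrightarrow> 0 < n"
  using ord_at_le_tendsto[OF assms(1), of 0] assms(2) by auto

section \<open>Orders under local changes of coordinate and local involutions\<close>

lemma deriv_eq_tendsto:
  assumes "\<phi> analytic_on {z}"
  shows "((\<lambda>w. (\<phi> w - \<phi> z) / (w - z)) \<longlongrightarrow> deriv \<phi> z) (at z)"
proof -
  have "\<phi> field_differentiable (at z)" using assms by (rule analytic_on_imp_differentiable_at) simp
  thus ?thesis by (simp add: DERIV_deriv_iff_field_differentiable[symmetric] has_field_derivative_iff)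
qed

lemma analytic_ord_1:
  assumes "\<phi> analytic_on {z}" "deriv \<phi> z \<noteq> 0"
  shows "ord_at (\<lambda>w. \<phi> w - \<phi> z) z 1"
proof -
  have a: "(\<lambda>w. \<phi> w - \<phi> z) analytic_on {z}" using assms by (intro analytic_intros)
  have t: "((\<lambda>w. (\<phi> w - \<phi> z) * (w - z) powi (-1)) \<longlongrightarrow> deriv \<phi> z) (at z)"
    using deriv_eq_tendsto[OF assms(1)] by (simp add: power_int_minus field_simps)
  have "\<not> (\<forall>\<^sub>F w in at z. \<phi> w - \<phi> z = 0)"
  proof
    assume "\<forall>\<^sub>F w in at z. \<phi> w - \<phi> z = 0"
    hence "((\<lambda>w. (\<phi> w - \<phi> z) * (w - z) powi (-1)) \<longlongrightarrow> 0) (at z)"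
      by (intro tendsto_eventually) (auto elim: eventually_mono)
    with t assms(2) show False using tendsto_unique[OF at_neq_bot] by blast
  qed
  then obtain n where n: "ord_at (\<lambda>w. \<phi> w - \<phi> z) z n"
    using meromorphic_imp_ord_at[OF analytic_on_imp_meromorphic_on[OF a]] by blast
  obtain l where l: "l \<noteq> 0" "((\<lambda>w. (\<phi> w - \<phi> z) * (w - z) powi (-n)) \<longlongrightarrow> l) (at z)"
    by (rule ord_at_tendsto[OF n])
  have "1 \<le> n" using ord_at_ge(1)[OF n t] .
  moreover have "n \<le> 1"
  proof (rule ccontr)
    assume "\<not> n \<le> 1"
    then obtain l' where "((\<lambda>w. (\<phi> w - \<phi> z) * (w - z) powi (-1)) \<longlongrightarrow> l') (at z)" "l' = 0"
      using ord_at_le_tendsto[OF n, of 1] by auto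
    with t assms(2) show False using tendsto_unique[OF at_neq_bot] by blast
  qed
  ultimately have "n = 1" by linarith
  thus ?thesis using n by simp
qed

lemma analytic_regular_filterlim:
  assumes "\<phi> analytic_on {z}" "deriv \<phi> z \<noteq> 0"
  shows "filterlim \<phi> (at (\<phi> z)) (at z)"
proof -
  have "(\<phi> \<longlongrightarrow> \<phi> z) (at z)" using analytic_at_imp_isCont[OF assms(1)] isCont_def by blast
  moreover have "\<forall>\<^sub>F w in at z. \<phi> w \<noteq> \<phi> z" using ord_at_nonzero[OF analytic_ord_1[OF assms]] by simp
  ultimately show ?thesis by (simp add: filterlim_at)
qed

text \<open>Where the derivative does not vanish, \<open>\<phi> w - \<phi> z\<close> is
  \<open>w - z\<close> times a unit \<open>v\<close>, so only the unit in front of the power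
  changes.\<close>

lemma ord_at_compose:
  assumes "ord_at f (\<phi> z) n" "\<phi> analytic_on {z}" "deriv \<phi> z \<noteq> 0"
  shows "ord_at (\<lambda>w. f (\<phi> w)) z n"
proof -
  obtain u where u: "u analytic_on {\<phi> z}" "u (\<phi> z) \<noteq> 0" "\<forall>\<^sub>F w in at (\<phi> z). f w = u w * (w - \<phi> z) powi n"
    using assms(1) unfolding ord_at_def by blast
  obtain v where v: "v analytic_on {z}" "v z \<noteq> 0" "\<forall>\<^sub>F w in at z. \<phi> w - \<phi> z = v w * (w - z) powi 1"
    using analytic_ord_1[OF assms(2,3)] unfolding ord_at_def by blast
  have a1: "(\<lambda>w. u (\<phi> w)) analytic_on {z}"
    using analytic_on_compose[OF assms(2), of u] u(1) by (simp add: o_def)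
  have a: "(\<lambda>w. u (\<phi> w) * v w powi n) analytic_on {z}"
    using a1 v(1,2) by (intro analytic_intros) auto
  have "\<forall>\<^sub>F w in at z. f (\<phi> w) = u (\<phi> w) * (\<phi> w - \<phi> z) powi n"
    using filterlim_iff[THEN iffD1, OF analytic_regular_filterlim[OF assms(2,3)]] u(3) by blast
  with v(3) have "\<forall>\<^sub>F w in at z. f (\<phi> w) = (u (\<phi> w) * v w powi n) * (w - z) powi n"
    by eventually_elim (simp add: power_int_mult_distrib)
  thus ?thesis using a u(2) v(2) unfolding ord_at_def by (intro exI[of _ "\<lambda>w. u (\<phi> w) * v w powi n"]) auto
qed

text \<open>Comparing leading coefficients: \<open>j w - z\<close> behaves like
  \<open>deriv j z * (w - z)\<close>, so the left side has leading coefficient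
  \<open>l * deriv j z powi n * \<alpha>\<close> and the right side \<open>e * l\<close>. With
  derivative -1 this decides the parity of the order.\<close>

lemma ord_at_symmetry:
  assumes "ord_at G z n" "j analytic_on {z}" "j z = z" "deriv j z \<noteq> 0"
    and "(A \<longlongrightarrow> \<alpha>) (at z)" "\<forall>\<^sub>F w in at z. G (j w) * A w = e * G w"
  shows "deriv j z powi n * \<alpha> = e"
proof -
  obtain l where l: "l \<noteq> 0" "((\<lambda>w. G w * (w - z) powi (-n)) \<longlongrightarrow> l) (at z)"
    by (rule ord_at_tendsto[OF assms(1)])
  have fl: "filterlim j (at z) (at z)"
    using analytic_regular_filterlim[OF assms(2,4)] assms(3) by simp
  have 1: "((\<lambda>w. G (j w) * (j w - z) powi (-n)) \<longlongrightarrow> l) (at z)"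
    using filterlim_compose[OF l(2) fl] .
  have 2: "((\<lambda>w. ((j w - z) / (w - z)) powi n) \<longlongrightarrow> deriv j z powi n) (at z)"
    using deriv_eq_tendsto[OF assms(2)] assms(3,4) by (intro tendsto_power_int) auto
  have 3: "((\<lambda>w. G (j w) * (j w - z) powi (-n) * ((j w - z) / (w - z)) powi n * A w)
              \<longlongrightarrow> l * deriv j z powi n * \<alpha>) (at z)"
    by (intro tendsto_mult 1 2 assms(5))
  have "\<forall>\<^sub>F w in at z. j w \<noteq> z" using fl by (simp add: filterlim_at)
  hence "\<forall>\<^sub>F w in at z. G (j w) * (j w - z) powi (-n) * ((j w - z) / (w - z)) powi n * A w
              = e * (G w * (w - z) powi (-n))"
    using assms(6) eventually_neq_at_within[of z z]
  proof eventually_elim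
    case (elim w)
    have "G (j w) * (j w - z) powi (-n) * ((j w - z) / (w - z)) powi n * A w
        = (G (j w) * A w) * (w - z) powi (-n)"
      using elim(1,3) by (simp add: power_int_minus power_int_divide_distrib field_simps)
    with elim(2) show ?case by simp
  qed
  hence "((\<lambda>w. e * (G w * (w - z) powi (-n))) \<longlongrightarrow> l * deriv j z powi n * \<alpha>) (at z)"
    by (rule Lim_transform_eventually[OF 3])
  moreover have "((\<lambda>w. e * (G w * (w - z) powi (-n))) \<longlongrightarrow> e * l) (at z)"
    by (intro tendsto_intros l)
  ultimately have "l * deriv j z powi n * \<alpha> = e * l"
    using tendsto_unique[OF at_neq_bot] by blast
  thus ?thesis using l(1) by simp
qed

text \<open>The chain rule makes the derivative a square root of 1, so only the value 1 has to be
  excluded.\<close>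

lemma local_involution_deriv:
  assumes "j analytic_on {z}" "j z = z" "\<forall>\<^sub>F w in nhds z. j (j w) = w" "\<forall>\<^sub>F w in at z. j w \<noteq> w"
  shows "deriv j z = -1"
proof -
  have d: "(j has_field_derivative deriv j z) (at z)"
    using assms(1) by (metis DERIV_deriv_iff_field_differentiable analytic_on_imp_differentiable_at singletonI)
  have "((j \<circ> j) has_field_derivative deriv j z * deriv j z) (at z)"
    by (rule DERIV_chain) (use d assms(2) in auto)
  moreover have "((j \<circ> j) has_field_derivative 1) (at z)"
  proof -
    have "((\<lambda>w. w) has_field_derivative 1) (at z)" by simp
    thus ?thesis
      using DERIV_cong_ev[of z z "j \<circ> j" "\<lambda>w. w" 1 1] assms(3) by (simp add: o_def)
  qed
  ultimately have "deriv j z * deriv j z = 1" by (rule DERIV_unique)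
  hence "deriv j z = 1 \<or> deriv j z = -1" by (simp add: square_eq_1_iff)
  moreover have "deriv j z \<noteq> 1"
  proof
    \<comment> \<open>Otherwise \<open>w + j w\<close> is a local coordinate; being invariant under \<open>j\<close>, it forces \<open>j w = w\<close>.\<close>
    assume 1: "deriv j z = 1"
    let ?p = "\<lambda>w. w + j w"
    have an: "?p analytic_on {z}" using assms(1) by (intro analytic_intros) auto
    have dp: "deriv ?p z = 2"
      using DERIV_imp_deriv[OF DERIV_add[OF DERIV_ident d]] 1 by simp
    obtain S where S: "open S" "z \<in> S" "?p holomorphic_on S" using an by (auto simp: analytic_at)
    obtain r where r: "r > 0" "ball z r \<subseteq> S" "inj_on ?p (ball z r)"
      by (rule has_complex_derivative_locally_injective[OF S(3,2,1)]) (use dp in auto)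
    have c: "(j \<longlongrightarrow> z) (at z)"
      using analytic_at_imp_isCont[OF assms(1)] assms(2) isCont_def by metis
    have "\<forall>\<^sub>F w in at z. w \<in> ball z r"
      using r(1) by (intro eventually_at_in_open') auto
    moreover have "\<forall>\<^sub>F w in at z. j w \<in> ball z r"
      using c by (rule topological_tendstoD) (use r(1) in auto)
    moreover have "\<forall>\<^sub>F w in at z. j (j w) = w" using assms(3) by (simp add: eventually_nhds_conv_at)
    ultimately have "\<forall>\<^sub>F w in at z. False"
      using assms(4)
    proof eventually_elim
      case (elim w)
      have "?p (j w) = ?p w" using elim(3) by simp
      thus False using inj_onD[OF r(3), of "j w" w] elim by simp
    qed
    thus False by simp
  qed
  ultimately show ?thesis by blast
qed

text \<open>Near a zero of order \<open>n\<close> the function is the n-th power of a local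
  coordinate \<open>\<psi>\<close>, so small nonzero values are taken \<open>n\<close> times.
  Combined with a bound on the size of fibres this bounds the ramification.\<close>

lemma local_multiplicity:
  assumes "ord_at y z (int n)" "n > 0" "y analytic_on {z}" "open S" "z \<in> S"
  obtains T c where "T \<subseteq> S - {z}" "card T = n" "\<And>w. w \<in> T \<Longrightarrow> y w = c"
proof -
  obtain u where u: "u analytic_on {z}" "u z \<noteq> 0" "\<forall>\<^sub>F w in at z. y w = u w * (w - z) powi (int n)"
    using assms(1) unfolding ord_at_def by blast
  have fn: "finite {w. w ^ n = u z}" "card {w. w ^ n = u z} = n"
    using card_nth_roots[of "u z" n] finite_nth_roots[of n "u z"] u(2) assms(2) by auto
  have "{w. w ^ n = u z} \<noteq> {}"
  proof
    assume "{w. w ^ n = u z} = {}"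
    hence "card {w. w ^ n = u z} = 0" by (simp only: card.empty)
    thus False using fn(2) assms(2) by linarith
  qed
  then obtain \<rho> where \<rho>: "\<rho> ^ n = u z" by blast
  \<comment> \<open>An analytic n-th root of the unit \<open>u\<close>: dividing by
    \<open>u z\<close> makes the argument of \<open>Ln\<close> equal to 1 at \<open>z\<close>, away
    from the branch cut.\<close>
  define v where "v w = \<rho> * exp (Ln (u w / u z) / of_nat n)" for w
  have an: "v analytic_on {z}" unfolding v_def using u(1,2) by (intro analytic_intros) (auto simp: assms)
  have vz: "v z = \<rho>" using u(2) by (simp add: v_def)
  have "\<rho> \<noteq> 0" using \<rho> u(2) assms(2) by (auto simp: power_0_left)
  have vn: "v w ^ n = u w" if "u w \<noteq> 0" for w
  proof -
    have "of_nat n * (Ln (u w / u z) / of_nat n) = Ln (u w / u z)" using assms(2) by simp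
    hence "exp (Ln (u w / u z) / of_nat n) ^ n = exp (Ln (u w / u z))"
      by (metis exp_of_nat_mult)
    hence "v w ^ n = \<rho> ^ n * exp (Ln (u w / u z))" by (simp add: v_def power_mult_distrib)
    also have "\<dots> = u w" using that u(2) \<rho> by simp
    finally show ?thesis .
  qed
  define \<psi> where "\<psi> w = (w - z) * v w" for w
  have pan: "\<psi> analytic_on {z}" unfolding \<psi>_def using an by (intro analytic_intros)
  have dv: "(v has_field_derivative deriv v z) (at z)"
    using an by (metis DERIV_deriv_iff_field_differentiable analytic_on_imp_differentiable_at singletonI)
  have "((\<lambda>w. (w - z) * v w) has_field_derivative v z) (at z)"
    by (auto intro!: derivative_eq_intros dv)
  hence dp: "deriv \<psi> z = \<rho>" using vz unfolding \<psi>_def[abs_def] by (simp add: DERIV_imp_deriv)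
  have "\<forall>\<^sub>F w in at z. y w = \<psi> w ^ n"
    using u(3) analytic_at_nonzero_eventually[OF u(1,2), unfolded eventually_nhds_conv_at, THEN conjunct1]
    by eventually_elim (simp add: \<psi>_def power_mult_distrib vn)
  then obtain W where W: "open W" "z \<in> W" "\<And>w. w \<in> W \<Longrightarrow> w \<noteq> z \<Longrightarrow> y w = \<psi> w ^ n"
    unfolding eventually_at_topological by auto
  obtain S' where S': "open S'" "z \<in> S'" "\<psi> holomorphic_on S'" using pan by (auto simp: analytic_at)
  have hol: "\<psi> holomorphic_on (S \<inter> W \<inter> S')" using S' by (rule_tac holomorphic_on_subset) auto
  obtain r where r: "r > 0" "ball z r \<subseteq> S \<inter> W \<inter> S'" "inj_on \<psi> (ball z r)"
    by (rule has_complex_derivative_locally_injective[OF hol, of z])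
       (use dp \<open>\<rho> \<noteq> 0\<close> assms(4,5) W S' in auto)
  have "open (\<psi> ` ball z r)"
    by (rule open_mapping_thm3) (use r hol in \<open>auto intro: holomorphic_on_subset\<close>)
  moreover have "0 \<in> \<psi> ` ball z r" using r(1) by (intro image_eqI[of _ _ z]) (auto simp: \<psi>_def)
  ultimately obtain e where e: "e > 0" "cball 0 e \<subseteq> \<psi> ` ball z r"
    unfolding open_contains_cball by blast
  \<comment> \<open>The \<open>n\<close> solutions all have modulus \<open>e\<close>, hence lie in
    the disc covered by \<open>\<psi>\<close> and differ from 0.\<close>
  define R where "R = {t. t ^ n = complex_of_real e ^ n}"
  have cR: "card R = n" unfolding R_def using card_nth_roots[of "complex_of_real e ^ n" n] e(1) assms(2) by simp
  have Rsub: "R \<subseteq> \<psi> ` ball z r - {0}"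
  proof
    fix t assume "t \<in> R"
    hence "cmod (t ^ n) = cmod (complex_of_real e ^ n)" unfolding R_def by simp
    hence "cmod t ^ n = e ^ n" using e(1) by (simp add: norm_power)
    hence nt: "cmod t = e" using power_eq_iff_eq_base[OF assms(2), of "cmod t" e] e(1) by simp
    hence "t \<in> cball 0 e" by simp
    thus "t \<in> \<psi> ` ball z r - {0}" using e nt by auto
  qed
  let ?T = "inv_into (ball z r) \<psi> ` R"
  show thesis
  proof (rule that[of ?T "complex_of_real e ^ n"])
    show "card ?T = n"
      using cR card_image[OF inj_on_subset[OF inj_on_inv_into[of R \<psi> "ball z r"]]] Rsub by auto
    have *: "w \<in> ball z r" "\<psi> w \<in> R" if w: "w \<in> ?T" for w
    proof -
      obtain t where t: "t \<in> R" "w = inv_into (ball z r) \<psi> t" using w by blast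
      have "t \<in> \<psi> ` ball z r" using t Rsub by blast
      thus "w \<in> ball z r" "\<psi> w \<in> R" 
        using t inv_into_into[of t \<psi> "ball z r"] f_inv_into_f[of t \<psi> "ball z r"] by auto
    qed
    have **: "w \<noteq> z" if "w \<in> ?T" for w using *(2)[OF that] Rsub by (auto simp: \<psi>_def)
    show "?T \<subseteq> S - {z}" using * ** r(2) by blast
    fix w assume w: "w \<in> ?T"
    thus "y w = complex_of_real e ^ n" using W(3)[of w] *[OF w] **[OF w] r(2) by (auto simp: R_def)
  qed
qed

section \<open>Compact Riemann surfaces\<close>

locale riemann_surface =
  fixes A :: "('a::t2_space) chart set"
  assumes surf: "compact_riemann_surface A"
begin

lemma atlas: "holomorphic_atlas A"
  using surf by (simp add: compact_riemann_surface_def)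

lemma chart_exists: obtains c where "c \<in> A" "p \<in> cdom c"
  using atlas unfolding holomorphic_atlas_def by blast

definition chart_of :: "'a \<Rightarrow> 'a chart" where
  "chart_of p = (SOME c. c \<in> A \<and> p \<in> cdom c)"

lemma chart_of: "chart_of p \<in> A" "p \<in> cdom (chart_of p)"
  unfolding chart_of_def using someI_ex[of "\<lambda>c. c \<in> A \<and> p \<in> cdom c"] chart_exists by metis+

lemma chart_props:
  assumes "c \<in> A"
  shows "open (cdom c)" "open (coord c ` cdom c)"
    "homeomorphism (cdom c) (coord c ` cdom c) (coord c) (cparam c)"
  using assms atlas unfolding holomorphic_atlas_def by blast+

lemma cparam_coord: "c \<in> A \<Longrightarrow> q \<in> cdom c \<Longrightarrow> cparam c (coord c q) = q"
  using chart_props(3) unfolding homeomorphism_def by blast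

lemma coord_cparam: "c \<in> A \<Longrightarrow> w \<in> coord c ` cdom c \<Longrightarrow> coord c (cparam c w) = w"
  using chart_props(3) unfolding homeomorphism_def by blast

lemma cparam_in: "c \<in> A \<Longrightarrow> w \<in> coord c ` cdom c \<Longrightarrow> cparam c w \<in> cdom c"
  by (metis cparam_coord imageE)

lemma open_coord_image:
  assumes "c \<in> A" "open U" "U \<subseteq> cdom c"
  shows "open (coord c ` U)"
proof -
  have "openin (top_of_set (cdom c)) U" using assms by (metis chart_props(1) openin_open_eq)
  hence "openin (top_of_set (coord c ` cdom c)) (coord c ` U)"
    by (rule homeomorphism_imp_open_map[OF chart_props(3)[OF assms(1)]])
  thus ?thesis using chart_props(2)[OF assms(1)] openin_open_trans by blast
qed

lemma open_cparam_image:
  assumes "c \<in> A" "open U" "U \<subseteq> coord c ` cdom c"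
  shows "open (cparam c ` U)"
proof -
  have "openin (top_of_set (coord c ` cdom c)) U" using assms by (metis chart_props(2) openin_open_eq)
  hence "openin (top_of_set (cdom c)) (cparam c ` U)"
    by (rule homeomorphism_imp_open_map[OF homeomorphism_symD[OF chart_props(3)[OF assms(1)]]])
  thus ?thesis using chart_props(1)[OF assms(1)] openin_open_trans by blast
qed

lemma eventually_chart:
  assumes "c \<in> A" "p \<in> cdom c"
  shows "(\<forall>\<^sub>F q in at p. Pr q) \<longleftrightarrow> (\<forall>\<^sub>F w in at (coord c p). Pr (cparam c w))"
proof
  assume "\<forall>\<^sub>F q in at p. Pr q"
  then obtain U where U: "open U" "p \<in> U" "\<And>q. q \<in> U \<Longrightarrow> q \<noteq> p \<Longrightarrow> Pr q"
    unfolding eventually_at_topological by auto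
  have "open (coord c ` (U \<inter> cdom c))"
    by (rule open_coord_image) (use assms U chart_props(1)[OF assms(1)] in auto)
  moreover have "Pr (cparam c w)" if h: "w \<in> coord c ` (U \<inter> cdom c)" "w \<noteq> coord c p" for w
  proof -
    obtain q where q: "q \<in> U" "q \<in> cdom c" "w = coord c q" using h(1) by blast
    moreover have "q \<noteq> p" using h(2) q(3) by blast
    ultimately show ?thesis using U(3)[of q] cparam_coord[OF assms(1)] by simp
  qed
  ultimately show "\<forall>\<^sub>F w in at (coord c p). Pr (cparam c w)"
    unfolding eventually_at_topological using U(2) assms(2) by blast
next
  assume "\<forall>\<^sub>F w in at (coord c p). Pr (cparam c w)"
  then obtain U where U: "open U" "coord c p \<in> U" "\<And>q. q \<in> U \<Longrightarrow> q \<noteq> coord c p \<Longrightarrow> Pr (cparam c q)"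
    unfolding eventually_at_topological by auto
  have "open (cparam c ` (U \<inter> coord c ` cdom c))"
    by (rule open_cparam_image) (use assms U chart_props(2)[OF assms(1)] in auto)
  moreover have "Pr q" if h: "q \<in> cparam c ` (U \<inter> coord c ` cdom c)" "q \<noteq> p" for q
  proof -
    obtain w where w: "w \<in> U" "w \<in> coord c ` cdom c" "q = cparam c w" using h(1) by blast
    moreover have "w \<noteq> coord c p" using h(2) w(3) cparam_coord[OF assms] by blast
    ultimately show ?thesis using U(3)[of w] by simp
  qed
  moreover have "p \<in> cparam c ` (U \<inter> coord c ` cdom c)"
    using U(2) assms by (intro image_eqI[of _ _ "coord c p"]) (auto simp: cparam_coord)
  ultimately show "\<forall>\<^sub>F q in at p. Pr q"
    unfolding eventually_at_topological by blast
qed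

lemma filterlim_chart:
  assumes "c \<in> A" "p \<in> cdom c"
  shows "filterlim F G (at p) \<longleftrightarrow> filterlim (\<lambda>w. F (cparam c w)) G (at (coord c p))"
  unfolding filterlim_iff eventually_chart[OF assms, of "\<lambda>q. P (F q)" for P] ..

lemma at_neq_bot_surface [simp]: "at (p::'a) \<noteq> bot"
proof -
  obtain c where c: "c \<in> A" "p \<in> cdom c" by (rule chart_exists)
  show ?thesis
    using eventually_chart[OF c, of "\<lambda>_. False"] by (metis at_neq_bot trivial_limit_def)
qed

lemma eventually_in_cdom: "c \<in> A \<Longrightarrow> p \<in> cdom c \<Longrightarrow> \<forall>\<^sub>F q in at p. q \<in> cdom c"
  using chart_props(1) eventually_at_in_open' by blast

lemma eventually_in_image:
  assumes "c \<in> A" "p \<in> cdom c" shows "\<forall>\<^sub>F w in at (coord c p). w \<in> coord c ` cdom c"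
  by (rule eventually_at_in_open'[OF chart_props(2)[OF assms(1)]]) (use assms in blast)

text \<open>The identity theorem in abstract form. The points near which a property holds on a
  punctured neighbourhood form an open set; the sets belonging to \<open>Pr\<close> and to its
  negation are disjoint because no point is isolated, and by hypothesis they cover the connected
  surface.\<close>

lemma locally_determined_imp_constant:
  assumes "\<And>p::'a. (\<forall>\<^sub>F q in at p. Pr q) \<or> (\<forall>\<^sub>F q in at p. \<not> Pr q)"
  shows "(\<forall>p::'a. \<forall>\<^sub>F q in at p. Pr q) \<or> (\<forall>p::'a. \<forall>\<^sub>F q in at p. \<not> Pr q)"
proof -
  have op: "open {p::'a. \<forall>\<^sub>F q in at p. Q q}" for Q
  proof (subst open_subopen, safe)
    fix p assume "\<forall>\<^sub>F q in at p. Q q"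
    then obtain U where U: "open U" "p \<in> U" "\<And>q. q \<in> U \<Longrightarrow> q \<noteq> p \<Longrightarrow> Q q"
      unfolding eventually_at_topological by auto
    have "\<forall>\<^sub>F q in at r. Q q" if "r \<in> U" for r
    proof (cases "r = p")
      case False
      have "open (U - {p})" using U(1) by (intro open_Diff) auto
      moreover have "r \<in> U - {p}" "\<And>q. q \<in> U - {p} \<Longrightarrow> Q q" using that False U(3) by auto
      ultimately show ?thesis unfolding eventually_at_topological by blast
    qed (use U in \<open>auto simp: eventually_at_topological\<close>)
    thus "\<exists>T. open T \<and> p \<in> T \<and> T \<subseteq> {p. \<forall>\<^sub>F q in at p. Q q}" using U by blast
  qed
  let ?S = "{p::'a. \<forall>\<^sub>F q in at p. Pr q}" and ?T = "{p::'a. \<forall>\<^sub>F q in at p. \<not> Pr q}"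
  have "?S \<inter> ?T = {}"
  proof safe
    fix p :: 'a assume "\<forall>\<^sub>F q in at p. Pr q" "\<forall>\<^sub>F q in at p. \<not> Pr q"
    hence "\<forall>\<^sub>F q in at p. False" by eventually_elim simp
    thus "p \<in> {}" by simp
  qed
  moreover have "UNIV \<subseteq> ?S \<union> ?T" using assms by blast
  moreover have "connected (UNIV :: 'a set)" using surf by (simp add: compact_riemann_surface_def)
  ultimately have "?S \<inter> UNIV = {} \<or> ?T \<inter> UNIV = {}"
    using connectedD[OF _ op op, of UNIV Pr "\<lambda>q. \<not> Pr q"] by auto
  thus ?thesis using assms by blast
qed

subsection \<open>Derivatives of self-maps in charts\<close>

text \<open>For the identity map this is the cocycle of the canonical bundle, so that changes of
  chart and the involution are covered by the same lemmas.\<close>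

definition chart_deriv :: "('a \<Rightarrow> 'a) \<Rightarrow> 'a chart \<Rightarrow> 'a chart \<Rightarrow> 'a \<Rightarrow> complex" where
  "chart_deriv \<Phi> c d p = deriv (coord d \<circ> \<Phi> \<circ> cparam c) (coord c p)"

lemma chart_deriv_id: "chart_deriv id c d p = canonical_bundle c d p"
  by (simp add: chart_deriv_def canonical_bundle_def)

lemma holomorphic_self_map_id: "holomorphic_self_map A id"
  using atlas unfolding holomorphic_self_map_def holomorphic_atlas_def by (auto simp: o_def)

lemma open_chart_preimage:
  assumes "holomorphic_self_map A \<Phi>" "c \<in> A" "d \<in> A"
  shows "open (cdom c \<inter> \<Phi> -` cdom d)"
proof -
  have "continuous_on UNIV \<Phi>" using assms(1) by (simp add: holomorphic_self_map_def)
  hence "open (\<Phi> -` cdom d)" using chart_props(1)[OF assms(3)] by (simp add: continuous_on_open_vimage)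
  thus ?thesis using chart_props(1)[OF assms(2)] by blast
qed

lemma chart_map_holomorphic:
  assumes "holomorphic_self_map A \<Phi>" "c \<in> A" "d \<in> A"
  shows "(coord d \<circ> \<Phi> \<circ> cparam c) holomorphic_on (coord c ` (cdom c \<inter> \<Phi> -` cdom d))"
    "open (coord c ` (cdom c \<inter> \<Phi> -` cdom d))"
  using assms open_coord_image[OF assms(2) open_chart_preimage[OF assms]]
  by (auto simp: holomorphic_self_map_def)

lemma chart_map_analytic:
  assumes "holomorphic_self_map A \<Phi>" "c \<in> A" "d \<in> A" "p \<in> cdom c" "\<Phi> p \<in> cdom d"
  shows "(coord d \<circ> \<Phi> \<circ> cparam c) analytic_on {coord c p}"
  using chart_map_holomorphic[OF assms(1-3)] assms(4,5) by (auto simp: analytic_at)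

lemma chart_map_value:
  assumes "c \<in> A" "p \<in> cdom c"
  shows "(coord d \<circ> \<Phi> \<circ> cparam c) (coord c p) = coord d (\<Phi> p)"
  using assms by (simp add: cparam_coord)

lemma chart_deriv_comp:
  assumes "holomorphic_self_map A \<Phi>" "holomorphic_self_map A \<Psi>" "c \<in> A" "d \<in> A" "e \<in> A"
    and "p \<in> cdom c" "\<Psi> p \<in> cdom d" "\<Phi> (\<Psi> p) \<in> cdom e"
  shows "chart_deriv (\<Phi> \<circ> \<Psi>) c e p = chart_deriv \<Phi> d e (\<Psi> p) * chart_deriv \<Psi> c d p"
proof -
  let ?f = "coord d \<circ> \<Psi> \<circ> cparam c" and ?g = "coord e \<circ> \<Phi> \<circ> cparam d"
  have v: "?f (coord c p) = coord d (\<Psi> p)" by (rule chart_map_value) fact+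
  have 1: "?f field_differentiable at (coord c p)"
    by (rule analytic_on_imp_differentiable_at[OF chart_map_analytic]) (use assms in auto)
  have 2: "?g field_differentiable at (?f (coord c p))"
    unfolding v by (rule analytic_on_imp_differentiable_at[OF chart_map_analytic]) (use assms in auto)
  have "deriv (?g \<circ> ?f) (coord c p) = deriv ?g (?f (coord c p)) * deriv ?f (coord c p)"
    by (rule deriv_chain[OF 1 2])
  moreover have "deriv (coord e \<circ> (\<Phi> \<circ> \<Psi>) \<circ> cparam c) (coord c p) = deriv (?g \<circ> ?f) (coord c p)"
  proof (rule deriv_cong_ev)
    have "\<forall>\<^sub>F w in nhds (coord c p). w \<in> coord c ` (cdom c \<inter> \<Psi> -` cdom d)"
      by (rule eventually_nhds_in_open) (use chart_map_holomorphic(2) assms in auto)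
    thus "\<forall>\<^sub>F w in nhds (coord c p). (coord e \<circ> (\<Phi> \<circ> \<Psi>) \<circ> cparam c) w = (?g \<circ> ?f) w"
      by eventually_elim (use assms in \<open>auto simp: cparam_coord\<close>)
  qed simp
  ultimately show ?thesis unfolding chart_deriv_def v by simp
qed

lemma chart_deriv_id_same: "c \<in> A \<Longrightarrow> p \<in> cdom c \<Longrightarrow> chart_deriv id c c p = 1"
proof -
  assume c: "c \<in> A" "p \<in> cdom c"
  have "deriv (coord c \<circ> id \<circ> cparam c) (coord c p) = deriv (\<lambda>w. w) (coord c p)"
  proof (rule deriv_cong_ev)
    have "\<forall>\<^sub>F w in nhds (coord c p). w \<in> coord c ` cdom c"
      by (rule eventually_nhds_in_open) (use c chart_props in auto)
    thus "\<forall>\<^sub>F w in nhds (coord c p). (coord c \<circ> id \<circ> cparam c) w = w"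
      by eventually_elim (use c in \<open>auto simp: coord_cparam\<close>)
  qed simp
  thus ?thesis by (simp add: chart_deriv_def)
qed

text \<open>The chain rule for \<open>\<Phi> \<circ> \<Phi> = id\<close>. It is used with the
  identity and with the involution, and shows that both have nonvanishing derivative in every pair
  of charts.\<close>

lemma chart_deriv_involution_nonzero:
  assumes "holomorphic_self_map A \<Phi>" "\<Phi> \<circ> \<Phi> = id" "c \<in> A" "d \<in> A" "p \<in> cdom c" "\<Phi> p \<in> cdom d"
  shows "chart_deriv \<Phi> d c (\<Phi> p) * chart_deriv \<Phi> c d p = 1"
proof -
  have "\<Phi> (\<Phi> p) = p" using assms(2) by (metis comp_apply id_apply)
  with chart_deriv_comp[OF assms(1,1,3,4,3,5,6)] assms show ?thesis
    by (simp add: chart_deriv_id_same)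
qed

subsection \<open>Orders of functions\<close>

text \<open>A relation and not a function, because a germ that vanishes identically has no order;
  the value at \<open>p\<close> itself is ignored. One chart suffices since the order is the same in
  all of them.\<close>

definition ordp :: "('a \<Rightarrow> complex) \<Rightarrow> 'a \<Rightarrow> int \<Rightarrow> bool" where
  "ordp F p n \<longleftrightarrow> (\<exists>c\<in>A. p \<in> cdom c \<and> ord_at (F \<circ> cparam c) (coord c p) n)"

text \<open>For \<open>\<Phi> = id\<close> this is independence of the chart, for
  \<open>\<Phi> = J\<close> invariance of orders under conjugation.\<close>

lemma ord_at_chart_map:
  assumes "holomorphic_self_map A \<Phi>" "\<Phi> \<circ> \<Phi> = id" "c \<in> A" "d \<in> A" "p \<in> cdom c" "\<Phi> p \<in> cdom d"
    and "ord_at (F \<circ> cparam d) (coord d (\<Phi> p)) n"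
  shows "ord_at (F \<circ> \<Phi> \<circ> cparam c) (coord c p) n"
proof -
  let ?f = "coord d \<circ> \<Phi> \<circ> cparam c"
  have v: "?f (coord c p) = coord d (\<Phi> p)" by (rule chart_map_value) fact+
  have "chart_deriv \<Phi> c d p \<noteq> 0"
    using chart_deriv_involution_nonzero[OF assms(1-6)] by (metis mult_zero_right zero_neq_one)
  hence nz: "deriv ?f (coord c p) \<noteq> 0" by (simp only: chart_deriv_def not_False_eq_True)
  have o: "ord_at (F \<circ> cparam d) (?f (coord c p)) n" unfolding v by (rule assms(7))
  have "ord_at (\<lambda>w. (F \<circ> cparam d) (?f w)) (coord c p) n"
    by (rule ord_at_compose[OF o chart_map_analytic[OF assms(1,3,4,5,6)] nz])
  moreover have "\<forall>\<^sub>F w in at (coord c p). w \<in> coord c ` (cdom c \<inter> \<Phi> -` cdom d)"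
    by (rule eventually_at_in_open') (use chart_map_holomorphic(2) assms in auto)
  hence "\<forall>\<^sub>F w in at (coord c p). (F \<circ> cparam d) (?f w) = (F \<circ> \<Phi> \<circ> cparam c) w"
    by eventually_elim (use assms in \<open>auto simp: cparam_coord\<close>)
  ultimately show ?thesis by (rule ord_at_cong)
qed

lemma ordp_iff:
  assumes "c \<in> A" "p \<in> cdom c"
  shows "ordp F p n \<longleftrightarrow> ord_at (F \<circ> cparam c) (coord c p) n"
  using ord_at_chart_map[OF holomorphic_self_map_id, of c _ p F n] assms
  by (auto simp: ordp_def)

lemma ordp_comp:
  assumes "holomorphic_self_map A \<Phi>" "\<Phi> \<circ> \<Phi> = id" "ordp F (\<Phi> p) n"
  shows "ordp (F \<circ> \<Phi>) p n"
proof -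
  obtain d where d: "d \<in> A" "\<Phi> p \<in> cdom d" by (rule chart_exists)
  obtain c where c: "c \<in> A" "p \<in> cdom c" by (rule chart_exists)
  show ?thesis using ord_at_chart_map[OF assms(1,2) c(1) d(1) c(2) d(2)] assms(3) c d
    by (simp add: ordp_iff)
qed

lemma ordp_unique: "ordp F p n \<Longrightarrow> ordp F p m \<Longrightarrow> n = m"
  by (metis ord_at_unique ordp_def ordp_iff)

lemma ordp_cong:
  assumes "ordp F p n" "\<forall>\<^sub>F q in at p. F q = G q"
  shows "ordp G p n"
proof -
  obtain c where c: "c \<in> A" "p \<in> cdom c" by (rule chart_exists)
  show ?thesis using assms ord_at_cong[of "F \<circ> cparam c" "coord c p" n "G \<circ> cparam c"]
    eventually_chart[OF c] by (simp add: ordp_iff[OF c])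
qed

lemma ordp_mult: "ordp F p n \<Longrightarrow> ordp G p m \<Longrightarrow> ordp (\<lambda>q. F q * G q) p (n + m)"
  and ordp_inverse: "ordp F p n \<Longrightarrow> ordp (\<lambda>q. inverse (F q)) p (-n)"
  and ordp_divide: "ordp F p n \<Longrightarrow> ordp G p m \<Longrightarrow> ordp (\<lambda>q. F q / G q) p (n - m)"
  and ordp_power_int: "ordp F p n \<Longrightarrow> ordp (\<lambda>q. F q powi k) p (k * n)"
proof -
  obtain c where c: "c \<in> A" "p \<in> cdom c" by (rule chart_exists)
  show "ordp F p n \<Longrightarrow> ordp G p m \<Longrightarrow> ordp (\<lambda>q. F q * G q) p (n + m)"
    "ordp F p n \<Longrightarrow> ordp (\<lambda>q. inverse (F q)) p (-n)"
    "ordp F p n \<Longrightarrow> ordp G p m \<Longrightarrow> ordp (\<lambda>q. F q / G q) p (n - m)"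
    "ordp F p n \<Longrightarrow> ordp (\<lambda>q. F q powi k) p (k * n)"
    using ord_at_mult[of "F \<circ> cparam c" "coord c p" n "G \<circ> cparam c" m]
      ord_at_inverse[of "F \<circ> cparam c" "coord c p" n]
      ord_at_divide[of "F \<circ> cparam c" "coord c p" n "G \<circ> cparam c" m]
      ord_at_power_int[of "F \<circ> cparam c" "coord c p" n k]
    by (simp_all add: ordp_iff[OF c] o_def)
qed

lemma ordp_nonzero: "ordp F p n \<Longrightarrow> \<forall>\<^sub>F q in at p. F q \<noteq> 0"
proof -
  obtain c where c: "c \<in> A" "p \<in> cdom c" by (rule chart_exists)
  show "ordp F p n \<Longrightarrow> \<forall>\<^sub>F q in at p. F q \<noteq> 0"
    using ord_at_nonzero[of "F \<circ> cparam c" "coord c p" n]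
    by (simp add: ordp_iff[OF c] eventually_chart[OF c])
qed

lemma ordp_nonneg_tendsto:
  assumes "ordp F p n" "0 \<le> n"
  obtains l where "(F \<longlongrightarrow> l) (at p)" "l = 0 \<longleftrightarrow> 0 < n"
proof -
  obtain c where c: "c \<in> A" "p \<in> cdom c" by (rule chart_exists)
  show thesis
    using ord_at_0_tendsto[of "F \<circ> cparam c" "coord c p" n] assms that
    by (auto simp: ordp_iff[OF c] filterlim_chart[OF c] o_def)
qed

lemma ordp_tendsto_nonneg:
  assumes "ordp F p n" "(F \<longlongrightarrow> l) (at p)"
  shows "0 \<le> n" "l = 0 \<Longrightarrow> 0 < n"
proof -
  obtain c where c: "c \<in> A" "p \<in> cdom c" by (rule chart_exists)
  show "0 \<le> n" "l = 0 \<Longrightarrow> 0 < n"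
    using ord_at_ge[of "F \<circ> cparam c" "coord c p" n 0 l] assms
    by (auto simp: ordp_iff[OF c] filterlim_chart[OF c] o_def)
qed

lemma ordp_const: "a \<noteq> 0 \<Longrightarrow> ordp (\<lambda>_. a) p 0"
proof -
  obtain c where c: "c \<in> A" "p \<in> cdom c" by (rule chart_exists)
  show "a \<noteq> 0 \<Longrightarrow> ordp (\<lambda>_. a) p 0"
    using ord_at_analytic_nonzero[of "\<lambda>_. a"] by (simp add: ordp_iff[OF c] o_def)
qed

definition merp :: "('a \<Rightarrow> complex) \<Rightarrow> 'a \<Rightarrow> bool" where
  "merp F p \<longleftrightarrow> (\<forall>\<^sub>F q in at p. F q = 0) \<or> (\<exists>n. ordp F p n)"

lemma merp_iff:
  assumes c: "c \<in> A" "p \<in> cdom c"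
  shows "merp F p \<longleftrightarrow> (F \<circ> cparam c) meromorphic_on {coord c p}"
proof
  assume "merp F p"
  thus "(F \<circ> cparam c) meromorphic_on {coord c p}" unfolding merp_def
  proof
    assume "\<forall>\<^sub>F q in at p. F q = 0"
    hence "\<forall>\<^sub>F w in at (coord c p). (F \<circ> cparam c) w = 0" using eventually_chart[OF c] by simp
    thus ?thesis by (subst meromorphic_on_cong[where g = "\<lambda>_. 0"]) auto
  qed (auto simp: ordp_iff[OF c] ord_at_imp_meromorphic)
next
  assume "(F \<circ> cparam c) meromorphic_on {coord c p}"
  thus "merp F p" using meromorphic_imp_ord_at unfolding merp_def
    by (fastforce simp: ordp_iff[OF c] eventually_chart[OF c])
qed

lemma ordp_imp_merp: "ordp F p n \<Longrightarrow> merp F p"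
  by (auto simp: merp_def)

lemma merp_diff: "merp F p \<Longrightarrow> merp G p \<Longrightarrow> merp (\<lambda>q. F q - G q) p"
  and merp_mult: "merp F p \<Longrightarrow> merp G p \<Longrightarrow> merp (\<lambda>q. F q * G q) p"
  and merp_const: "merp (\<lambda>_. a) p"
proof -
  obtain c where c: "c \<in> A" "p \<in> cdom c" by (rule chart_exists)
  show "merp F p \<Longrightarrow> merp G p \<Longrightarrow> merp (\<lambda>q. F q - G q) p"
    "merp F p \<Longrightarrow> merp G p \<Longrightarrow> merp (\<lambda>q. F q * G q) p" "merp (\<lambda>_. a) p"
    by (auto simp: merp_iff[OF c] o_def intro!: meromorphic_intros)
qed

lemma meromorphic_zero_or_ordp:
  assumes "\<And>p. merp F p"
  shows "(\<forall>p. \<forall>\<^sub>F q in at p. F q = 0) \<or> (\<forall>p. \<exists>n. ordp F p n)"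
proof -
  have "(\<forall>\<^sub>F q in at p. F q = 0) \<or> (\<forall>\<^sub>F q in at p. F q \<noteq> 0)" for p
    using assms[of p] ordp_nonzero unfolding merp_def by blast
  from locally_determined_imp_constant[of "\<lambda>q. F q = 0", OF this]
  show ?thesis
  proof
    assume a: "\<forall>p. \<forall>\<^sub>F q in at p. F q \<noteq> 0"
    have "\<exists>n. ordp F p n" for p
    proof (rule ccontr)
      assume "\<nexists>n. ordp F p n"
      hence "\<forall>\<^sub>F q in at p. F q = 0" using assms[of p] by (simp add: merp_def)
      with a[rule_format, of p] have "\<forall>\<^sub>F q in at p. False" by eventually_elim simp
      thus False by simp
    qed
    thus ?thesis by blast
  qed blast
qed

end

lemma nicely_meromorphic_on_transfer:
  assumes "f nicely_meromorphic_on S" "open S" "\<And>z. z \<in> S \<Longrightarrow> f z = g z"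
  shows "g nicely_meromorphic_on S"
proof -
  have ev: "\<forall>\<^sub>F w in at z. f w = g w" if "z \<in> S" for z
    using eventually_at_in_open'[OF assms(2) that] by eventually_elim (use assms(3) in auto)
  have "g meromorphic_on S"
    using assms(1) meromorphic_on_cong[of S f g S] ev by (simp add: nicely_meromorphic_on_def)
  moreover have "is_pole g z \<and> g z = 0 \<or> (g \<longlongrightarrow> g z) (at z)" if z: "z \<in> S" for z
  proof -
    have "is_pole f z \<and> f z = 0 \<or> (f \<longlongrightarrow> f z) (at z)"
      using assms(1) z by (simp add: nicely_meromorphic_on_def)
    thus ?thesis
      using is_pole_cong[OF ev[OF z] refl] tendsto_cong[OF ev[OF z], of "g z"] assms(3)[OF z] by simp
  qed
  ultimately show ?thesis by (simp add: nicely_meromorphic_on_def)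
qed

section \<open>The maximum principle on a compact surface\<close>

context riemann_surface
begin

lemma ordp_nonneg_analytic:
  assumes "ordp F p n" "0 \<le> n" "c \<in> A" "p \<in> cdom c"
  obtains u where "u analytic_on {coord c p}" "\<forall>\<^sub>F q in at p. F q = u (coord c q)"
proof -
  have "ord_at (F \<circ> cparam c) (coord c p) n" using assms by (simp add: ordp_iff)
  then obtain u where u: "u analytic_on {coord c p}"
    "\<forall>\<^sub>F w in at (coord c p). (F \<circ> cparam c) w = u w * (w - coord c p) powi n"
    unfolding ord_at_def by blast
  let ?v = "\<lambda>w. u w * (w - coord c p) ^ nat n"
  have "?v analytic_on {coord c p}" using u(1) by (intro analytic_intros)
  moreover from eventually_in_image[OF assms(3,4)]
  have "\<forall>\<^sub>F w in at (coord c p). F (cparam c w) = ?v (coord c (cparam c w))"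
    using u(2) by eventually_elim (use assms(2,3) in \<open>simp add: coord_cparam power_int_def\<close>)
  hence "\<forall>\<^sub>F q in at p. F q = ?v (coord c q)"
    by (simp only: eventually_chart[OF assms(3,4)])
  ultimately show thesis by (rule that)
qed

text \<open>A function without poles is a nonzero constant and hence has no zeros. This takes the
  place of the statement that principal divisors have degree 0.\<close>

lemma ordp_maximum_principle:
  assumes E: "\<And>p. ordp F p (E p)" and nonneg: "\<And>p. 0 \<le> E p"
  shows "E p = 0"
proof -
  \<comment> \<open>An order says nothing about the value of \<open>F\<close> at the point itself,
    so \<open>F\<close> need not be continuous; \<open>G\<close> is its continuous extension across
    the removable singularities.\<close>
  define G where "G p = Lim (at p) F" for p
  have lim: "(F \<longlongrightarrow> G p) (at p)" for p
  proof -
    obtain l where "(F \<longlongrightarrow> l) (at p)" using ordp_nonneg_tendsto[OF E nonneg] by blast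
    thus ?thesis unfolding G_def using tendsto_Lim[of "at p" F l] by simp
  qed
  have loc: "\<exists>u. u analytic_on {coord c p} \<and> (\<forall>\<^sub>F q in nhds p. G q = u (coord c q)) \<and>
                 (\<forall>\<^sub>F q in at p. F q = u (coord c q))" if c: "c \<in> A" "p \<in> cdom c" for c p
  proof -
    obtain u where u: "u analytic_on {coord c p}" "\<forall>\<^sub>F q in at p. F q = u (coord c q)"
      by (rule ordp_nonneg_analytic[OF E nonneg c])
    obtain S where S: "open S" "coord c p \<in> S" "u holomorphic_on S" using u(1) by (auto simp: analytic_at)
    obtain U where U: "open U" "p \<in> U" "\<And>q. q \<in> U \<Longrightarrow> q \<noteq> p \<Longrightarrow> F q = u (coord c q)"
      using u(2) unfolding eventually_at_topological by auto
    have cc: "continuous_on (cdom c) (coord c)"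
      using chart_props(3)[OF c(1)] by (simp add: homeomorphism_def)
    define W where "W = U \<inter> (cdom c \<inter> coord c -` S)"
    have "open (cdom c \<inter> coord c -` S)"
      using continuous_on_open_vimage[OF chart_props(1)[OF c(1)], of "coord c"] cc S(1)
      by (simp add: Int_commute)
    hence W: "open W" "p \<in> W" using U S c by (auto simp: W_def)
    have "G q = u (coord c q)" if q: "q \<in> W" for q
    proof -
      have qc: "q \<in> cdom c" "coord c q \<in> S" using q by (auto simp: W_def)
      have "isCont u (coord c q)"
        using S qc by (meson continuous_on_eq_continuous_at holomorphic_on_imp_continuous_on)
      moreover have "(coord c \<longlongrightarrow> coord c q) (at q)"
        using cc chart_props(1)[OF c(1)] qc(1) by (metis continuous_on_eq_continuous_at isContD)
      ultimately have 1: "((\<lambda>q. u (coord c q)) \<longlongrightarrow> u (coord c q)) (at q)"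
        by (rule isCont_tendsto_compose)
      have "\<forall>\<^sub>F r in at q. F r = u (coord c r)"
      proof (cases "q = p")
        case False
        have "\<forall>\<^sub>F r in at q. r \<in> W - {p}"
          by (rule eventually_at_in_open') (use W q False in auto)
        thus ?thesis by eventually_elim (use U(3) in \<open>auto simp: W_def\<close>)
      qed (use u(2) in simp)
      hence "(F \<longlongrightarrow> u (coord c q)) (at q)" using 1 tendsto_cong by fastforce
      thus ?thesis using lim[of q] tendsto_unique[OF at_neq_bot_surface] by blast
    qed
    hence "\<forall>\<^sub>F q in nhds p. G q = u (coord c q)" using W unfolding eventually_nhds by blast
    with u show ?thesis by blast
  qed
  have contG: "continuous_on UNIV G"
    unfolding continuous_on_def
  proof
    fix p
    obtain c where c: "c \<in> A" "p \<in> cdom c" by (rule chart_exists)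
    obtain u where u: "\<forall>\<^sub>F q in nhds p. G q = u (coord c q)" "\<forall>\<^sub>F q in at p. F q = u (coord c q)"
      using loc[OF c] by blast
    have "\<forall>\<^sub>F q in at p. F q = G q"
      using u(2) eventually_nhds_conv_at[THEN iffD1, OF u(1), THEN conjunct1] by eventually_elim simp
    thus "(G \<longlongrightarrow> G p) (at p within UNIV)" using lim[of p] tendsto_cong by fastforce
  qed
  have "compact (UNIV :: 'a set)" using surf by (simp add: compact_riemann_surface_def)
  then obtain p0 where p0: "\<And>q. cmod (G q) \<le> cmod (G p0)"
    using continuous_attains_sup[of UNIV "\<lambda>q. cmod (G q)"] contG continuous_on_norm by blast
  obtain c where c: "c \<in> A" "p0 \<in> cdom c" by (rule chart_exists)
  obtain u where u: "u analytic_on {coord c p0}" "\<forall>\<^sub>F q in nhds p0. G q = u (coord c q)"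
      "\<forall>\<^sub>F q in at p0. F q = u (coord c q)"
    using loc[OF c] by blast
  have up: "u (coord c p0) = G p0" using eventually_nhds_x_imp_x[OF u(2)] by simp
  obtain S where S: "open S" "coord c p0 \<in> S" "u holomorphic_on S" using u(1) by (auto simp: analytic_at)
  obtain W where W: "open W" "p0 \<in> W" "\<And>q. q \<in> W \<Longrightarrow> G q = u (coord c q)"
    using u(2) unfolding eventually_nhds by blast
  have "open (coord c ` (W \<inter> cdom c))"
    by (rule open_coord_image) (use c W chart_props(1)[OF c(1)] in auto)
  then obtain r where r: "r > 0" "ball (coord c p0) r \<subseteq> S \<inter> coord c ` (W \<inter> cdom c)"
    using S W(2) c(2) by (metis (no_types, lifting) IntI image_eqI open_Int openE)
  have "u constant_on ball (coord c p0) r"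
  proof (rule maximum_modulus_principle[where U = "ball (coord c p0) r" and \<xi> = "coord c p0"])
    fix w assume "w \<in> ball (coord c p0) r"
    then obtain q where "q \<in> W" "w = coord c q" using r(2) by blast
    thus "cmod (u w) \<le> cmod (u (coord c p0))" using W(3) p0 up by metis
  qed (use r S in \<open>auto intro: holomorphic_on_subset\<close>)
  hence uc: "u w = G p0" if "w \<in> ball (coord c p0) r" for w
    using that up r(1) unfolding constant_on_def by (metis centre_in_ball)
  have "\<forall>\<^sub>F w in at (coord c p0). w \<in> ball (coord c p0) r \<inter> coord c ` cdom c"
    by (rule eventually_at_in_open') (use r(1) c chart_props(2)[OF c(1)] in auto)
  hence "\<forall>\<^sub>F w in at (coord c p0). u (coord c (cparam c w)) = G p0"
    by eventually_elim (use c uc in \<open>simp add: coord_cparam\<close>)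
  hence "\<forall>\<^sub>F q in at p0. u (coord c q) = G p0"
    by (simp only: eventually_chart[OF c])
  with u(3) have z: "\<forall>\<^sub>F q in at p0. F q - G p0 = 0" by eventually_elim simp
  have "\<And>p. merp (\<lambda>q. F q - G p0) p"
    by (intro merp_diff merp_const ordp_imp_merp[OF E])
  from meromorphic_zero_or_ordp[OF this] have ev: "\<forall>\<^sub>F q in at p. F q - G p0 = 0" for p
  proof
    assume "\<forall>p. \<exists>n. ordp (\<lambda>q. F q - G p0) p n"
    then obtain n where "ordp (\<lambda>q. F q - G p0) p0 n" by blast
    from ordp_nonzero[OF this] z have "\<forall>\<^sub>F q in at p0. False" by eventually_elim simp
    thus ?thesis by simp
  qed blast
  \<comment> \<open>The constant cannot be 0, since a function possessing an order does not vanish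
    near the point.\<close>
  have "G p0 \<noteq> 0"
  proof
    assume "G p0 = 0"
    hence "\<forall>\<^sub>F q in at p. F q = 0" using ev[of p] by simp
    with ordp_nonzero[OF E[of p]] have "\<forall>\<^sub>F q in at p. False" by eventually_elim simp
    thus False by simp
  qed
  moreover have "\<forall>\<^sub>F q in at p. G p0 = F q" using ev[of p] by eventually_elim simp
  ultimately have "ordp F p 0" by (rule ordp_cong[OF ordp_const])
  thus ?thesis using ordp_unique[OF E] by blast
qed

subsection \<open>Sections of line bundles\<close>

text \<open>What sections need from a cocycle, shared by \<open>\<xi>\<close> and the canonical
  bundle. Convergence is required separately because an order does not see the value at the
  point.\<close>

definition regular_cocycle :: "('a chart \<Rightarrow> 'a chart \<Rightarrow> 'a \<Rightarrow> complex) \<Rightarrow> bool" where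
  "regular_cocycle t \<longleftrightarrow> (\<forall>c\<in>A. \<forall>d\<in>A. \<forall>p\<in>cdom c \<inter> cdom d.
      t c d p \<noteq> 0 \<and> ordp (t c d) p 0 \<and> ((t c d) \<longlongrightarrow> t c d p) (at p))"

lemma analytic_nonzero_ordp:
  assumes "c \<in> A" "p \<in> cdom c" "(F \<circ> cparam c) analytic_on {coord c p}" "F p \<noteq> 0"
  shows "ordp F p 0" "(F \<longlongrightarrow> F p) (at p)"
proof -
  have v: "(F \<circ> cparam c) (coord c p) = F p" using assms by (simp add: cparam_coord)
  show "ordp F p 0"
    using ord_at_analytic_nonzero[OF assms(3)] v assms(4) by (simp add: ordp_iff[OF assms(1,2)])
  have "((F \<circ> cparam c) \<longlongrightarrow> F p) (at (coord c p))"
    using analytic_at_imp_isCont[OF assms(3)] v isCont_def by metis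
  thus "(F \<longlongrightarrow> F p) (at p)" by (simp add: filterlim_chart[OF assms(1,2)] o_def)
qed

lemma line_bundle_regular: "line_bundle A t \<Longrightarrow> regular_cocycle t"
  unfolding regular_cocycle_def
proof (intro ballI conjI)
  fix c d p assume t: "line_bundle A t" and cd: "c \<in> A" "d \<in> A" and p: "p \<in> cdom c \<inter> cdom d"
  show nz: "t c d p \<noteq> 0" using t cd p by (simp add: line_bundle_def)
  have "(t c d \<circ> cparam d) holomorphic_on (coord d ` (cdom c \<inter> cdom d))"
    using t cd unfolding line_bundle_def by blast
  moreover have "open (coord d ` (cdom c \<inter> cdom d))"
    by (rule open_coord_image) (use cd chart_props(1)[OF cd(1)] chart_props(1)[OF cd(2)] in auto)
  ultimately have "(t c d \<circ> cparam d) analytic_on {coord d p}"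
    using p by (auto simp: analytic_at)
  with nz show "ordp (t c d) p 0" "((t c d) \<longlongrightarrow> t c d p) (at p)"
    using analytic_nonzero_ordp[of d p] cd p by blast+
qed

lemma chart_deriv_regular:
  assumes "holomorphic_self_map A \<Phi>" "\<Phi> \<circ> \<Phi> = id" "c \<in> A" "d \<in> A" "p \<in> cdom c" "\<Phi> p \<in> cdom d"
  shows "chart_deriv \<Phi> c d p \<noteq> 0" "ordp (chart_deriv \<Phi> c d) p 0"
    "((chart_deriv \<Phi> c d) \<longlongrightarrow> chart_deriv \<Phi> c d p) (at p)"
proof -
  show nz: "chart_deriv \<Phi> c d p \<noteq> 0"
    using chart_deriv_involution_nonzero[OF assms] by (metis mult_zero_right zero_neq_one)
  let ?S = "coord c ` (cdom c \<inter> \<Phi> -` cdom d)"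
  have "deriv (coord d \<circ> \<Phi> \<circ> cparam c) holomorphic_on ?S"
    by (rule holomorphic_deriv) (rule chart_map_holomorphic[OF assms(1,3,4)])+
  moreover have "(chart_deriv \<Phi> c d \<circ> cparam c) w = deriv (coord d \<circ> \<Phi> \<circ> cparam c) w" if "w \<in> ?S" for w
  proof -
    have "w \<in> coord c ` cdom c" using that by blast
    thus ?thesis unfolding chart_deriv_def comp_def by (simp add: coord_cparam[OF assms(3)])
  qed
  ultimately have "(chart_deriv \<Phi> c d \<circ> cparam c) holomorphic_on ?S"
    using holomorphic_cong by metis
  hence "(chart_deriv \<Phi> c d \<circ> cparam c) analytic_on {coord c p}"
    using chart_map_holomorphic(2)[OF assms(1,3,4)] assms(5,6) unfolding analytic_at by blast
  with nz show "ordp (chart_deriv \<Phi> c d) p 0"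
    "((chart_deriv \<Phi> c d) \<longlongrightarrow> chart_deriv \<Phi> c d p) (at p)"
    using analytic_nonzero_ordp[of c p] assms by blast+
qed

lemma canonical_bundle_regular: "regular_cocycle canonical_bundle"
  unfolding regular_cocycle_def
proof (intro ballI)
  fix c d p assume cd: "c \<in> A" "d \<in> A" and p: "p \<in> cdom c \<inter> cdom d"
  have e: "chart_deriv id c d = canonical_bundle c d" by (rule ext) (rule chart_deriv_id)
  show "canonical_bundle c d p \<noteq> 0 \<and> ordp (canonical_bundle c d) p 0 \<and>
      (canonical_bundle c d \<longlongrightarrow> canonical_bundle c d p) (at p)"
    using chart_deriv_regular[OF holomorphic_self_map_id, of c d p] cd p unfolding e by simp
qed

text \<open>Pointwise products and quotients have accidental values at zeros and poles.
  \<open>remove_sings\<close> puts in limits and the value 0 at poles, as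
  \<open>nicely_meromorphic_on\<close> demands; the value 0 outside the chart is the convention of
  \<open>holomorphic_sections\<close>.\<close>

definition normalise :: "('a chart \<Rightarrow> 'a \<Rightarrow> complex) \<Rightarrow> 'a chart \<Rightarrow> 'a \<Rightarrow> complex" where
  "normalise \<sigma> c p =
     (if c \<in> A \<and> p \<in> cdom c then remove_sings (\<sigma> c \<circ> cparam c) (coord c p) else 0)"

lemma normalise_limit:
  assumes "c \<in> A" "p \<in> cdom c" "(\<sigma> c \<longlongrightarrow> l) (at p)"
  shows "normalise \<sigma> c p = l"
  using assms remove_sings_eqI[of "\<sigma> c \<circ> cparam c" l "coord c p"]
  by (simp add: normalise_def filterlim_chart[OF assms(1,2)] o_def)

lemma normalise_pole:
  assumes "c \<in> A" "p \<in> cdom c" "ordp (\<sigma> c) p n" "n < 0"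
  shows "normalise \<sigma> c p = 0"
  using assms ord_at_pole_iff[of "\<sigma> c \<circ> cparam c" "coord c p" n]
  by (simp add: normalise_def ordp_iff[OF assms(1,2)])

lemma normalise_eq:
  assumes "c \<in> A" "w \<in> coord c ` cdom c"
  shows "(normalise \<sigma> c \<circ> cparam c) w = remove_sings (\<sigma> c \<circ> cparam c) w"
  using assms by (simp add: normalise_def coord_cparam cparam_in)

lemma normalise_section:
  assumes t: "regular_cocycle t"
    and tr: "\<And>c d q. c \<in> A \<Longrightarrow> d \<in> A \<Longrightarrow> q \<in> cdom c \<Longrightarrow> q \<in> cdom d \<Longrightarrow> \<sigma> c q = t c d q * \<sigma> d q"
    and E: "\<And>c p. c \<in> A \<Longrightarrow> p \<in> cdom c \<Longrightarrow> ordp (\<sigma> c) p (E p)"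
  shows "meromorphic_section A t (normalise \<sigma>)"
    and "c \<in> A \<Longrightarrow> p \<in> cdom c \<Longrightarrow> ordp (normalise \<sigma> c) p (E p)"
    and "(\<And>p. 0 \<le> E p) \<Longrightarrow> normalise \<sigma> \<in> holomorphic_sections A t"
    and "c \<in> A \<Longrightarrow> p \<in> cdom c \<Longrightarrow> 0 \<le> E p \<Longrightarrow> normalise \<sigma> c p = 0 \<longleftrightarrow> 0 < E p"
proof -
  have mer: "(\<sigma> c \<circ> cparam c) meromorphic_on (coord c ` cdom c)" if c: "c \<in> A" for c
    unfolding meromorphic_on_meromorphic_at[of _ "coord c ` cdom c"]
    using merp_iff[OF c] ordp_imp_merp[OF E[OF c]] by blast
  have nice: "(normalise \<sigma> c \<circ> cparam c) nicely_meromorphic_on (coord c ` cdom c)" if c: "c \<in> A" for c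
    by (rule nicely_meromorphic_on_transfer[OF remove_sings_nicely_meromorphic[OF mer[OF c]] chart_props(2)[OF c]])
       (rule normalise_eq[OF c, symmetric])
  \<comment> \<open>At nonnegative order the law passes to the limit; at a pole both sides are 0 by
    convention.\<close>
  have trans: "normalise \<sigma> c p = t c d p * normalise \<sigma> d p"
    if cd: "c \<in> A" "d \<in> A" and p: "p \<in> cdom c \<inter> cdom d" for c d p
  proof (cases "0 \<le> E p")
    case True
    have pd: "p \<in> cdom d" and pc: "p \<in> cdom c" using p by auto
    obtain l where l: "(\<sigma> d \<longlongrightarrow> l) (at p)" using ordp_nonneg_tendsto[OF E[OF cd(2) pd] True] by blast
    have "((t c d) \<longlongrightarrow> t c d p) (at p)" using t cd p by (simp add: regular_cocycle_def)
    hence "((\<lambda>q. t c d q * \<sigma> d q) \<longlongrightarrow> t c d p * l) (at p)" using l by (rule tendsto_mult)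
    moreover have "\<forall>\<^sub>F q in at p. t c d q * \<sigma> d q = \<sigma> c q"
      using eventually_in_cdom[OF cd(1) pc] eventually_in_cdom[OF cd(2) pd]
      by eventually_elim (use tr[OF cd] in simp)
    ultimately have "(\<sigma> c \<longlongrightarrow> t c d p * l) (at p)" by (rule Lim_transform_eventually)
    thus ?thesis using normalise_limit[where \<sigma> = \<sigma>] l cd pc pd by metis
  next
    case False
    thus ?thesis using normalise_pole[of c p \<sigma> "E p"] normalise_pole[of d p \<sigma> "E p"] E cd p by simp
  qed
  show "meromorphic_section A t (normalise \<sigma>)"
    unfolding meromorphic_section_def using nice trans by blast
  show ordn: "ordp (normalise \<sigma> c) p (E p)" if c: "c \<in> A" "p \<in> cdom c" for c p
  proof -
    have "(\<sigma> c \<circ> cparam c) meromorphic_on {coord c p}"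
      using merp_iff[OF c] ordp_imp_merp[OF E[OF c]] by blast
    hence "\<forall>\<^sub>F w in at (coord c p). remove_sings (\<sigma> c \<circ> cparam c) w = (\<sigma> c \<circ> cparam c) w"
      by (intro eventually_remove_sings_eq_at) (simp add: meromorphic_at_iff)
    moreover note eventually_in_image[OF c]
    ultimately have "\<forall>\<^sub>F w in at (coord c p). (\<sigma> c \<circ> cparam c) w = (normalise \<sigma> c \<circ> cparam c) w"
      by eventually_elim (use normalise_eq[OF c(1)] in metis)
    thus ?thesis using ord_at_cong E[OF c] by (simp add: ordp_iff[OF c])
  qed
  show "normalise \<sigma> \<in> holomorphic_sections A t" if nn: "\<And>p. 0 \<le> E p"
  proof -
    have "(normalise \<sigma> c \<circ> cparam c) holomorphic_on (coord c ` cdom c)" if c: "c \<in> A" for c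
    proof (rule analytic_imp_holomorphic, rule nicely_meromorphic_without_singularities[OF nice[OF c]], safe)
      fix p assume p: "p \<in> cdom c" "is_pole (normalise \<sigma> c \<circ> cparam c) (coord c p)"
      have "E p < 0"
        using ord_at_pole_iff[of "normalise \<sigma> c \<circ> cparam c" "coord c p" "E p"] ordn[OF c p(1)] p(2)
        by (simp add: ordp_iff[OF c p(1)])
      thus False using nn[of p] by simp
    qed
    moreover have "\<forall>c p. c \<notin> A \<or> p \<notin> cdom c \<longrightarrow> normalise \<sigma> c p = 0"
      unfolding normalise_def by metis
    ultimately show ?thesis unfolding holomorphic_sections_def using trans by blast
  qed
  show "normalise \<sigma> c p = 0 \<longleftrightarrow> 0 < E p" if c: "c \<in> A" "p \<in> cdom c" and nn: "0 \<le> E p" for c p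
  proof -
    obtain l where l: "(\<sigma> c \<longlongrightarrow> l) (at p)" "l = 0 \<longleftrightarrow> 0 < E p"
      using ordp_nonneg_tendsto[OF E[OF c] nn] by blast
    thus ?thesis using normalise_limit[where \<sigma> = \<sigma>, OF c l(1)] by simp
  qed
qed

end

section \<open>Dimensions of spaces of sections\<close>

interpretation section_space: vector_space scale_section
  by unfold_locales (rule ext, rule ext, simp add: scale_section_def algebra_simps)+

lemma has_h0_0: "has_h0 A t 0 \<Longrightarrow> holomorphic_sections A t = {0}"
proof -
  assume "has_h0 A t 0"
  then obtain B where B: "finite B" "card B = 0" "section_space.span B = holomorphic_sections A t"
    unfolding has_h0_def by blast
  hence "B = {}" by simp
  with B(3) show ?thesis by (metis section_space.span_empty)
qed

text \<open>The matrix of values of the sections at the chosen points is diagonal with nonzero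
  diagonal entries, so the sections are linearly independent.\<close>

lemma has_h0_bound:
  assumes "has_h0 A t n" "finite I"
    and "\<And>i. i \<in> I \<Longrightarrow> s i \<in> holomorphic_sections A t"
    and "\<And>i j. i \<in> I \<Longrightarrow> j \<in> I \<Longrightarrow> s i (c j) (x j) = 0 \<longleftrightarrow> i \<noteq> j"
  shows "card I \<le> n"
proof -
  obtain B where B: "finite B" "card B = n" "section_space.span B = holomorphic_sections A t"
    using assms(1) unfolding has_h0_def by blast
  have inj: "inj_on s I"
    by (rule inj_onI) (metis assms(4))
  have "section_space.independent (s ` I)"
  proof (rule section_space.independent_if_scalars_zero)
    show "finite (s ` I)" using assms(2) by simp
    fix f v assume z: "(\<Sum>v\<in>s ` I. scale_section (f v) v) = 0" and "v \<in> s ` I"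
    then obtain j where j: "j \<in> I" "v = s j" by blast
    have ev: "(\<Sum>i\<in>K. h i) a b = (\<Sum>i\<in>K. h i a b)"
      for h :: "'b \<Rightarrow> 'a chart \<Rightarrow> 'a \<Rightarrow> complex" and K a b
      by (induction K rule: infinite_finite_induct) auto
    have "(\<Sum>i\<in>I. scale_section (f (s i)) (s i)) = 0"
      using z inj by (simp add: sum.reindex)
    hence "(\<Sum>i\<in>I. scale_section (f (s i)) (s i)) (c j) (x j) = 0" by simp
    hence "(\<Sum>i\<in>I. f (s i) * s i (c j) (x j)) = 0"
      unfolding ev by (simp add: scale_section_def)
    moreover have "(\<Sum>i\<in>I. f (s i) * s i (c j) (x j)) = (\<Sum>i\<in>I. if i = j then f (s i) * s i (c j) (x j) else 0)"
      by (rule sum.cong) (use assms(4) j in auto)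
    ultimately have "f (s j) * s j (c j) (x j) = 0" using assms(2) j(1) by (simp add: sum.delta')
    thus "f v = 0" using assms(4)[OF j(1) j(1)] j(2) by simp
  qed
  moreover have "s ` I \<subseteq> section_space.span B" using assms(3) B(3) by blast
  ultimately have "card (s ` I) \<le> card B"
    using section_space.independent_span_bound[OF B(1)] by blast
  thus ?thesis using B(2) card_image[OF inj] by simp
qed

section \<open>Discreteness and finiteness of zeros and poles\<close>

context riemann_surface
begin

lemma merp_tendsto_nonzero:
  assumes "merp F p" "(F \<longlongrightarrow> l) (at p)" "l \<noteq> 0"
  shows "ordp F p 0"
proof -
  have "\<not> (\<forall>\<^sub>F q in at p. F q = 0)"
  proof
    assume "\<forall>\<^sub>F q in at p. F q = 0"
    hence "(F \<longlongrightarrow> 0) (at p)" by (rule tendsto_eventually)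
    thus False using assms(2,3) tendsto_unique[OF at_neq_bot_surface] by blast
  qed
  then obtain n where n: "ordp F p n" using assms(1) by (auto simp: merp_def)
  have nn: "0 \<le> n" by (rule ordp_tendsto_nonneg(1)[OF n assms(2)])
  obtain l' where l': "(F \<longlongrightarrow> l') (at p)" "l' = 0 \<longleftrightarrow> 0 < n" by (rule ordp_nonneg_tendsto[OF n nn])
  have "l' = l" using l'(1) assms(2) tendsto_unique[OF at_neq_bot_surface] by blast
  thus ?thesis using l'(2) assms(3) nn n by (cases "n = 0") auto
qed

lemma ordp_eventually_0:
  assumes "ordp F p n"
  shows "\<forall>\<^sub>F q in at p. ordp F q 0"
proof -
  obtain c where c: "c \<in> A" "p \<in> cdom c" by (rule chart_exists)
  let ?z = "coord c p"
  obtain u where u: "u analytic_on {?z}" "u ?z \<noteq> 0"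
    "\<forall>\<^sub>F w in at ?z. (F \<circ> cparam c) w = u w * (w - ?z) powi n"
    using assms unfolding ordp_iff[OF c] ord_at_def by blast
  obtain S where S: "open S" "?z \<in> S" "u holomorphic_on S" using u(1) by (auto simp: analytic_at)
  obtain T where T: "open T" "?z \<in> T" "\<And>w. w \<in> T \<Longrightarrow> u w \<noteq> 0"
    using analytic_at_nonzero_eventually[OF u(1,2)] unfolding eventually_nhds by blast
  obtain W where W: "open W" "?z \<in> W" "\<And>w. w \<in> W \<Longrightarrow> w \<noteq> ?z \<Longrightarrow> (F \<circ> cparam c) w = u w * (w - ?z) powi n"
    using u(3) unfolding eventually_at_topological by blast
  define X where "X = S \<inter> T \<inter> W \<inter> coord c ` cdom c"
  have X: "open X" "?z \<in> X" using S T W c chart_props(2)[OF c(1)] by (auto simp: X_def)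
  have "ordp F (cparam c w) 0" if w: "w \<in> X" "w \<noteq> ?z" for w
  proof -
    have wc: "w \<in> coord c ` cdom c" using w(1) by (simp add: X_def)
    have "ord_at (\<lambda>w. u w * (w - ?z) powi n) w 0"
    proof (rule ord_at_analytic_nonzero)
      have "u analytic_on {w}" using S w(1) unfolding analytic_at X_def by blast
      thus "(\<lambda>w. u w * (w - ?z) powi n) analytic_on {w}"
        using w(2) by (intro analytic_intros) auto
      show "u w * (w - ?z) powi n \<noteq> 0" using T(3) w by (simp add: X_def)
    qed
    moreover have "\<forall>\<^sub>F v in at w. v \<in> X - {?z}"
      by (rule eventually_at_in_open') (use X w in auto)
    hence "\<forall>\<^sub>F v in at w. u v * (v - ?z) powi n = (F \<circ> cparam c) v"
      by eventually_elim (use W(3) in \<open>auto simp: X_def\<close>)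
    ultimately have "ord_at (F \<circ> cparam c) w 0" by (rule ord_at_cong)
    thus ?thesis
      by (simp add: ordp_iff[OF c(1) cparam_in[OF c(1) wc]] coord_cparam[OF c(1) wc])
  qed
  moreover have "\<forall>\<^sub>F w in at ?z. w \<in> X - {?z}"
    using eventually_at_in_open'[OF X] eventually_neq_at_within[of ?z ?z] by eventually_elim simp
  ultimately have "\<forall>\<^sub>F w in at ?z. ordp F (cparam c w) 0"
    by (auto elim: eventually_mono)
  thus ?thesis by (simp only: eventually_chart[OF c])
qed

text \<open>Each point has a neighbourhood containing at most itself from the support; compactness
  selects finitely many.\<close>

lemma finite_support:
  assumes "\<And>p::'a. \<forall>\<^sub>F q in at p. E q = (0::int)"
  shows "finite {p. E p \<noteq> 0}"
proof -
  have "\<exists>U. open U \<and> p \<in> U \<and> (\<forall>q\<in>U. q \<noteq> p \<longrightarrow> E q = 0)" for p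
    using assms[of p] unfolding eventually_at_topological by blast
  then obtain U where U: "\<And>p. open (U p)" "\<And>p. p \<in> U p" "\<And>p q. q \<in> U p \<Longrightarrow> q \<noteq> p \<Longrightarrow> E q = 0"
    by metis
  have "compact (UNIV :: 'a set)" using surf by (simp add: compact_riemann_surface_def)
  then obtain C where C: "finite C" "UNIV \<subseteq> (\<Union>p\<in>C. U p)"
    by (rule compactE_image[of UNIV UNIV U]) (use U in auto)
  have "{p. E p \<noteq> 0} \<subseteq> C" using C(2) U(3) by blast
  thus ?thesis using C(1) finite_subset by blast
qed

lemma ordp_finite_support:
  assumes "\<And>p. ordp F p (E p)"
  shows "finite {p. E p \<noteq> 0}"
proof (rule finite_support)
  fix p show "\<forall>\<^sub>F q in at p. E q = 0"
    using ordp_eventually_0[OF assms[of p]] by eventually_elim (use assms ordp_unique in blast)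
qed

end

section \<open>Hyperelliptic surfaces\<close>

locale hyperelliptic_surface = riemann_surface +
  fixes J :: "'a \<Rightarrow> 'a"
  assumes hyp: "hyperelliptic_involution A J"
begin

lemma J_holomorphic: "holomorphic_self_map A J" and J_comp: "J \<circ> J = id" and J_not_id: "J \<noteq> id"
  using hyp by (simp_all add: hyperelliptic_involution_def)

lemma J_J [simp]: "J (J p) = p"
  using J_comp by (metis comp_apply id_apply)

lemma J_tendsto: "(J \<longlongrightarrow> J p) (at p)"
  using J_holomorphic unfolding holomorphic_self_map_def continuous_on_def by blast

lemma J_filterlim: "filterlim J (at (J p)) (at p)"
proof -
  have "\<forall>\<^sub>F q in at p. J q \<noteq> J p"
    using eventually_neq_at_within[of p p] by eventually_elim (metis J_J)
  thus ?thesis using J_tendsto by (simp add: filterlim_at)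
qed

lemma ordp_J: "ordp F (J p) n \<Longrightarrow> ordp (F \<circ> J) p n"
  by (rule ordp_comp[OF J_holomorphic J_comp])

lemma eventually_J: "(\<forall>\<^sub>F q in at (J p). Pr q) \<Longrightarrow> \<forall>\<^sub>F q in at p. Pr (J q)"
  using J_filterlim unfolding filterlim_iff by blast

lemma eventually_in_chart_preimage:
  assumes "c \<in> A" "d \<in> A" "p \<in> cdom c" "J p \<in> cdom d"
  shows "\<forall>\<^sub>F q in at p. q \<in> cdom c \<and> J q \<in> cdom d"
  using eventually_in_cdom[OF assms(1,3)] eventually_J[OF eventually_in_cdom[OF assms(2,4)]]
  by eventually_elim simp

lemma eventually_fixed_chart:
  assumes "J p = p" "c \<in> A" "p \<in> cdom c"
  shows "\<forall>\<^sub>F w in at (coord c p). cparam c (coord c (J (cparam c w))) = J (cparam c w)"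
proof -
  have "\<forall>\<^sub>F q in at p. cparam c (coord c (J q)) = J q"
    using eventually_in_chart_preimage[OF assms(2,2,3)] assms cparam_coord[OF assms(2)]
    by (auto elim: eventually_mono)
  thus ?thesis by (simp only: eventually_chart[OF assms(2,3)])
qed

text \<open>The identity theorem for \<open>J\<close>: near a fixed point \<open>J w - w\<close> is
  analytic in a chart, near any other point the Hausdorff property separates \<open>p\<close> from
  \<open>J p\<close>. If \<open>J\<close> were the identity near some point, it would be the
  identity everywhere.\<close>

lemma J_moves_points: "\<forall>\<^sub>F q in at p. J q \<noteq> q"
proof -
  have "(\<forall>\<^sub>F q in at p. J q = q) \<or> (\<forall>\<^sub>F q in at p. J q \<noteq> q)" for p
  proof (cases "J p = p")
    case False
    obtain U W where UW: "open U" "open W" "p \<in> U" "J p \<in> W" "U \<inter> W = {}"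
      using hausdorff[of p "J p"] False by metis
    have "\<forall>\<^sub>F q in at p. q \<in> U" using UW by (intro eventually_at_in_open') auto
    moreover have "\<forall>\<^sub>F q in at p. J q \<in> W" by (rule topological_tendstoD[OF J_tendsto UW(2,4)])
    ultimately have "\<forall>\<^sub>F q in at p. J q \<noteq> q" by eventually_elim (use UW(5) in auto)
    thus ?thesis ..
  next
    case True
    obtain c where c: "c \<in> A" "p \<in> cdom c" by (rule chart_exists)
    have cJ: "J p \<in> cdom c" using True c(2) by simp
    let ?j = "coord c \<circ> J \<circ> cparam c"
    have "?j analytic_on {coord c p}" by (rule chart_map_analytic[OF J_holomorphic c(1) c(1) c(2) cJ])
    hence "(\<lambda>w. ?j w - w) analytic_on {coord c p}" by (intro analytic_intros)
    from meromorphic_imp_ord_at[OF analytic_on_imp_meromorphic_on[OF this]]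
    have "(\<forall>\<^sub>F w in at (coord c p). ?j w - w = 0) \<or> (\<forall>\<^sub>F w in at (coord c p). ?j w - w \<noteq> 0)"
      using ord_at_nonzero by blast
    moreover have ev: "\<forall>\<^sub>F w in at (coord c p). ?j w - w = 0 \<longleftrightarrow> J (cparam c w) = cparam c w"
    proof -
      from eventually_fixed_chart[OF True c] eventually_in_image[OF c] show ?thesis
        by eventually_elim (metis comp_apply right_minus_eq coord_cparam[OF c(1)])
    qed
    ultimately have "(\<forall>\<^sub>F w in at (coord c p). J (cparam c w) = cparam c w) \<or>
      (\<forall>\<^sub>F w in at (coord c p). J (cparam c w) \<noteq> cparam c w)"
    proof (elim disjE)
      assume "\<forall>\<^sub>F w in at (coord c p). ?j w - w = 0"
      with ev have "\<forall>\<^sub>F w in at (coord c p). J (cparam c w) = cparam c w" by eventually_elim blast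
      thus ?thesis ..
    next
      assume "\<forall>\<^sub>F w in at (coord c p). ?j w - w \<noteq> 0"
      with ev have "\<forall>\<^sub>F w in at (coord c p). J (cparam c w) \<noteq> cparam c w" by eventually_elim blast
      thus ?thesis ..
    qed
    thus ?thesis by (simp only: eventually_chart[OF c])
  qed
  from locally_determined_imp_constant[of "\<lambda>q. J q = q", OF this]
  show ?thesis
  proof
    assume a: "\<forall>p. \<forall>\<^sub>F q in at p. J q = q"
    have "J p = id p" for p
    proof -
      have "(J \<longlongrightarrow> p) (at p)"
        by (rule Lim_transform_eventually[OF tendsto_ident_at]) (rule eventually_mono[OF a[rule_format]], simp)
      thus ?thesis using J_tendsto tendsto_unique[OF at_neq_bot_surface] by fastforce
    qed
    thus ?thesis using J_not_id by blast
  qed blast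
qed

lemma chart_deriv_fixed:
  assumes "J p = p" "c \<in> A" "p \<in> cdom c"
  shows "chart_deriv J c c p = -1"
  unfolding chart_deriv_def
proof (rule local_involution_deriv)
  have cJ: "J p \<in> cdom c" using assms by simp
  let ?j = "coord c \<circ> J \<circ> cparam c"
  show "?j analytic_on {coord c p}" by (rule chart_map_analytic[OF J_holomorphic assms(2,2,3) cJ])
  show "?j (coord c p) = coord c p" using chart_map_value[OF assms(2,3)] assms(1) by metis
  have "\<forall>\<^sub>F w in nhds (coord c p). w \<in> coord c ` (cdom c \<inter> J -` cdom c)"
    by (rule eventually_nhds_in_open[OF chart_map_holomorphic(2)[OF J_holomorphic assms(2,2)]])
       (use assms in auto)
  thus "\<forall>\<^sub>F w in nhds (coord c p). ?j (?j w) = w"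
  proof eventually_elim
    case (elim w)
    then obtain q where "q \<in> cdom c" "J q \<in> cdom c" "w = coord c q" by blast
    thus ?case by (simp add: cparam_coord[OF assms(2)])
  qed
  have "\<forall>\<^sub>F w in at (coord c p). J (cparam c w) \<noteq> cparam c w"
    using J_moves_points[of p] unfolding eventually_chart[OF assms(2,3)] .
  with eventually_fixed_chart[OF assms] show "\<forall>\<^sub>F w in at (coord c p). ?j w \<noteq> w"
    by eventually_elim auto
qed

text \<open>The factor \<open>a\<close> is 1 for functions and the derivative of \<open>J\<close> in
  a chart, with limit -1, for differentials. Thus invariant functions and anti-invariant
  differentials have even order at a branch point.\<close>

lemma ordp_parity:
  assumes "J p = p" "ordp F p n" "(a \<longlongrightarrow> \<alpha>) (at p)" "\<forall>\<^sub>F q in at p. F (J q) * a q = e * F q"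
  shows "(-1) powi n * \<alpha> = e"
proof -
  obtain c where c: "c \<in> A" "p \<in> cdom c" by (rule chart_exists)
  have cJ: "J p \<in> cdom c" using assms(1) c(2) by simp
  let ?j = "coord c \<circ> J \<circ> cparam c"
  have d: "deriv ?j (coord c p) = -1" using chart_deriv_fixed[OF assms(1) c] by (simp only: chart_deriv_def)
  have "deriv ?j (coord c p) powi n * \<alpha> = e"
  proof (rule ord_at_symmetry)
    show "ord_at (F \<circ> cparam c) (coord c p) n" using assms(2) by (simp add: ordp_iff[OF c])
    show "?j analytic_on {coord c p}" by (rule chart_map_analytic[OF J_holomorphic c(1,1,2) cJ])
    show "?j (coord c p) = coord c p" using chart_map_value[OF c] assms(1) by metis
    show "deriv ?j (coord c p) \<noteq> 0" using d by simp
    show "((\<lambda>w. a (cparam c w)) \<longlongrightarrow> \<alpha>) (at (coord c p))"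
      using assms(3) by (simp only: filterlim_chart[OF c])
    have "\<forall>\<^sub>F w in at (coord c p). F (J (cparam c w)) * a (cparam c w) = e * F (cparam c w)"
      using assms(4) unfolding eventually_chart[OF c] .
    with eventually_fixed_chart[OF assms(1) c]
    show "\<forall>\<^sub>F w in at (coord c p). (F \<circ> cparam c) (?j w) * a (cparam c w) = e * (F \<circ> cparam c) w"
      by eventually_elim simp
  qed
  thus ?thesis by (simp only: d)
qed

subsection \<open>The hyperelliptic projection\<close>

definition proj :: "'a \<Rightarrow> complex" where
  "proj = (SOME x. meromorphic_function A x \<and>
          (\<forall>Q R. sphere_value A x R = sphere_value A x Q \<longleftrightarrow> R \<in> {Q, J Q}))"

lemma proj_props: "meromorphic_function A proj"
  "sphere_value A proj R = sphere_value A proj Q \<longleftrightarrow> R \<in> {Q, J Q}"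
proof -
  have "\<exists>x. meromorphic_function A x \<and>
          (\<forall>Q R. sphere_value A x R = sphere_value A x Q \<longleftrightarrow> R \<in> {Q, J Q})"
    using hyp by (simp add: hyperelliptic_involution_def)
  from someI_ex[OF this] show "meromorphic_function A proj"
    "sphere_value A proj R = sphere_value A proj Q \<longleftrightarrow> R \<in> {Q, J Q}"
    unfolding proj_def by blast+
qed

abbreviation sv :: "'a \<Rightarrow> complex option" where "sv \<equiv> sphere_value A proj"

lemma pole_iff_chart:
  assumes "c \<in> A" "p \<in> cdom c"
  shows "is_pole (F \<circ> cparam c) (coord c p) \<longleftrightarrow> filterlim F at_infinity (at p)"
  by (simp add: is_pole_def filterlim_chart[OF assms] o_def)

lemma sv_eq: "sv p = (if filterlim proj at_infinity (at p) then None else Some (proj p))"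
proof -
  have "(\<exists>c\<in>A. p \<in> cdom c \<and> is_pole (proj \<circ> cparam c) (coord c p)) \<longleftrightarrow> filterlim proj at_infinity (at p)"
    using pole_iff_chart chart_exists by metis
  thus ?thesis unfolding sphere_value_def by simp
qed

lemma proj_nicely: "c \<in> A \<Longrightarrow> (proj \<circ> cparam c) nicely_meromorphic_on (coord c ` cdom c)"
  using proj_props(1) by (simp add: meromorphic_function_def)

lemma proj_merp: "merp proj p"
proof -
  obtain c where c: "c \<in> A" "p \<in> cdom c" by (rule chart_exists)
  have "(proj \<circ> cparam c) meromorphic_on (coord c ` cdom c)"
    using proj_nicely[OF c(1)] by (simp add: nicely_meromorphic_on_def)
  hence "(proj \<circ> cparam c) meromorphic_on {coord c p}" by (rule meromorphic_on_subset) (use c in blast)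
  thus ?thesis by (simp only: merp_iff[OF c])
qed

lemma sv_eventually_finite: "\<forall>\<^sub>F q in at p. sv q = Some (proj q)"
proof -
  obtain c where c: "c \<in> A" "p \<in> cdom c" by (rule chart_exists)
  have "isolated_singularity_at (proj \<circ> cparam c) (coord c p)"
    using proj_merp[of p] unfolding merp_iff[OF c] meromorphic_at_iff by blast
  hence "\<forall>\<^sub>F w in at (coord c p). \<not> is_pole (proj \<circ> cparam c) w"
    by (rule eventually_not_pole)
  moreover note eventually_in_image[OF c]
  ultimately have "\<forall>\<^sub>F w in at (coord c p). sv (cparam c w) = Some (proj (cparam c w))"
  proof eventually_elim
    case (elim w)
    have "\<not> filterlim proj at_infinity (at (cparam c w))"
      unfolding pole_iff_chart[OF c(1) cparam_in[OF c(1) elim(2)], of proj, symmetric]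
        coord_cparam[OF c(1) elim(2)] by (rule elim(1))
    thus ?case by (simp add: sv_eq)
  qed
  thus ?thesis by (simp only: eventually_chart[OF c])
qed

text \<open>The projection in a coordinate of the sphere centred at its value at \<open>p\<close>.\<close>

definition local_proj :: "'a \<Rightarrow> 'a \<Rightarrow> complex" where
  "local_proj p q = (if sv p = None then inverse (proj q) else proj q - proj p)"

lemma local_proj_inj: "local_proj p q = local_proj p r \<longleftrightarrow> proj q = proj r"
  by (simp add: local_proj_def)

lemma local_proj_analytic:
  assumes "c \<in> A" "p \<in> cdom c"
  shows "(local_proj p \<circ> cparam c) analytic_on {coord c p}" "local_proj p p = 0"
proof -
  let ?S = "coord c ` cdom c"
  have pS: "coord c p \<in> ?S" using assms by blast
  have "(local_proj p \<circ> cparam c) analytic_on {coord c p} \<and> local_proj p p = 0"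
  proof (cases "sv p = None")
    case True
    hence inf: "filterlim proj at_infinity (at p)" by (simp add: sv_eq split: if_splits)
    hence pole: "is_pole (proj \<circ> cparam c) (coord c p)" by (simp only: pole_iff_chart[OF assms])
    have "(\<lambda>w. inverse ((proj \<circ> cparam c) w)) nicely_meromorphic_on ?S"
      by (rule nicely_meromorphic_on_inverse[OF proj_nicely[OF assms(1)]])
    moreover have "\<not> is_pole (\<lambda>w. inverse ((proj \<circ> cparam c) w)) (coord c p)"
    proof
      assume "is_pole (\<lambda>w. inverse ((proj \<circ> cparam c) w)) (coord c p)"
      moreover have "((\<lambda>w. inverse ((proj \<circ> cparam c) w)) \<longlongrightarrow> 0) (at (coord c p))"
        using pole unfolding is_pole_def by (rule filterlim_compose[OF tendsto_inverse_0])
      ultimately show False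
        unfolding is_pole_def using not_tendsto_and_filterlim_at_infinity[OF at_neq_bot] by blast
    qed
    ultimately have "(\<lambda>w. inverse ((proj \<circ> cparam c) w)) analytic_on {coord c p}"
      using nicely_meromorphic_on_imp_analytic_at pS by blast
    moreover have "(local_proj p \<circ> cparam c) = (\<lambda>w. inverse ((proj \<circ> cparam c) w))"
      using True by (simp add: local_proj_def fun_eq_iff)
    \<comment> \<open>At its poles \<open>proj\<close> has the conventional value 0 and
      \<open>inverse 0 = 0\<close>, which happens to be the correct value of the reciprocal
      coordinate.\<close>
    moreover have "(proj \<circ> cparam c) (coord c p) = 0"
      by (rule is_pole_zero_at_nicely_mero[OF proj_nicely[OF assms(1)] pole pS])
    hence "local_proj p p = 0" using True by (simp add: local_proj_def cparam_coord[OF assms])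
    ultimately show ?thesis by (simp only: simp_thms)
  next
    case False
    hence "\<not> filterlim proj at_infinity (at p)" by (auto simp: sv_eq split: if_splits)
    hence "\<not> is_pole (proj \<circ> cparam c) (coord c p)" by (simp only: pole_iff_chart[OF assms] not_False_eq_True)
    hence "(proj \<circ> cparam c) analytic_on {coord c p}"
      using nicely_meromorphic_on_imp_analytic_at[OF proj_nicely[OF assms(1)] pS] by blast
    hence "(\<lambda>w. (proj \<circ> cparam c) w - proj p) analytic_on {coord c p}" by (intro analytic_intros)
    moreover have "(local_proj p \<circ> cparam c) = (\<lambda>w. (proj \<circ> cparam c) w - proj p)"
      by (rule ext) (simp only: local_proj_def False if_False comp_apply)
    moreover have "local_proj p p = 0" by (simp add: local_proj_def False del: not_None_eq)
    ultimately show ?thesis by (simp only: simp_thms)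
  qed
  thus "(local_proj p \<circ> cparam c) analytic_on {coord c p}" "local_proj p p = 0" by blast+
qed

text \<open>An order \<open>k\<close> produces \<open>k\<close> distinct nearby points in one fibre.
  Fibres have at most two points, and only one near \<open>p\<close> if \<open>p\<close> and
  \<open>J p\<close> can be separated. At a fixed point the invariance of the projection makes the
  order even, leaving 2.\<close>

lemma local_proj_ordp: "ordp (local_proj p) p (if J p = p then 2 else 1)"
proof -
  obtain c where c: "c \<in> A" "p \<in> cdom c" by (rule chart_exists)
  let ?y = "local_proj p \<circ> cparam c" and ?z = "coord c p"
  have an: "?y analytic_on {?z}" and y0: "?y ?z = 0"
    using local_proj_analytic[OF c] by (simp_all add: cparam_coord[OF c])
  \<comment> \<open>Otherwise all points near \<open>p\<close> would lie in the fibre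
    \<open>{r, J r}\<close> of a single nearby point \<open>r\<close>.\<close>
  have "\<not> (\<forall>\<^sub>F q in at p. local_proj p q = 0)"
  proof
    assume "\<forall>\<^sub>F q in at p. local_proj p q = 0"
    hence e: "\<forall>\<^sub>F q in at p. local_proj p q = 0 \<and> sv q = Some (proj q)"
      using sv_eventually_finite[of p] by eventually_elim simp
    then obtain r where r: "local_proj p r = 0" "sv r = Some (proj r)"
      using eventually_happens[OF e] at_neq_bot_surface by blast
    have "\<forall>\<^sub>F q in at p. False"
      using e eventually_neq_at_within[of r p UNIV] eventually_neq_at_within[of "J r" p UNIV]
    proof eventually_elim
      case (elim q)
      have "proj q = proj r" using elim r local_proj_inj[of p q r] by simp
      hence "sv q = sv r" using elim r by simp
      thus False using proj_props(2)[of q r] elim by simp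
    qed
    thus False by simp
  qed
  moreover have "merp (local_proj p) p"
    using analytic_on_imp_meromorphic_on[OF an] by (simp only: merp_iff[OF c])
  ultimately obtain n where n: "ordp (local_proj p) p n" by (auto simp: merp_def)
  have "(?y \<longlongrightarrow> 0) (at ?z)" using analytic_at_imp_isCont[OF an] y0 isCont_def by metis
  hence lim: "(local_proj p \<longlongrightarrow> 0) (at p)" by (simp add: filterlim_chart[OF c] o_def)
  have "0 < n" using ordp_tendsto_nonneg(2)[OF n lim] by simp
  then obtain k where k: "n = int k" "k > 0" by (metis of_nat_0_less_iff pos_int_cases)
  \<comment> \<open>Away from poles equal values of \<open>proj\<close> mean equal values on the
    sphere; the conventional value 0 at a pole would otherwise be confused with a genuine 0.\<close>
  obtain U0 where U0: "open U0" "p \<in> U0" "\<And>q. q \<in> U0 \<Longrightarrow> q \<noteq> p \<Longrightarrow> sv q = Some (proj q)"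
    using sv_eventually_finite[of p] unfolding eventually_at_topological by blast
  have card_le: "card T \<le> 2" "J p \<noteq> p \<Longrightarrow> (\<And>q. q \<in> U \<Longrightarrow> J q \<notin> U) \<Longrightarrow> card T \<le> 1"
    if T: "T \<subseteq> U \<inter> U0 - {p}" "\<And>q. q \<in> T \<Longrightarrow> local_proj p q = a" for T U a
  proof -
    have *: "q \<in> {r, J r}" if qr: "q \<in> T" "r \<in> T" for q r
    proof -
      have "proj q = proj r" using T(2)[OF qr(1)] T(2)[OF qr(2)] local_proj_inj[of p q r] by simp
      moreover have "sv q = Some (proj q)" "sv r = Some (proj r)" using U0(3) T(1) qr by blast+
      ultimately have "sv q = sv r" by simp
      thus ?thesis by (simp only: proj_props(2))
    qed
    show "card T \<le> 2"
    proof (cases "T = {}")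
      case False
      then obtain r where "r \<in> T" by blast
      hence "T \<subseteq> {r, J r}" using * by blast
      hence "card T \<le> card {r, J r}" by (intro card_mono) auto
      also have "\<dots> \<le> 2" by (simp add: card_insert_if)
      finally show ?thesis .
    qed simp
    show "card T \<le> 1" if U: "J p \<noteq> p" "\<And>q. q \<in> U \<Longrightarrow> J q \<notin> U"
    proof (cases "T = {}")
      case False
      then obtain r where r: "r \<in> T" by blast
      hence "J r \<notin> U" using U(2) T(1) by blast
      hence "T \<subseteq> {r}" using *[OF _ r] T(1) by blast
      thus ?thesis using card_mono[of "{r}" T] by simp
    qed simp
  qed
  have bound: "\<exists>T a. T \<subseteq> U \<inter> U0 - {p} \<and> card T = k \<and> (\<forall>q\<in>T. local_proj p q = a)"
    if U: "open U" "p \<in> U" for U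
  proof -
    let ?S = "coord c ` (U \<inter> U0 \<inter> cdom c)"
    have "open ?S" by (rule open_coord_image) (use U U0 c chart_props(1)[OF c(1)] in auto)
    moreover have "?z \<in> ?S" using U U0 c by blast
    moreover have "ord_at ?y ?z (int k)" using n k(1) by (simp only: ordp_iff[OF c])
    ultimately obtain T a where T: "T \<subseteq> ?S - {?z}" "card T = k" "\<And>w. w \<in> T \<Longrightarrow> ?y w = a"
      using local_multiplicity[OF _ k(2) an] by blast
    have Tc: "T \<subseteq> coord c ` cdom c" using T(1) by blast
    have "inj_on (cparam c) T"
      by (rule inj_onI) (metis Tc coord_cparam[OF c(1)] subsetD)
    hence "card (cparam c ` T) = k" using T(2) card_image by blast
    moreover have "cparam c ` T \<subseteq> U \<inter> U0 - {p}"
    proof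
      fix q assume "q \<in> cparam c ` T"
      then obtain w where w: "w \<in> T" "q = cparam c w" by blast
      then obtain r where r: "r \<in> U \<inter> U0 \<inter> cdom c" "w = coord c r" "w \<noteq> ?z" using T(1) by blast
      hence "q = r" using w(2) cparam_coord[OF c(1), of r] by simp
      thus "q \<in> U \<inter> U0 - {p}" using r by blast
    qed
    moreover have "\<forall>q\<in>cparam c ` T. local_proj p q = a" using T(3) by auto
    ultimately show ?thesis by blast
  qed
  show ?thesis
  proof (cases "J p = p")
    case False
    obtain U W where UW: "open U" "open W" "p \<in> U" "J p \<in> W" "U \<inter> W = {}"
      using hausdorff[of p "J p"] False by metis
    have "continuous_on UNIV J" using J_holomorphic by (simp add: holomorphic_self_map_def)
    hence "open (J -` W)" using UW(2) by (simp add: continuous_on_open_vimage)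
    \<comment> \<open>A neighbourhood of \<open>p\<close> that is disjoint from its
      conjugate.\<close>
    hence o: "open (U \<inter> J -` W)" "p \<in> U \<inter> J -` W" using UW by auto
    have "\<And>q. q \<in> U \<inter> J -` W \<Longrightarrow> J q \<notin> U \<inter> J -` W" using UW(5) by blast
    with bound[OF o] card_le(2)[of _ "U \<inter> J -` W"] False have "k \<le> 1" by blast
    thus ?thesis using False n k by (cases "k = 1") auto
  next
    case True
    have "k \<le> 2" using bound[of UNIV] card_le(1)[of _ UNIV] by blast
    moreover have "(-1) powi n * (1::complex) = 1"
    proof (rule ordp_parity[OF True n])
      show "((\<lambda>_. 1) \<longlongrightarrow> 1) (at p)" by simp
      have "\<forall>\<^sub>F q in at p. sv (J q) = Some (proj (J q))"
        by (rule eventually_J) (simp add: True sv_eventually_finite)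
      with sv_eventually_finite[of p]
      show "\<forall>\<^sub>F q in at p. local_proj p (J q) * 1 = 1 * local_proj p q"
      proof eventually_elim
        case (elim q)
        have "sv (J q) = sv q" by (simp add: proj_props(2))
        hence "proj (J q) = proj q" using elim by simp
        thus ?case by (simp add: local_proj_def)
      qed
    qed
    hence "even k" using k(1) by (cases "even k") auto
    ultimately have "k = 2" using k(2) by (cases "k = 1") auto
    thus ?thesis using True n k by simp
  qed
qed

text \<open>Its divisor is the fibre over \<open>a\<close> minus the fibre over infinity. For
  \<open>a = None\<close> the two cancel, whence the constant 1; quotients then compare any two
  fibres without case distinctions.\<close>

definition proj_minus :: "complex option \<Rightarrow> 'a \<Rightarrow> complex" where
  "proj_minus a q = (case a of None \<Rightarrow> 1 | Some b \<Rightarrow> proj q - b)"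

lemma proj_minus_ordp:
  "ordp (proj_minus a) p ((if J p = p then 2 else 1) * (of_bool (sv p = a) - of_bool (sv p = None)))"
proof (cases a)
  case None
  thus ?thesis using ordp_const[of 1 p] by (simp add: proj_minus_def[abs_def])
next
  case (Some b)
  let ?n = "if J p = p then 2 else (1::int)"
  have pm: "proj_minus a = (\<lambda>q. proj q - b)" using Some by (simp add: proj_minus_def fun_eq_iff)
  have lo: "ordp (local_proj p) p ?n" by (rule local_proj_ordp)
  have "0 < ?n" by simp
  have lim: "(local_proj p \<longlongrightarrow> 0) (at p)"
    using ordp_nonneg_tendsto[OF lo] \<open>0 < ?n\<close> by (metis less_imp_le)
  show ?thesis
  proof (cases "sv p = None")
    case True
    hence lp: "local_proj p = (\<lambda>q. inverse (proj q))" by (simp add: local_proj_def fun_eq_iff)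
    have px: "ordp proj p (- ?n)" using ordp_inverse[OF lo] unfolding lp by simp
    \<comment> \<open>At a pole of \<open>proj\<close> write \<open>proj q - b\<close> as
      \<open>proj q\<close> times this factor, which tends to 1 and so has order 0.\<close>
    have "((\<lambda>q. 1 - b * inverse (proj q)) \<longlongrightarrow> 1 - b * 0) (at p)"
      by (intro tendsto_intros) (use lim in \<open>simp only: lp\<close>)
    moreover have "merp (\<lambda>q. 1 - b * inverse (proj q)) p"
      by (intro merp_diff merp_mult merp_const ordp_imp_merp[OF lo, unfolded lp])
    ultimately have "ordp (\<lambda>q. 1 - b * inverse (proj q)) p 0"
      using merp_tendsto_nonzero by fastforce
    from ordp_mult[OF px this] have "ordp (\<lambda>q. proj q * (1 - b * inverse (proj q))) p (- ?n)" by simp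
    moreover have "\<forall>\<^sub>F q in at p. proj q * (1 - b * inverse (proj q)) = proj q - b"
      using ordp_nonzero[OF px] by eventually_elim (simp add: field_simps)
    ultimately have "ordp (\<lambda>q. proj q - b) p (- ?n)" by (rule ordp_cong)
    thus ?thesis using True Some pm by simp
  next
    case False
    hence s: "sv p = Some (proj p)" by (auto simp: sv_eq split: if_splits)
    have lp: "local_proj p = (\<lambda>q. proj q - proj p)"
      by (rule ext) (simp only: local_proj_def False if_False)
    show ?thesis
    proof (cases "proj p = b")
      case True
      thus ?thesis using lo s Some pm lp by simp
    next
      case ne: False
      have "((\<lambda>q. (proj q - proj p) + (proj p - b)) \<longlongrightarrow> 0 + (proj p - b)) (at p)"
        by (intro tendsto_intros) (use lim in \<open>simp only: lp\<close>)
      hence "((\<lambda>q. proj q - b) \<longlongrightarrow> proj p - b) (at p)" by simp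
      moreover have "merp (\<lambda>q. proj q - b) p" by (intro merp_diff merp_const proj_merp)
      ultimately have "ordp (\<lambda>q. proj q - b) p 0" using merp_tendsto_nonzero ne by fastforce
      thus ?thesis using s Some pm ne by simp
    qed
  qed
qed

subsection \<open>Functions with invariant divisors\<close>

text \<open>The divisor \<open>T + J T\<close>, a fibre of the projection.\<close>

definition pair :: "'a \<Rightarrow> 'a \<Rightarrow> int" where
  "pair T p = of_bool (p = T) + of_bool (p = J T)"

lemma pair_J [simp]: "pair T (J p) = pair T p"
proof -
  have "J p = T \<longleftrightarrow> p = J T" "J p = J T \<longleftrightarrow> p = T" by (metis J_J)+
  thus ?thesis by (simp add: pair_def)
qed

lemma pair_nonneg: "0 \<le> pair T p"
  by (simp add: pair_def)

lemma pair_self: "0 < pair T T"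
  by (simp add: pair_def)

lemma pair_eq: "pair T p = (if J p = p then 2 else 1) * of_bool (sv p = sv T)"
proof -
  have "sv p = sv T \<longleftrightarrow> p = T \<or> p = J T" using proj_props(2)[of p T] by simp
  thus ?thesis by (auto simp: pair_def)
qed

lemma pair_difference_principal: "\<exists>\<mu>. \<forall>p. ordp \<mu> p (pair P p - pair T p)"
proof (intro exI allI)
  fix p
  show "ordp (\<lambda>q. proj_minus (sv P) q / proj_minus (sv T) q) p (pair P p - pair T p)"
    using ordp_divide[OF proj_minus_ordp[of "sv P" p] proj_minus_ordp[of "sv T" p]]
    by (simp add: pair_eq algebra_simps)
qed

lemma pair_sums_principal:
  "length Ps = length Ts \<Longrightarrow>
     \<exists>\<kappa>. \<forall>p. ordp \<kappa> p ((\<Sum>P\<leftarrow>Ps. pair P p) - (\<Sum>T\<leftarrow>Ts. pair T p))"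
proof (induction Ps Ts rule: list_induct2)
  case Nil
  show ?case using ordp_const[of 1] by (intro exI[of _ "\<lambda>_. 1"]) auto
next
  case (Cons P Ps T Ts)
  then obtain \<kappa> where \<kappa>: "\<And>p. ordp \<kappa> p ((\<Sum>P\<leftarrow>Ps. pair P p) - (\<Sum>T\<leftarrow>Ts. pair T p))" by blast
  obtain \<mu> where \<mu>: "\<And>p. ordp \<mu> p (pair P p - pair T p)" using pair_difference_principal by blast
  show ?case
  proof (intro exI allI)
    fix p
    show "ordp (\<lambda>q. \<mu> q * \<kappa> q) p ((\<Sum>P\<leftarrow>P # Ps. pair P p) - (\<Sum>T\<leftarrow>T # Ts. pair T p))"
      using ordp_mult[OF \<mu> \<kappa>, of p] by (simp add: algebra_simps)
  qed
qed

text \<open>Induction on the support: a multiple of the fibre through \<open>S\<close> removes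
  \<open>S\<close> and \<open>J S\<close>, and trading that fibre for the fibre of \<open>T\<close>
  costs only a principal divisor. So an invariant divisor is a sum of fibres once its coefficients
  at branch points are even.\<close>

lemma invariant_divisor_principal:
  assumes "finite {p. k p \<noteq> 0}" "\<And>p. k (J p) = k p" "\<And>p. J p = p \<Longrightarrow> even (k p)"
  shows "\<exists>\<kappa> n. \<forall>p. ordp \<kappa> p (k p + n * pair T p)"
  using assms
proof (induction "card {p. k p \<noteq> 0}" arbitrary: k rule: less_induct)
  case less
  show ?case
  proof (cases "\<exists>S. k S \<noteq> 0")
    case False
    thus ?thesis using ordp_const[of 1] by (intro exI[of _ "\<lambda>_. 1"] exI[of _ 0]) auto
  next
    case True
    then obtain S where S: "k S \<noteq> 0" by blast
    \<comment> \<open>At a branch point the fibre has coefficient 2; evenness makes the division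
      exact.\<close>
    define a where "a = (if J S = S then k S div 2 else k S)"
    define k' where "k' p = k p - a * pair S p" for p
    have aS: "a * pair S S = k S"
      using less.prems(3)[of S] by (auto simp: a_def pair_def)
    have off: "k' p = k p" if "p \<noteq> S" "p \<noteq> J S" for p using that by (simp add: k'_def pair_def)
    have kS: "k' S = 0" using aS by (simp add: k'_def)
    have inv: "k' (J p) = k' p" for p using less.prems(2) by (simp add: k'_def)
    have "k' (J S) = 0" using kS inv by simp
    hence "{p. k' p \<noteq> 0} \<subseteq> {p. k p \<noteq> 0} - {S}"
      using kS off by fastforce
    hence sub: "{p. k' p \<noteq> 0} \<subset> {p. k p \<noteq> 0}" using S by blast
    have "\<exists>\<kappa> n. \<forall>p. ordp \<kappa> p (k' p + n * pair T p)"
    proof (rule less.hyps)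
      show "card {p. k' p \<noteq> 0} < card {p. k p \<noteq> 0}"
        by (rule psubset_card_mono[OF less.prems(1) sub])
      show "finite {p. k' p \<noteq> 0}" using sub less.prems(1) by (metis finite_subset less_imp_le)
      show "k' (J p) = k' p" for p by (rule inv)
      fix p assume p: "J p = p"
      have "pair S p = (if p = S then 2 else 0)"
        using p by (auto simp: pair_def)
      thus "even (k' p)" using less.prems(3)[OF p] by (simp add: k'_def)
    qed
    then obtain \<kappa> n where \<kappa>: "\<And>p. ordp \<kappa> p (k' p + n * pair T p)" by blast
    obtain \<mu> where \<mu>: "\<And>p. ordp \<mu> p (pair S p - pair T p)" using pair_difference_principal by blast
    show ?thesis
    proof (intro exI allI)
      fix p
      show "ordp (\<lambda>q. \<kappa> q * \<mu> q powi a) p (k p + (n - a) * pair T p)"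
        using ordp_mult[OF \<kappa>[of p] ordp_power_int[OF \<mu>[of p], of a]] by (simp add: k'_def algebra_simps)
    qed
  qed
qed

end

section \<open>Sections of a nonsingular even spin bundle\<close>

locale spin_surface = hyperelliptic_surface +
  fixes \<xi> :: "'a chart \<Rightarrow> 'a chart \<Rightarrow> 'a \<Rightarrow> complex"
  assumes spin: "nonsingular_even_spin_bundle A \<xi>"
begin

lemma \<xi>_props: "line_bundle A \<xi>" "bundle_iso A (tensor_bundle \<xi> \<xi>) canonical_bundle" "has_h0 A \<xi> 0"
  using spin by (simp_all add: nonsingular_even_spin_bundle_def)

lemma \<xi>_regular: "regular_cocycle \<xi>"
  by (rule line_bundle_regular[OF \<xi>_props(1)])

lemma \<xi>_nonzero: "c \<in> A \<Longrightarrow> d \<in> A \<Longrightarrow> p \<in> cdom c \<Longrightarrow> p \<in> cdom d \<Longrightarrow> \<xi> c d p \<noteq> 0"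
  using \<xi>_regular unfolding regular_cocycle_def by blast

text \<open>\<open>D\<close> is the divisor of \<open>s\<close>, given as a function on points; the
  zero section has none.\<close>

definition section_order :: "('a chart \<Rightarrow> 'a \<Rightarrow> complex) \<Rightarrow> ('a \<Rightarrow> int) \<Rightarrow> bool" where
  "section_order s D \<longleftrightarrow> meromorphic_section A \<xi> s \<and> (\<forall>c\<in>A. \<forall>p\<in>cdom c. ordp (s c) p (D p))"

lemma section_orderD:
  assumes "section_order s D" "c \<in> A" "p \<in> cdom c"
  shows "ordp (s c) p (D p)"
  using assms unfolding section_order_def by blast

lemma section_transition:
  assumes "meromorphic_section A \<xi> s" "c \<in> A" "d \<in> A" "p \<in> cdom c" "p \<in> cdom d"
  shows "s c p = \<xi> c d p * s d p"
  using assms unfolding meromorphic_section_def by blast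

lemma meromorphic_section_merp:
  assumes "meromorphic_section A \<xi> s" "c \<in> A" "p \<in> cdom c"
  shows "merp (s c) p"
proof -
  have "(s c \<circ> cparam c) nicely_meromorphic_on (coord c ` cdom c)"
    using assms unfolding meromorphic_section_def by blast
  hence "(s c \<circ> cparam c) meromorphic_on (coord c ` cdom c)" by (simp add: nicely_meromorphic_on_def)
  hence "(s c \<circ> cparam c) meromorphic_on {coord c p}"
    by (rule meromorphic_on_subset) (use assms in blast)
  thus ?thesis by (simp only: merp_iff[OF assms(2,3)])
qed

lemma simple_pole_section_order:
  assumes s: "simple_pole_section A \<xi> T s"
  obtains D where "section_order s D" "D T = -1" "\<And>p. p \<noteq> T \<Longrightarrow> 0 \<le> D p"
    "\<And>c p. c \<in> A \<Longrightarrow> p \<in> cdom c \<Longrightarrow> p \<noteq> T \<Longrightarrow> s c p = 0 \<longleftrightarrow> 0 < D p"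
proof -
  have ms: "meromorphic_section A \<xi> s"
    and pole: "\<And>c p. c \<in> A \<Longrightarrow> p \<in> cdom c \<Longrightarrow> is_pole (s c \<circ> cparam c) (coord c p) \<longleftrightarrow> p = T"
    and zo: "\<And>c. c \<in> A \<Longrightarrow> T \<in> cdom c \<Longrightarrow> zorder (s c \<circ> cparam c) (coord c T) = -1"
    using s unfolding simple_pole_section_def by blast+
  \<comment> \<open>Vanishing of a section does not depend on the chart. This gives a global
    property of points to which the identity theorem applies; the pole at \<open>T\<close> then
    excludes the zero section.\<close>
  define Z where "Z q \<longleftrightarrow> (\<forall>c\<in>A. q \<in> cdom c \<longrightarrow> s c q = 0)" for q
  have Z: "Z q \<longleftrightarrow> s c q = 0" if c: "c \<in> A" "q \<in> cdom c" for c q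
  proof
    assume z: "s c q = 0"
    show "Z q" unfolding Z_def
    proof (intro ballI impI)
      fix d assume d: "d \<in> A" "q \<in> cdom d"
      show "s d q = 0" using section_transition[OF ms d(1) c(1) d(2) c(2)] z by simp
    qed
  qed (use c Z_def in blast)
  have Zev: "\<forall>\<^sub>F q in at p. Z q \<longleftrightarrow> s c q = 0" if c: "c \<in> A" "p \<in> cdom c" for c p
    using eventually_in_cdom[OF c] by eventually_elim (use Z[OF c(1)] in blast)
  have "(\<forall>\<^sub>F q in at p. Z q) \<or> (\<forall>\<^sub>F q in at p. \<not> Z q)" for p
  proof -
    obtain c where c: "c \<in> A" "p \<in> cdom c" by (rule chart_exists)
    have "(\<forall>\<^sub>F q in at p. s c q = 0) \<or> (\<forall>\<^sub>F q in at p. s c q \<noteq> 0)"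
      using meromorphic_section_merp[OF ms c] ordp_nonzero unfolding merp_def by blast
    thus ?thesis
    proof
      assume "\<forall>\<^sub>F q in at p. s c q = 0"
      with Zev[OF c] have "\<forall>\<^sub>F q in at p. Z q" by eventually_elim blast
      thus ?thesis ..
    next
      assume "\<forall>\<^sub>F q in at p. s c q \<noteq> 0"
      with Zev[OF c] have "\<forall>\<^sub>F q in at p. \<not> Z q" by eventually_elim blast
      thus ?thesis ..
    qed
  qed
  from locally_determined_imp_constant[of Z, OF this]
  have nZ: "\<forall>\<^sub>F q in at p. \<not> Z q" for p
  proof
    assume a: "\<forall>p. \<forall>\<^sub>F q in at p. Z q"
    obtain c where c: "c \<in> A" "T \<in> cdom c" by (rule chart_exists)
    have "\<forall>\<^sub>F q in at T. s c q = 0"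
      using a[rule_format, of T] Zev[OF c] by eventually_elim simp
    hence "(s c \<longlongrightarrow> 0) (at T)" by (rule tendsto_eventually)
    moreover have "filterlim (s c) at_infinity (at T)"
      using pole[OF c] unfolding is_pole_def filterlim_chart[OF c] o_def by simp
    ultimately show ?thesis using not_tendsto_and_filterlim_at_infinity[OF at_neq_bot_surface] by blast
  qed blast
  have ex: "\<exists>n. ordp (s c) p n" if c: "c \<in> A" "p \<in> cdom c" for c p
  proof (rule ccontr)
    assume "\<nexists>n. ordp (s c) p n"
    hence "\<forall>\<^sub>F q in at p. s c q = 0" using meromorphic_section_merp[OF ms c] by (simp add: merp_def)
    with Zev[OF c] nZ[of p] have "\<forall>\<^sub>F q in at p. False" by eventually_elim simp
    thus False by simp
  qed
  \<comment> \<open>The order is the same in all charts because the cocycle has order 0.\<close>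
  define D where "D p = (THE n. \<forall>c\<in>A. p \<in> cdom c \<longrightarrow> ordp (s c) p n)" for p
  have Dord: "ordp (s c) p (D p)" if c: "c \<in> A" "p \<in> cdom c" for c p
  proof -
    obtain n where n: "ordp (s c) p n" using ex[OF c] by blast
    have all: "\<forall>d\<in>A. p \<in> cdom d \<longrightarrow> ordp (s d) p n"
    proof (intro ballI impI)
      fix d assume d: "d \<in> A" "p \<in> cdom d"
      have "ordp (\<xi> d c) p 0" using \<xi>_regular c d unfolding regular_cocycle_def by blast
      from ordp_mult[OF this n] have "ordp (\<lambda>q. \<xi> d c q * s c q) p n" by simp
      moreover have "\<forall>\<^sub>F q in at p. \<xi> d c q * s c q = s d q"
        using eventually_in_cdom[OF c] eventually_in_cdom[OF d]
        by eventually_elim (use section_transition[OF ms d(1) c(1)] in simp)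
      ultimately show "ordp (s d) p n" by (rule ordp_cong)
    qed
    moreover have "m = n" if "\<forall>d\<in>A. p \<in> cdom d \<longrightarrow> ordp (s d) p m" for m
      using that n c ordp_unique by blast
    ultimately have "D p = n" unfolding D_def by (rule the_equality)
    with n show ?thesis by simp
  qed
  have polar: "D p < 0 \<longleftrightarrow> p = T" for p
  proof -
    obtain c where c: "c \<in> A" "p \<in> cdom c" by (rule chart_exists)
    show ?thesis using ord_at_pole_iff Dord[OF c] pole[OF c] unfolding ordp_iff[OF c] by blast
  qed
  show thesis
  proof (rule that[of D])
    show "section_order s D" using ms Dord unfolding section_order_def by blast
    show "D T = -1"
    proof -
      obtain c where c: "c \<in> A" "T \<in> cdom c" by (rule chart_exists)
      show ?thesis using ord_at_zorder[OF Dord[OF c, unfolded ordp_iff[OF c]]] zo[OF c] by simp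
    qed
    show nn: "0 \<le> D p" if "p \<noteq> T" for p using polar[of p] that by simp
    fix c p assume c: "c \<in> A" "p \<in> cdom c" and pT: "p \<noteq> T"
    have "(s c \<circ> cparam c) nicely_meromorphic_on (coord c ` cdom c)"
      using ms c unfolding meromorphic_section_def by blast
    hence "(s c \<circ> cparam c) analytic_on {coord c p}"
      by (rule nicely_meromorphic_on_imp_analytic_at) (use c pole[OF c] pT in auto)
    hence "((s c \<circ> cparam c) \<longlongrightarrow> (s c \<circ> cparam c) (coord c p)) (at (coord c p))"
      using analytic_at_imp_isCont isCont_def by blast
    hence lim: "(s c \<longlongrightarrow> s c p) (at p)" by (simp add: filterlim_chart[OF c] o_def cparam_coord[OF c])
    obtain l where l: "(s c \<longlongrightarrow> l) (at p)" "l = 0 \<longleftrightarrow> 0 < D p"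
      by (rule ordp_nonneg_tendsto[OF Dord[OF c] nn[OF pT]])
    show "s c p = 0 \<longleftrightarrow> 0 < D p"
      using tendsto_unique[OF at_neq_bot_surface lim l(1)] l(2) by simp
  qed
qed

section \<open>Products of sections with functions and the vanishing of h^0\<close>

lemma section_times_function:
  assumes s: "section_order s D" and F: "\<And>p. ordp F p (E p)"
  defines "t \<equiv> normalise (\<lambda>c q. s c q * F q)"
  shows "meromorphic_section A \<xi> t"
    and "c \<in> A \<Longrightarrow> p \<in> cdom c \<Longrightarrow> ordp (t c) p (D p + E p)"
    and "(\<And>p. 0 \<le> D p + E p) \<Longrightarrow> t \<in> holomorphic_sections A \<xi>"
    and "c \<in> A \<Longrightarrow> p \<in> cdom c \<Longrightarrow> 0 \<le> D p + E p \<Longrightarrow> t c p = 0 \<longleftrightarrow> 0 < D p + E p"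
proof -
  have ms: "meromorphic_section A \<xi> s" using s by (simp add: section_order_def)
  have tr: "s c q * F q = \<xi> c d q * (s d q * F q)"
    if "c \<in> A" "d \<in> A" "q \<in> cdom c" "q \<in> cdom d" for c d q
    using section_transition[OF ms that] by simp
  have o: "ordp (\<lambda>q. s c q * F q) p (D p + E p)" if "c \<in> A" "p \<in> cdom c" for c p
    by (rule ordp_mult[OF section_orderD[OF s that] F])
  note n = normalise_section[OF \<xi>_regular, of "\<lambda>c q. s c q * F q" "\<lambda>p. D p + E p", OF tr o, folded t_def]
  show "meromorphic_section A \<xi> t" by (rule n(1))
  show "c \<in> A \<Longrightarrow> p \<in> cdom c \<Longrightarrow> ordp (t c) p (D p + E p)" by (rule n(2))
  show "(\<And>p. 0 \<le> D p + E p) \<Longrightarrow> t \<in> holomorphic_sections A \<xi>" by (rule n(3))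
  show "c \<in> A \<Longrightarrow> p \<in> cdom c \<Longrightarrow> 0 \<le> D p + E p \<Longrightarrow> t c p = 0 \<longleftrightarrow> 0 < D p + E p" by (rule n(4))
qed

text \<open>The normalised product would be a holomorphic section with an order at each point, hence
  a nonzero element of a space of dimension 0.\<close>

lemma no_effective_divisor:
  assumes s: "section_order s D" and F: "\<And>p. ordp F p (E p)" and nn: "\<And>p. 0 \<le> D p + E p"
  shows False
proof -
  let ?t = "normalise (\<lambda>c q. s c q * F q)"
  have "?t \<in> holomorphic_sections A \<xi>" by (rule section_times_function(3)[OF s F nn])
  hence z: "?t = 0" using has_h0_0[OF \<xi>_props(3)] by blast
  obtain p :: 'a where True by blast
  obtain c where c: "c \<in> A" "p \<in> cdom c" by (rule chart_exists)
  have "ordp (?t c) p (D p + E p)" by (rule section_times_function(2)[OF s F c])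
  from ordp_nonzero[OF this] have "\<forall>\<^sub>F q in at p. False" by (simp only: z zero_fun_apply) simp
  thus False by simp
qed

text \<open>A suitable combination of \<open>s'\<close> and the product of \<open>s\<close> with
  \<open>F\<close> cancels the pole at \<open>T\<close>. It is then holomorphic, hence zero because
  h^0 = 0, so the two sections are proportional.\<close>

lemma simple_pole_section_unique:
  assumes s: "section_order s D" and F: "\<And>p. ordp F p (E p)"
    and T: "D T + E T = -1" "\<And>p. p \<noteq> T \<Longrightarrow> 0 \<le> D p + E p"
    and s': "section_order s' D'" "D' T = -1" "\<And>p. p \<noteq> T \<Longrightarrow> 0 \<le> D' p"
  shows "D' p = D p + E p"
proof -
  have ms: "meromorphic_section A \<xi> s" and ms': "meromorphic_section A \<xi> s'"
    using s s' by (simp_all add: section_order_def)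
  \<comment> \<open>The cocycle cancels in a quotient of two sections, so any chart gives the same
    function.\<close>
  define F' where "F' q = s' (chart_of q) q / s (chart_of q) q" for q
  have F'_eq: "F' q = s' c q / s c q" if c: "c \<in> A" "q \<in> cdom c" for c q
    unfolding F'_def section_transition[OF ms c(1) chart_of(1) c(2) chart_of(2)]
      section_transition[OF ms' c(1) chart_of(1) c(2) chart_of(2)]
    using \<xi>_nonzero[OF c(1) chart_of(1) c(2) chart_of(2)] by simp
  have F'_ev: "\<forall>\<^sub>F q in at p. F' q = s' c q / s c q" if c: "c \<in> A" "p \<in> cdom c" for c p
    using eventually_in_cdom[OF c] by eventually_elim (use F'_eq[OF c(1)] in blast)
  have F'_ord: "ordp F' p (D' p - D p)" for p
  proof -
    obtain c where c: "c \<in> A" "p \<in> cdom c" by (rule chart_exists)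
    have "\<forall>\<^sub>F q in at p. s' c q / s c q = F' q" using F'_ev[OF c] by eventually_elim simp
    with ordp_divide[OF section_orderD[OF s'(1) c] section_orderD[OF s c]] show ?thesis
      by (rule ordp_cong)
  qed
  let ?H = "\<lambda>q. F' q / F q"
  have H_ord: "ordp ?H p (D' p - D p - E p)" for p by (rule ordp_divide[OF F'_ord F])
  have "ordp ?H T 0" using H_ord[of T] T(1) s'(2) by (simp add: algebra_simps)
  then obtain a where a: "(?H \<longlongrightarrow> a) (at T)" "a \<noteq> 0"
    using ordp_nonneg_tendsto[of ?H T 0] by auto
  let ?G = "\<lambda>q. ?H q - a"
  have "\<And>p. merp ?G p" by (intro merp_diff merp_const ordp_imp_merp[OF H_ord])
  from meromorphic_zero_or_ordp[OF this] show ?thesis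
  proof
    assume "\<forall>p. \<exists>n. ordp ?G p n"
    then obtain M where M: "\<And>p. ordp ?G p (M p)" by metis
    have "0 \<le> D p + (M p + E p)" for p
    proof (cases "p = T")
      case True
      \<comment> \<open>Subtracting the limit \<open>a\<close> gives \<open>?G\<close> a zero at
        \<open>T\<close>, which cancels the simple pole there.\<close>
      have "(?G \<longlongrightarrow> a - a) (at T)" by (intro tendsto_intros a)
      hence "0 < M T" using ordp_tendsto_nonneg(2)[OF M] by simp
      thus ?thesis using True T(1) by simp
    next
      case False
      obtain c where c: "c \<in> A" "p \<in> cdom c" by (rule chart_exists)
      have o: "ordp (\<lambda>q. s c q * (?G q * F q)) p (D p + (M p + E p))"
        by (intro ordp_mult section_orderD[OF s c] M F)
      obtain l where l: "(s' c \<longlongrightarrow> l) (at p)"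
        using ordp_nonneg_tendsto[OF section_orderD[OF s'(1) c] s'(3)[OF False]] by blast
      obtain k where k: "((\<lambda>q. s c q * F q) \<longlongrightarrow> k) (at p)"
        using ordp_nonneg_tendsto[OF ordp_mult[OF section_orderD[OF s c] F] T(2)[OF False]] by blast
      have "((\<lambda>q. s' c q - a * (s c q * F q)) \<longlongrightarrow> l - a * k) (at p)"
        by (intro tendsto_intros l k)
      moreover have "\<forall>\<^sub>F q in at p. s' c q - a * (s c q * F q) = s c q * (?G q * F q)"
        using F'_ev[OF c] ordp_nonzero[OF F[of p]] ordp_nonzero[OF section_orderD[OF s c]]
        by eventually_elim (simp add: field_simps)
      ultimately have "((\<lambda>q. s c q * (?G q * F q)) \<longlongrightarrow> l - a * k) (at p)"
        by (rule Lim_transform_eventually)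
      from ordp_tendsto_nonneg(1)[OF o this] show ?thesis .
    qed
    from no_effective_divisor[OF s ordp_mult[OF M F] this] show ?thesis ..
  next
    assume "\<forall>p. \<forall>\<^sub>F q in at p. ?G q = 0"
    hence "\<forall>\<^sub>F q in at p. a = ?H q" by (auto elim: eventually_mono)
    from ordp_cong[OF ordp_const[OF a(2)] this] have "D' p - D p - E p = 0"
      using ordp_unique[OF H_ord] by blast
    thus ?thesis by simp
  qed
qed

text \<open>\<open>zero_points\<close> quantifies over all sections with a simple pole at
  \<open>T\<close>; by uniqueness of the divisor it can be read off from one explicit section times
  a function.\<close>

lemma zero_points_eq:
  assumes s: "section_order s D" and F: "\<And>p. ordp F p (E p)"
    and E: "\<And>p. D p + E p = E' p - of_bool (p = T)" and nn: "\<And>p. 0 \<le> E' p"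
  shows "zero_points A \<xi> T = {R. 0 < E' R}"
proof -
  \<comment> \<open>A zero of \<open>E'\<close> at the pole is automatic: a positive coefficient
    would cancel the pole and leave an effective divisor.\<close>
  have ET: "E' T = 0"
  proof (rule ccontr)
    assume "E' T \<noteq> 0"
    hence "0 \<le> D p + E p" for p using E[of p] nn[of p] by (cases "p = T") auto
    from no_effective_divisor[OF s F this] show False .
  qed
  have T: "D T + E T = -1" "\<And>p. p \<noteq> T \<Longrightarrow> 0 \<le> D p + E p" using E ET nn by simp_all
  let ?t = "normalise (\<lambda>c q. s c q * F q)"
  note t = section_times_function[OF s F]
  have pole: "simple_pole_section A \<xi> T ?t"
    unfolding simple_pole_section_def
  proof (intro conjI ballI impI)
    show "meromorphic_section A \<xi> ?t" by (rule t(1))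
  next
    fix c p assume c: "c \<in> A" "p \<in> cdom c"
    have "is_pole (?t c \<circ> cparam c) (coord c p) \<longleftrightarrow> D p + E p < 0"
      using ord_at_pole_iff t(2)[OF c] unfolding ordp_iff[OF c] by blast
    thus "is_pole (?t c \<circ> cparam c) (coord c p) \<longleftrightarrow> p = T" using T by (metis not_less zero_less_one neg_less_0_iff_less)
  next
    fix c assume c: "c \<in> A" "T \<in> cdom c"
    show "zorder (?t c \<circ> cparam c) (coord c T) = -1"
      using ord_at_zorder[OF t(2)[OF c, unfolded ordp_iff[OF c]]] T(1) by simp
  qed
  show ?thesis
  proof (intro equalityI subsetI)
    fix R assume "R \<in> zero_points A \<xi> T"
    then obtain s' c where R: "R \<noteq> T" "simple_pole_section A \<xi> T s'" "c \<in> A" "R \<in> cdom c" "s' c R = 0"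
      unfolding zero_points_def by blast
    obtain D' where D': "section_order s' D'" "D' T = -1" "\<And>p. p \<noteq> T \<Longrightarrow> 0 \<le> D' p"
      "\<And>c p. c \<in> A \<Longrightarrow> p \<in> cdom c \<Longrightarrow> p \<noteq> T \<Longrightarrow> s' c p = 0 \<longleftrightarrow> 0 < D' p"
      using simple_pole_section_order[OF R(2)] by blast
    have "0 < D' R" using D'(4)[OF R(3,4,1)] R(5) by blast
    moreover have "D' R = D R + E R" by (rule simple_pole_section_unique[OF s F T D'(1-3)])
    ultimately show "R \<in> {R. 0 < E' R}" using E[of R] R(1) by simp
  next
    fix R assume "R \<in> {R. 0 < E' R}"
    hence R: "0 < E' R" "R \<noteq> T" using ET by auto
    obtain c where c: "c \<in> A" "R \<in> cdom c" by (rule chart_exists)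
    have "?t c R = 0" using t(4)[OF c] T(2)[OF R(2)] E[of R] R by simp
    thus "R \<in> zero_points A \<xi> T" unfolding zero_points_def using R(2) pole c by blast
  qed
qed

subsection \<open>The differential of a section\<close>

definition spin_iso :: "'a chart \<Rightarrow> 'a \<Rightarrow> complex" where
  "spin_iso = (SOME h. (\<forall>c\<in>A. (h c \<circ> cparam c) holomorphic_on (coord c ` cdom c) \<and> (\<forall>p\<in>cdom c. h c p \<noteq> 0)) \<and>
          (\<forall>c\<in>A. \<forall>d\<in>A. \<forall>p\<in>cdom c \<inter> cdom d.
              h c p * canonical_bundle c d p = tensor_bundle \<xi> \<xi> c d p * h d p))"

lemma spin_iso_props:
  "c \<in> A \<Longrightarrow> (spin_iso c \<circ> cparam c) holomorphic_on (coord c ` cdom c)"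
  "c \<in> A \<Longrightarrow> p \<in> cdom c \<Longrightarrow> spin_iso c p \<noteq> 0"
  "c \<in> A \<Longrightarrow> d \<in> A \<Longrightarrow> p \<in> cdom c \<Longrightarrow> p \<in> cdom d \<Longrightarrow>
     spin_iso c p * canonical_bundle c d p = \<xi> c d p ^ 2 * spin_iso d p"
  using someI_ex[OF \<xi>_props(2)[unfolded bundle_iso_def], folded spin_iso_def]
  by (auto simp: tensor_bundle_def power2_eq_square)

lemma spin_iso_ordp: "c \<in> A \<Longrightarrow> p \<in> cdom c \<Longrightarrow> ordp (spin_iso c) p 0"
proof -
  assume c: "c \<in> A" "p \<in> cdom c"
  have "(spin_iso c \<circ> cparam c) analytic_on {coord c p}"
    using spin_iso_props(1)[OF c(1)] chart_props(2)[OF c(1)] c(2) unfolding analytic_at by blast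
  thus ?thesis using analytic_nonzero_ordp(1)[OF c] spin_iso_props(2)[OF c] by blast
qed

text \<open>Multiplication by \<open>spin_iso\<close> carries differentials to sections of the
  square of \<open>\<xi>\<close>, so division brings the square of \<open>s\<close> back to a
  differential.\<close>

definition differential :: "('a chart \<Rightarrow> 'a \<Rightarrow> complex) \<Rightarrow> 'a chart \<Rightarrow> 'a \<Rightarrow> complex" where
  "differential s c p = s c p ^ 2 / spin_iso c p"

lemma differential_ordp:
  assumes "section_order s D" "c \<in> A" "p \<in> cdom c"
  shows "ordp (differential s c) p (2 * D p)"
  using ordp_divide[OF ordp_power_int[OF section_orderD[OF assms], of 2] spin_iso_ordp[OF assms(2,3)]]
  unfolding differential_def[abs_def] by simp

lemma differential_transition:
  assumes "section_order s D" "c \<in> A" "d \<in> A" "p \<in> cdom c" "p \<in> cdom d"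
  shows "differential s c p = canonical_bundle c d p * differential s d p"
proof -
  have "s c p = \<xi> c d p * s d p"
    using section_transition assms unfolding section_order_def by blast
  hence "differential s c p * (spin_iso c p * spin_iso d p) = (\<xi> c d p ^ 2 * spin_iso d p) * s d p ^ 2"
    using spin_iso_props(2)[OF assms(2,4)] by (simp add: differential_def power_mult_distrib)
  also have "\<dots> = canonical_bundle c d p * differential s d p * (spin_iso c p * spin_iso d p)"
    unfolding spin_iso_props(3)[OF assms(2-5), symmetric]
    using spin_iso_props(2)[OF assms(3,5)] by (simp add: differential_def)
  finally show ?thesis
    using spin_iso_props(2)[OF assms(2,4)] spin_iso_props(2)[OF assms(3,5)] by simp
qed

text \<open>The quotient of the differential \<open>J\<^sup>* \<omega>\<close> by \<open>\<omega>\<close>, where \<open>\<omega>\<close> is the differential of \<open>s\<close>.\<close>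

definition pullback_quotient :: "('a chart \<Rightarrow> 'a \<Rightarrow> complex) \<Rightarrow> 'a \<Rightarrow> complex" where
  "pullback_quotient s q =
     (let c = chart_of q; d = chart_of (J q)
      in differential s d (J q) * chart_deriv J c d q / differential s c q)"

text \<open>The definition uses chosen charts. By the chain rule the derivatives of the chart
  changes cancel against the transition factors of the differentials, so any charts may be
  used.\<close>

lemma pullback_quotient_eq:
  assumes s: "section_order s D" and c: "c \<in> A" "q \<in> cdom c" and d: "d \<in> A" "J q \<in> cdom d"
  shows "pullback_quotient s q = differential s d (J q) * chart_deriv J c d q / differential s c q"
proof -
  let ?c = "chart_of q" and ?d = "chart_of (J q)"
  note c' = chart_of[of q] and d' = chart_of[of "J q"]
  note idh = holomorphic_self_map_id
  have 1: "chart_deriv J c ?d q = chart_deriv J ?c ?d q * chart_deriv id c ?c q"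
    using chart_deriv_comp[OF J_holomorphic idh c(1) c'(1) d'(1) c(2)] c'(2) d'(2) by simp
  have 2: "chart_deriv J c d q = chart_deriv id ?d d (J q) * chart_deriv J c ?d q"
    using chart_deriv_comp[OF idh J_holomorphic c(1) d'(1) d(1) c(2)] d(2) d'(2) by simp
  have 3: "chart_deriv id d ?d (J q) * chart_deriv id ?d d (J q) = 1"
    using chart_deriv_involution_nonzero[OF idh _ d'(1) d(1) d'(2)] d(2) by simp
  have nz: "chart_deriv id c ?c q \<noteq> 0"
    using chart_deriv_regular(1)[OF idh _ c(1) c'(1) c(2)] c'(2) by simp
  have w1: "differential s c q = chart_deriv id c ?c q * differential s ?c q"
    unfolding chart_deriv_id by (rule differential_transition[OF s c(1) c'(1) c(2) c'(2)])
  have w2: "differential s d (J q) = chart_deriv id d ?d (J q) * differential s ?d (J q)"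
    unfolding chart_deriv_id by (rule differential_transition[OF s d(1) d'(1) d(2) d'(2)])
  have "differential s d (J q) * chart_deriv J c d q
      = (chart_deriv id d ?d (J q) * chart_deriv id ?d d (J q)) *
        (differential s ?d (J q) * chart_deriv J ?c ?d q * chart_deriv id c ?c q)"
    unfolding w2 2 1 by (simp only: mult_ac)
  also have "\<dots> = differential s ?d (J q) * chart_deriv J ?c ?d q * chart_deriv id c ?c q"
    unfolding 3 by simp
  finally show ?thesis unfolding pullback_quotient_def Let_def w1 using nz by simp
qed

lemma pullback_quotient_ordp:
  assumes s: "section_order s D"
  shows "ordp (pullback_quotient s) p (2 * D (J p) - 2 * D p)"
proof -
  obtain c where c: "c \<in> A" "p \<in> cdom c" by (rule chart_exists)
  obtain d where d: "d \<in> A" "J p \<in> cdom d" by (rule chart_exists)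
  have "ordp (differential s d \<circ> J) p (2 * D (J p))"
    by (rule ordp_J[OF differential_ordp[OF s d]])
  from ordp_divide[OF ordp_mult[OF this chart_deriv_regular(2)[OF J_holomorphic J_comp c(1) d(1) c(2) d(2)]]
      differential_ordp[OF s c]]
  have "ordp (\<lambda>q. (differential s d \<circ> J) q * chart_deriv J c d q / differential s c q) p (2 * D (J p) - 2 * D p)"
    by simp
  moreover have "\<forall>\<^sub>F q in at p. (differential s d \<circ> J) q * chart_deriv J c d q / differential s c q = pullback_quotient s q"
    using eventually_in_chart_preimage[OF c(1) d(1) c(2) d(2)]
    by eventually_elim (simp add: pullback_quotient_eq[OF s c(1) _ d(1)])
  ultimately show ?thesis by (rule ordp_cong)
qed

text \<open>Pulling back twice is the identity: the differentials cancel and the derivatives of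
  \<open>J\<close> at \<open>q\<close> and \<open>J q\<close> are inverse to each other. This is the
  cocycle condition of Hilbert 90.\<close>

lemma pullback_quotient_J:
  assumes s: "section_order s D"
  shows "\<forall>\<^sub>F q in at p. pullback_quotient s (J q) * pullback_quotient s q = 1"
proof -
  obtain c where c: "c \<in> A" "p \<in> cdom c" by (rule chart_exists)
  obtain d where d: "d \<in> A" "J p \<in> cdom d" by (rule chart_exists)
  show ?thesis
    using eventually_in_chart_preimage[OF c(1) d(1) c(2) d(2)]
      ordp_nonzero[OF differential_ordp[OF s c]] eventually_J[OF ordp_nonzero[OF differential_ordp[OF s d]]]
  proof eventually_elim
    case (elim q)
    have q: "q \<in> cdom c" "J q \<in> cdom d" using elim by auto
    have "pullback_quotient s (J q) = differential s c q * chart_deriv J d c (J q) / differential s d (J q)"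
      using pullback_quotient_eq[OF s d(1) q(2) c(1)] q(1) by simp
    moreover have "pullback_quotient s q = differential s d (J q) * chart_deriv J c d q / differential s c q"
      by (rule pullback_quotient_eq[OF s c(1) q(1) d(1) q(2)])
    ultimately have "pullback_quotient s (J q) * pullback_quotient s q = chart_deriv J d c (J q) * chart_deriv J c d q"
      using elim by simp
    thus ?case using chart_deriv_involution_nonzero[OF J_holomorphic J_comp c(1) d(1) q] by simp
  qed
qed

text \<open>
  The function \<open>r = J\<^sup>*\<omega> / \<omega>\<close> satisfies \<open>r (r \<circ> J) = 1\<close>, so it is \<open>- b / (b \<circ> J)\<close> for \<open>b = 1 - r\<close>. Up to fibres
  of the projection \<open>b\<close> is therefore a square root of \<open>r\<close>.
\<close>

lemma conjugate_section:
  assumes s: "section_order s D" and P: "D P = -1" and nn: "\<And>p. p \<noteq> P \<Longrightarrow> 0 \<le> D p"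
  shows "\<exists>m. \<forall>p. ordp m p (D (J p) - D p)"
proof -
  let ?r = "pullback_quotient s"
  let ?b = "\<lambda>q. 1 - ?r q"
  note r_ord = pullback_quotient_ordp[OF s]
  have loc: "\<forall>\<^sub>F q in at p. differential s c (J q) * chart_deriv J c c q = ?r q * differential s c q"
    and deriv_lim: "(chart_deriv J c c \<longlongrightarrow> -1) (at p)"
    if p: "J p = p" and c: "c \<in> A" "p \<in> cdom c" for p c
  proof -
    have cJ: "J p \<in> cdom c" using p c by simp
    show "\<forall>\<^sub>F q in at p. differential s c (J q) * chart_deriv J c c q = ?r q * differential s c q"
      using eventually_in_chart_preimage[OF c(1,1,2) cJ] ordp_nonzero[OF differential_ordp[OF s c]]
      by eventually_elim (simp add: pullback_quotient_eq[OF s c(1) _ c(1)])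
    show "(chart_deriv J c c \<longlongrightarrow> -1) (at p)"
      using chart_deriv_regular(3)[OF J_holomorphic J_comp c(1,1,2) cJ] chart_deriv_fixed[OF p c] by metis
  qed
  have "\<And>p. merp ?b p" by (intro merp_diff merp_const ordp_imp_merp[OF r_ord])
  from meromorphic_zero_or_ordp[OF this] have "\<forall>p. \<exists>n. ordp ?b p n"
  proof
    \<comment> \<open>In this case the differential is invariant under \<open>J\<close>. Comparing
      orders at \<open>P\<close> makes \<open>P\<close> a branch point; there an invariant
      differential has odd order, whereas its order is -2.\<close>
    assume z: "\<forall>p. \<forall>\<^sub>F q in at p. ?b q = 0"
    have "\<forall>\<^sub>F q in at P. 1 = ?r q" using z[rule_format, of P] by eventually_elim simp
    from ordp_cong[OF ordp_const[of 1] this] have "ordp ?r P 0" by simp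
    hence "2 * D (J P) - 2 * D P = 0" using r_ord ordp_unique by blast
    hence fixed: "J P = P" using P nn[of "J P"] by (cases "J P = P") auto
    obtain c where c: "c \<in> A" "P \<in> cdom c" by (rule chart_exists)
    have "\<forall>\<^sub>F q in at P. differential s c (J q) * chart_deriv J c c q = 1 * differential s c q"
      using loc[OF fixed c] z[rule_format, of P] by eventually_elim simp
    from ordp_parity[OF fixed differential_ordp[OF s c] deriv_lim[OF fixed c] this] P
    show ?thesis by simp
  qed
  then obtain B where B: "\<And>p. ordp ?b p (B p)" by metis
  \<comment> \<open>Read off from \<open>b \<circ> J = - b / r\<close>, where \<open>b\<close> and
    \<open>r\<close> stand for \<open>?b\<close> and \<open>?r\<close>.\<close>
  have BJ: "B (J p) = B p - (2 * D (J p) - 2 * D p)" for p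
  proof -
    have 1: "ordp (\<lambda>q. (-1) * (?b q / ?r q)) p (0 + (B p - (2 * D (J p) - 2 * D p)))"
      by (intro ordp_mult ordp_divide B r_ord ordp_const) simp
    have "\<forall>\<^sub>F q in at p. (-1) * (?b q / ?r q) = (?b \<circ> J) q"
      using pullback_quotient_J[OF s, of p] ordp_nonzero[OF r_ord[of p]]
    proof eventually_elim
      case (elim q)
      have "?r (J q) = 1 / ?r q" using elim by (simp add: field_simps)
      thus ?case using elim(2) by (simp add: field_simps)
    qed
    from ordp_cong[OF 1 this] have "ordp (?b \<circ> J) p (B p - (2 * D (J p) - 2 * D p))"
      by (simp only: add_0)
    with ordp_J[OF B] show ?thesis using ordp_unique by blast
  qed
  \<comment> \<open>The differential times \<open>?b\<close> is the differential minus its pullback,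
    hence anti-invariant. Since \<open>J\<close> has derivative -1 at the branch point, its order is
    even, and the differential itself contributes the even number \<open>2 * D p\<close>.\<close>
  have B_even: "even (B p)" if p: "J p = p" for p
  proof -
    obtain c where c: "c \<in> A" "p \<in> cdom c" by (rule chart_exists)
    have o: "ordp (\<lambda>q. differential s c q * ?b q) p (2 * D p + B p)"
      by (rule ordp_mult[OF differential_ordp[OF s c] B])
    have "\<forall>\<^sub>F q in at p. (differential s c (J q) * ?b (J q)) * chart_deriv J c c q
        = (-1) * (differential s c q * ?b q)"
      using loc[OF p c] pullback_quotient_J[OF s, of p]
    proof eventually_elim
      case (elim q)
      have "(differential s c (J q) * ?b (J q)) * chart_deriv J c c q
          = (differential s c (J q) * chart_deriv J c c q) * ?b (J q)"
        by (simp only: mult_ac)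
      also have "\<dots> = differential s c q * (?r q - ?r (J q) * ?r q)"
        unfolding elim(1) by (simp add: algebra_simps)
      also have "\<dots> = (-1) * (differential s c q * ?b q)"
        unfolding elim(2) by (simp add: algebra_simps)
      finally show ?case .
    qed
    from ordp_parity[OF p o deriv_lim[OF p c] this]
    have "(-1) powi (2 * D p + B p) = (1::complex)" by simp
    hence "even (2 * D p + B p)"
      by (cases "even (2 * D p + B p)") (simp_all add: power_int_minus_one_minus)
    thus ?thesis by simp
  qed
  \<comment> \<open>The amount by which the divisor of \<open>?b\<close> misses the desired one. It
    is invariant by \<open>BJ\<close>, and at a fixed point it equals \<open>B p\<close>, so it is
    even there.\<close>
  define k where "k p = B p - D (J p) + D p" for p
  have "\<exists>\<kappa> n. \<forall>p. ordp \<kappa> p (k p + n * pair P p)"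
  proof (rule invariant_divisor_principal)
    have "{p. k p \<noteq> 0} \<subseteq> {p. B p \<noteq> 0} \<union> {p. 2 * D (J p) - 2 * D p \<noteq> 0}"
      by (auto simp: k_def)
    thus "finite {p. k p \<noteq> 0}"
      using ordp_finite_support[OF B] ordp_finite_support[OF r_ord] by (meson finite_Un finite_subset)
    show "k (J p) = k p" for p using BJ[of p] by (simp add: k_def)
    show "even (k p)" if "J p = p" for p using B_even[OF that] that by (simp add: k_def)
  qed
  then obtain \<kappa> n where \<kappa>: "\<And>p. ordp \<kappa> p (k p + n * pair P p)" by blast
  define m where "m q = ?b q / \<kappa> q" for q
  have m: "ordp m p (D (J p) - D p - n * pair P p)" for p
  proof -
    have "B p - (k p + n * pair P p) = D (J p) - D p - n * pair P p" by (simp add: k_def)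
    with ordp_divide[OF B \<kappa>, of p] show ?thesis unfolding m_def[abs_def] by (simp only:)
  qed
  \<comment> \<open>The norm of \<open>m\<close> has all its zeros and poles in one fibre, so the maximum principle applies.\<close>
  have norm: "ordp (\<lambda>q. m q * (m \<circ> J) q) p (- 2 * n * pair P p)" for p
  proof -
    have "(D (J p) - D p - n * pair P p) + (D (J (J p)) - D (J p) - n * pair P (J p)) = - 2 * n * pair P p"
      by simp
    with ordp_mult[OF m ordp_J[OF m], of p] show ?thesis by (simp only:)
  qed
  \<comment> \<open>The sign of \<open>n\<close> decides whether the norm or its inverse is free of
    poles.\<close>
  have "n = 0"
  proof (cases "n \<le> 0")
    case True
    have "- 2 * n * pair P P = 0"
      by (rule ordp_maximum_principle[OF norm]) (use True pair_nonneg in \<open>simp add: mult_nonpos_nonneg\<close>)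
    thus ?thesis using pair_self[of P] by simp
  next
    case False
    have "- (- 2 * n * pair P P) = 0"
      by (rule ordp_maximum_principle[OF ordp_inverse[OF norm]]) (use False pair_nonneg in simp)
    thus ?thesis using pair_self[of P] by simp
  qed
  thus ?thesis using m by auto
qed

subsection \<open>The zeros are simple\<close>

lemma section_order_finite:
  assumes "section_order s D" shows "finite {p. D p \<noteq> 0}"
proof (rule finite_support)
  fix p
  obtain c where c: "c \<in> A" "p \<in> cdom c" by (rule chart_exists)
  show "\<forall>\<^sub>F q in at p. D q = 0"
    using ordp_eventually_0[OF section_orderD[OF assms c]] eventually_in_cdom[OF c]
    by eventually_elim (use section_orderD[OF assms c(1)] ordp_unique in blast)
qed

text \<open>One point from each of \<open>n\<close> different fibres. Another fibre is always
  available because punctured neighbourhoods avoid any finite set without becoming empty.\<close>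

lemma inequivalent_points: "\<exists>Ts :: 'a list. length Ts = n \<and> (\<forall>i<n. \<forall>j<n. pair (Ts ! i) (Ts ! j) = 0 \<longleftrightarrow> i \<noteq> j)"
proof (induction n)
  case (Suc n)
  then obtain Ts :: "'a list" where Ts: "length Ts = n"
    "\<And>i j. i < n \<Longrightarrow> j < n \<Longrightarrow> pair (Ts ! i) (Ts ! j) = 0 \<longleftrightarrow> i \<noteq> j" by blast
  obtain p :: 'a where True by blast
  have "\<forall>\<^sub>F q in at p. q \<notin> S" if "finite S" for S
    using that
  proof induction
    case (insert x S)
    from insert.IH eventually_neq_at_within[of x p UNIV] show ?case by eventually_elim simp
  qed simp
  from this[of "set Ts \<union> J ` set Ts"] obtain T where "T \<notin> set Ts \<union> J ` set Ts"
    using eventually_happens[of _ "at p"] at_neq_bot_surface by (metis List.finite_set finite_UnI finite_imageI)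
  hence T: "T \<noteq> Ts ! i" "T \<noteq> J (Ts ! i)" "J T \<noteq> Ts ! i" if "i < n" for i
    using that Ts(1) nth_mem by (metis UnCI imageI, metis UnCI imageI, metis J_J UnCI imageI)
  show ?case
  proof (intro exI[of _ "Ts @ [T]"] conjI allI impI)
    fix i j assume "i < Suc n" "j < Suc n"
    thus "pair ((Ts @ [T]) ! i) ((Ts @ [T]) ! j) = 0 \<longleftrightarrow> i \<noteq> j"
      using Ts T[of i] T[of j] pair_self[of T]
      by (cases "i = n"; cases "j = n") (auto simp: nth_append pair_def)
  qed (use Ts in simp)
qed simp

text \<open>Let n be the length of \<open>L\<close>. The differential times \<open>m\<close> has
  divisor \<open>D\<close> plus its conjugate, a sum of n fibres minus the fibre of
  \<open>P\<close>. Exchanging these n fibres for that of \<open>P\<close> and n - 1 fibres chosen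
  freely gives effective canonical divisors. Omitting each of n chosen fibres in turn yields n
  independent holomorphic differentials.\<close>

lemma multiplicity_bound:
  assumes g: "has_genus A g" and s: "section_order s D" and m: "\<And>p. ordp m p (D (J p) - D p)"
    and L: "\<And>p. D p = int (count_list L p) - of_bool (p = P)"
  shows "length L \<le> g"
proof -
  let ?n = "length L"
  obtain Ts where Ts: "length Ts = ?n"
    "\<And>i j. i < ?n \<Longrightarrow> j < ?n \<Longrightarrow> pair (Ts ! i) (Ts ! j) = 0 \<longleftrightarrow> i \<noteq> j"
    using inequivalent_points[of ?n] by blast
  have Lpair: "(\<Sum>T\<leftarrow>L. pair T p) = int (count_list L p) + int (count_list L (J p))" for p
  proof -
    have "pair T p = of_bool (p = T) + of_bool (J p = T)" for T
    proof -
      have "J p = T \<longleftrightarrow> p = J T" by (metis J_J)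
      thus ?thesis by (simp add: pair_def)
    qed
    thus ?thesis by (induction L) auto
  qed
  have DJ: "D p + D (J p) = (\<Sum>T\<leftarrow>L. pair T p) - pair P p" for p
  proof -
    have "J p = P \<longleftrightarrow> p = J P" by (metis J_J)
    hence "pair P p = of_bool (p = P) + of_bool (J p = P)" by (simp add: pair_def)
    thus ?thesis by (simp add: L Lpair)
  qed
  \<comment> \<open>With \<open>P\<close> in front the list has the length of \<open>L\<close>, as
    the exchange of fibres requires; the fibre of \<open>P\<close> cancels the negative part of the
    divisor.\<close>
  define others where "others i = map ((!) Ts) (filter (\<lambda>j. j \<noteq> i) [0..<?n])" for i
  have others_sum: "(\<Sum>T\<leftarrow>others i. pair T p) = (\<Sum>j | j < ?n \<and> j \<noteq> i. pair (Ts ! j) p)" for i p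
  proof -
    have "(\<Sum>T\<leftarrow>others i. pair T p) = (\<Sum>j\<leftarrow>filter (\<lambda>j. j \<noteq> i) [0..<?n]. pair (Ts ! j) p)"
      by (simp add: others_def comp_def)
    also have "\<dots> = sum (\<lambda>j. pair (Ts ! j) p) (set (filter (\<lambda>j. j \<noteq> i) [0..<?n]))"
      by (rule sum_list_distinct_conv_sum_set) simp
    also have "set (filter (\<lambda>j. j \<noteq> i) [0..<?n]) = {j. j < ?n \<and> j \<noteq> i}" by auto
    finally show ?thesis .
  qed
  have len: "length (P # others i) = ?n" if "i < ?n" for i
  proof -
    have "length (others i) = card (set (filter (\<lambda>j. j \<noteq> i) [0..<?n]))"
      unfolding others_def length_map by (rule distinct_card[symmetric]) simp
    also have "set (filter (\<lambda>j. j \<noteq> i) [0..<?n]) = {..<?n} - {i}" by auto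
    also have "card ({..<?n} - {i}) = ?n - 1" using that by simp
    finally show ?thesis using that by simp
  qed
  have "\<exists>\<kappa>. \<forall>p. ordp \<kappa> p ((\<Sum>T\<leftarrow>P # others i. pair T p) - (\<Sum>T\<leftarrow>L. pair T p))" if "i < ?n" for i
    by (rule pair_sums_principal[OF len[OF that]])
  then obtain \<kappa> where \<kappa>: "\<And>i p. i < ?n \<Longrightarrow> ordp (\<kappa> i) p ((\<Sum>T\<leftarrow>P # others i. pair T p) - (\<Sum>T\<leftarrow>L. pair T p))"
    by metis
  define E where "E i p = (\<Sum>j | j < ?n \<and> j \<noteq> i. pair (Ts ! j) p)" for i p
  define \<sigma> where "\<sigma> i c q = differential s c q * (m q * \<kappa> i q)" for i c q
  have \<sigma>_ord: "ordp (\<sigma> i c) p (E i p)" if "i < ?n" "c \<in> A" "p \<in> cdom c" for i c p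
  proof -
    have "ordp (\<sigma> i c) p (2 * D p + ((D (J p) - D p) + ((\<Sum>T\<leftarrow>P # others i. pair T p) - (\<Sum>T\<leftarrow>L. pair T p))))"
      unfolding \<sigma>_def[abs_def]
      by (rule ordp_mult[OF differential_ordp[OF s that(2,3)] ordp_mult[OF m \<kappa>[OF that(1)]]])
    moreover have "2 * D p + ((D (J p) - D p) + ((\<Sum>T\<leftarrow>P # others i. pair T p) - (\<Sum>T\<leftarrow>L. pair T p))) = E i p"
      using DJ[of p] others_sum[of p i] by (simp add: E_def)
    ultimately show ?thesis by simp
  qed
  have \<sigma>_tr: "\<sigma> i c q = canonical_bundle c d q * \<sigma> i d q"
    if "c \<in> A" "d \<in> A" "q \<in> cdom c" "q \<in> cdom d" for i c d q
    using differential_transition[OF s that] by (simp add: \<sigma>_def)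
  have E_nonneg: "0 \<le> E i p" for i p unfolding E_def by (rule sum_nonneg) (rule pair_nonneg)
  \<comment> \<open>The i-th differential vanishes at all chosen points but the i-th: the diagonal
    pattern that gives independence.\<close>
  have E_zero: "0 < E i (Ts ! j) \<longleftrightarrow> i \<noteq> j" if ij: "i < ?n" "j < ?n" for i j
  proof -
    have "E i (Ts ! j) = 0 \<longleftrightarrow> (\<forall>l\<in>{l. l < ?n \<and> l \<noteq> i}. pair (Ts ! l) (Ts ! j) = 0)"
      unfolding E_def by (rule sum_nonneg_eq_0_iff) (auto simp: pair_nonneg)
    also have "\<dots> \<longleftrightarrow> i = j" using Ts(2) ij by auto
    finally show ?thesis using E_nonneg[of i "Ts ! j"] by linarith
  qed
  note n = normalise_section[OF canonical_bundle_regular]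
  have "card {..<?n} \<le> g"
  proof (rule has_h0_bound[where s = "\<lambda>i. normalise (\<sigma> i)" and c = "\<lambda>j. chart_of (Ts ! j)" and x = "(!) Ts"])
    show "has_h0 A canonical_bundle g" using g by (simp add: has_genus_def)
    show "normalise (\<sigma> i) \<in> holomorphic_sections A canonical_bundle" if "i \<in> {..<?n}" for i
      by (rule n(3)[OF \<sigma>_tr \<sigma>_ord E_nonneg]) (use that in auto)
    show "normalise (\<sigma> i) (chart_of (Ts ! j)) (Ts ! j) = 0 \<longleftrightarrow> i \<noteq> j" if "i \<in> {..<?n}" "j \<in> {..<?n}" for i j
    proof -
      have "normalise (\<sigma> i) (chart_of (Ts ! j)) (Ts ! j) = 0 \<longleftrightarrow> 0 < E i (Ts ! j)"
        by (rule n(4)[OF \<sigma>_tr \<sigma>_ord chart_of E_nonneg]) (use that in auto)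
      thus ?thesis using E_zero that by simp
    qed
  qed simp
  thus ?thesis by simp
qed

lemma count_list_exists:
  fixes f :: "'b \<Rightarrow> nat"
  assumes "finite {x. f x \<noteq> 0}"
  obtains L where "\<And>x. count_list L x = f x"
proof -
  have "finite {x. 0 < f x}" using assms by simp
  hence "count (Abs_multiset f) = f" by (simp add: count_Abs_multiset)
  moreover obtain L where "mset L = Abs_multiset f" using ex_mset by blast
  ultimately have "count_list L x = f x" for x by (metis count_mset)
  thus thesis by (rule that)
qed

text \<open>Once the zeros are simple, \<open>D\<close> is the indicator of \<open>Z\<close> minus
  that of \<open>P\<close>. The sections for \<open>J P\<close>, \<open>K\<close> and
  \<open>J K\<close> are then \<open>s\<close> times \<open>m\<close>, \<open>m \<mu>\<close> and
  \<open>\<mu>\<close>, where \<open>\<mu>\<close> has divisor P + J P - K - J K; their zeros are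
  read off from the sum of the divisors.\<close>

lemma spin_neighbours:
  assumes g: "has_genus A g" "0 < g" and card: "card (zero_points A \<xi> P) = g"
  defines "Z \<equiv> zero_points A \<xi> P"
  shows "P \<notin> Z" "zero_points A \<xi> (J P) = {R. J R \<in> Z}"
    "\<And>K. K \<in> Z \<Longrightarrow> zero_points A \<xi> K = insert P {R. J R \<in> Z \<and> J R \<noteq> K}"
    "\<And>K. K \<in> Z \<Longrightarrow> zero_points A \<xi> (J K) = insert (J P) (Z - {K})"
proof -
  have "Z \<noteq> {}" using card g(2) by (auto simp: Z_def)
  then obtain s where "simple_pole_section A \<xi> P s" unfolding Z_def zero_points_def by blast
  then obtain D where D: "section_order s D" "D P = -1" "\<And>p. p \<noteq> P \<Longrightarrow> 0 \<le> D p"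
    by (rule simple_pole_section_order) blast
  have Z: "Z = {R. 0 < D R + of_bool (R = P)}"
    unfolding Z_def
  proof (rule zero_points_eq[OF D(1) ordp_const[of 1]])
    show "D p + 0 = D p + of_bool (p = P) - of_bool (p = P)" for p by simp
    show "0 \<le> D p + of_bool (p = P)" for p using D(2) D(3)[of p] by (cases "p = P") auto
  qed simp
  show PZ: "P \<notin> Z" using D(2) by (simp add: Z)
  obtain m where m: "\<And>p. ordp m p (D (J p) - D p)" using conjugate_section[OF D] by blast
  \<comment> \<open>The zeros listed with multiplicity. The summand at \<open>P\<close> cancels the
    simple pole, so the argument of \<open>nat\<close> is nonnegative everywhere.\<close>
  obtain L where L: "\<And>p. count_list L p = nat (D p + of_bool (p = P))"
  proof (rule count_list_exists[of "\<lambda>p. nat (D p + of_bool (p = P))"])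
    have "{p. nat (D p + of_bool (p = P)) \<noteq> 0} \<subseteq> {p. D p \<noteq> 0}" using D(2) by auto
    thus "finite {p. nat (D p + of_bool (p = P)) \<noteq> 0}"
      using section_order_finite[OF D(1)] finite_subset by blast
  qed blast
  have L': "D p = int (count_list L p) - of_bool (p = P)" for p
    using D(2) D(3)[of p] by (cases "p = P") (auto simp: L)
  have "set L = Z"
  proof -
    have "x \<in> set L \<longleftrightarrow> 0 < count_list L x" for x using count_list_0_iff[of L x] by auto
    hence "x \<in> set L \<longleftrightarrow> x \<in> Z" for x by (simp add: Z L)
    thus ?thesis by blast
  qed
  hence "card (set L) = g" using card by (simp add: Z_def)
  moreover have "length L \<le> g" by (rule multiplicity_bound[OF g(1) D(1) m L'])
  \<comment> \<open>There are g distinct zeros by assumption and at most g with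
    multiplicity.\<close>
  ultimately have "distinct L" using card_length[of L] card_distinct[of L] by simp
  hence "count_list L p = of_bool (p \<in> set L)" for p by (induction L) auto
  hence "count_list L p = of_bool (p \<in> Z)" for p using \<open>set L = Z\<close> by simp
  hence Dp: "D p = of_bool (p \<in> Z) - of_bool (p = P)" for p using L'[of p] by simp
  have Jsw: "J p = T \<longleftrightarrow> p = J T" for p T by (metis J_J)
  show "zero_points A \<xi> (J P) = {R. J R \<in> Z}"
  proof -
    have "zero_points A \<xi> (J P) = {R. 0 < (of_bool (J R \<in> Z) :: int)}"
      by (rule zero_points_eq[OF D(1) m]) (auto simp: Dp Jsw)
    thus ?thesis by auto
  qed
  fix K assume K: "K \<in> Z"
  obtain \<mu> where \<mu>: "\<And>p. ordp \<mu> p (pair P p - pair K p)" using pair_difference_principal by blast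
  have KP: "K \<noteq> P" using K PZ by blast
  show "zero_points A \<xi> K = insert P {R. J R \<in> Z \<and> J R \<noteq> K}"
  proof -
    have "zero_points A \<xi> K = {R. 0 < (of_bool (J R \<in> Z \<and> J R \<noteq> K) + of_bool (R = P) :: int)}"
    proof (rule zero_points_eq[OF D(1) ordp_mult[OF m \<mu>]])
      fix p
      have "(of_bool (J p \<in> Z) :: int) = of_bool (J p \<in> Z \<and> J p \<noteq> K) + of_bool (p = J K)"
        using K Jsw[of p K] by auto
      thus "D p + (D (J p) - D p + (pair P p - pair K p)) =
          of_bool (J p \<in> Z \<and> J p \<noteq> K) + of_bool (p = P) - of_bool (p = K)"
        by (simp add: Dp pair_def Jsw)
    qed simp
    thus ?thesis by auto
  qed
  show "zero_points A \<xi> (J K) = insert (J P) (Z - {K})"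
  proof -
    have "zero_points A \<xi> (J K) = {R. 0 < (of_bool (R \<in> Z \<and> R \<noteq> K) + of_bool (R = J P) :: int)}"
    proof (rule zero_points_eq[OF D(1) \<mu>])
      fix p
      have "(of_bool (p \<in> Z) :: int) = of_bool (p \<in> Z \<and> p \<noteq> K) + of_bool (p = K)"
        using K by auto
      thus "D p + (pair P p - pair K p) =
          of_bool (p \<in> Z \<and> p \<noteq> K) + of_bool (p = J P) - of_bool (p = J K)"
        by (simp add: Dp pair_def)
    qed simp
    thus ?thesis by auto
  qed
qed

end

section \<open>Standard spin graphs\<close>

text \<open>Phrasing the graph through two sides exchanged by \<open>J\<close> makes all vertices
  alike and avoids distinguishing the four kinds P, J P, P_k, J P_k in the combinatorial
  part.\<close>

locale spin_graph =
  fixes V :: "'a set" and side :: "'a \<Rightarrow> bool" and J :: "'a \<Rightarrow> 'a" and N :: "'a \<Rightarrow> 'a set" and P :: 'a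
    and g :: nat
  assumes J_in: "Q \<in> V \<Longrightarrow> J Q \<in> V"
    and J_J [simp]: "J (J Q) = Q"
    and side_J: "Q \<in> V \<Longrightarrow> side (J Q) \<longleftrightarrow> \<not> side Q"
    and N_eq: "Q \<in> V \<Longrightarrow> N Q = {R \<in> V. side R \<noteq> side Q \<and> R \<noteq> J Q}"
    and V_eq: "spin_vertices N P = V"
    and finite_V: "finite V"
    and card_N: "Q \<in> V \<Longrightarrow> card (N Q) = g"
    and g_ge: "3 \<le> g"
begin

lemma J_eq_iff [simp]: "J Q = J R \<longleftrightarrow> Q = R"
  by (metis J_J)

lemma in_N_iff: "Q \<in> V \<Longrightarrow> R \<in> N Q \<longleftrightarrow> R \<in> V \<and> side R \<noteq> side Q \<and> R \<noteq> J Q"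
  by (simp add: N_eq)

lemmas in_ND = in_N_iff[THEN iffD1]

lemma N_sym: "Q \<in> V \<Longrightarrow> R \<in> N Q \<Longrightarrow> Q \<in> N R"
  using in_N_iff[of Q R] in_N_iff[of R Q] by (metis J_J)

lemma edge_iff: "{Q, R} \<in> spin_edges N P \<longleftrightarrow> Q \<in> V \<and> R \<in> N Q"
proof
  assume "{Q, R} \<in> spin_edges N P"
  then obtain Q' R' where "{Q, R} = {Q', R'}" "Q' \<in> V" "R' \<in> N Q'"
    unfolding spin_edges_def V_eq by auto
  thus "Q \<in> V \<and> R \<in> N Q" using N_sym[of Q' R'] in_N_iff[of Q' R'] by (auto simp: doubleton_eq_iff)
qed (auto simp: spin_edges_def V_eq)

text \<open>
  The graph is a complete bipartite graph without the perfect matching of conjugate points, so four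
  distinct pairwise nonconjugate vertices on alternating sides span a face.
\<close>

definition square :: "'a \<Rightarrow> 'a \<Rightarrow> 'a \<Rightarrow> 'a \<Rightarrow> bool" where
  "square V1 V2 V3 V4 \<longleftrightarrow> V1 \<in> V \<and> V2 \<in> V \<and> V3 \<in> V \<and> V4 \<in> V \<and>
     side V2 \<noteq> side V1 \<and> side V3 = side V1 \<and> side V4 = side V2 \<and> V3 \<noteq> V1 \<and> V4 \<noteq> V2 \<and>
     V2 \<noteq> J V1 \<and> V4 \<noteq> J V1 \<and> V2 \<noteq> J V3 \<and> V4 \<noteq> J V3"

lemma square_rotate: "square V1 V2 V3 V4 \<Longrightarrow> square V2 V3 V4 V1"
  unfolding square_def by (metis J_J)

lemma square_reflect: "square V1 V2 V3 V4 \<Longrightarrow> square V2 V1 V4 V3"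
  unfolding square_def by (metis J_J)

lemma quad_rotate: "quad V1 V2 V3 V4 = quad V2 V3 V4 V1"
  unfolding quad_def by auto

lemma quad_reflect: "quad V1 V2 V3 V4 = quad V2 V1 V4 V3"
  unfolding quad_def by (auto simp: insert_commute)

lemma square_distinct: "square V1 V2 V3 V4 \<Longrightarrow> distinct [V1, V2, V3, V4]"
  unfolding square_def by auto

lemma square_is_face: "square V1 V2 V3 V4 \<Longrightarrow> is_face N J P (quad V1 V2 V3 V4)"
proof -
  assume s: "square V1 V2 V3 V4"
  have e: "{A, B} \<in> spin_edges N P" if "square A B C D" for A B C D
    using that by (auto simp: edge_iff in_N_iff square_def)
  have "quad V1 V2 V3 V4 \<subseteq> spin_edges N P"
    unfolding quad_def using e[OF s] e[OF square_rotate[OF s]] e[OF square_rotate[OF square_rotate[OF s]]]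
      e[OF square_rotate[OF square_rotate[OF square_rotate[OF s]]]] by simp
  \<comment> \<open>Vertices on the same side are never conjugate because \<open>J\<close> changes
    sides; the pairs on opposite sides are excluded in \<open>square\<close>.\<close>
  moreover have "\<forall>V\<in>{V1, V2, V3, V4}. \<forall>W\<in>{V1, V2, V3, V4}. V \<noteq> W \<longrightarrow> V \<noteq> J W"
  proof -
    have "side (J V1) \<noteq> side V1" "side (J V2) \<noteq> side V2" "side (J V3) \<noteq> side V3" "side (J V4) \<noteq> side V4"
      using s side_J by (auto simp: square_def)
    with s show ?thesis unfolding square_def by (metis J_J empty_iff insert_iff)
  qed
  ultimately show ?thesis
    unfolding is_face_def using square_distinct[OF s] by blast
qed

text \<open>A face is only a set of edges; four rotations and a reflection let it be read from any
  of its oriented edges.\<close>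

lemma face_square:
  assumes "is_face N J P F" "{A, B} \<in> F"
  obtains C D where "F = quad A B C D" "square A B C D"
proof -
  obtain V1 V2 V3 V4 where F: "F = quad V1 V2 V3 V4" "distinct [V1, V2, V3, V4]" "F \<subseteq> spin_edges N P"
    and nc: "\<forall>V\<in>{V1, V2, V3, V4}. \<forall>W\<in>{V1, V2, V3, V4}. V \<noteq> W \<longrightarrow> V \<noteq> J W"
    using assms(1) unfolding is_face_def by (elim exE conjE) (rule that)
  have e: "V1 \<in> V \<and> V2 \<in> N V1" "V2 \<in> V \<and> V3 \<in> N V2" "V3 \<in> V \<and> V4 \<in> N V3" "V4 \<in> V \<and> V1 \<in> N V4"
    using F(1,3) by (auto simp: quad_def edge_iff)
  have s: "square V1 V2 V3 V4"
    using e nc F(2) in_N_iff[of V1 V2] in_N_iff[of V2 V3] in_N_iff[of V3 V4] in_N_iff[of V4 V1]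
    unfolding square_def by auto
  note s2 = square_rotate[OF s]
  note s3 = square_rotate[OF s2]
  note s4 = square_rotate[OF s3]
  have F2: "F = quad V2 V3 V4 V1" using F(1) quad_rotate[of V1 V2 V3 V4] by simp
  have F3: "F = quad V3 V4 V1 V2" using F2 quad_rotate[of V2 V3 V4 V1] by simp
  have F4: "F = quad V4 V1 V2 V3" using F3 quad_rotate[of V3 V4 V1 V2] by simp
  have "{A, B} = {V1, V2} \<or> {A, B} = {V2, V3} \<or> {A, B} = {V3, V4} \<or> {A, B} = {V4, V1}"
    using assms(2) F(1) by (simp add: quad_def)
  moreover have "thesis" if "{A, B} = {W1, W2}" "square W1 W2 W3 W4" "F = quad W1 W2 W3 W4" for W1 W2 W3 W4
  proof -
    from that(1) consider "A = W1" "B = W2" | "A = W2" "B = W1" by (auto simp: doubleton_eq_iff)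
    thus thesis
    proof cases
      case 1 with that(2,3) show thesis using \<open>\<And>C D. F = quad A B C D \<Longrightarrow> square A B C D \<Longrightarrow> thesis\<close> by blast
    next
      case 2
      with square_reflect[OF that(2)] that(3) quad_reflect[of W1 W2 W3 W4] show thesis
        using \<open>\<And>C D. F = quad A B C D \<Longrightarrow> square A B C D \<Longrightarrow> thesis\<close> by metis
    qed
  qed
  ultimately show thesis using s s2 s3 s4 F(1) F2 F3 F4 by blast
qed

text \<open>Justifies the definite description in \<open>transport\<close>: the second edge at each
  end of \<open>{A, B}\<close> is determined by the edge set.\<close>

lemma quad_determined:
  assumes "distinct [A, B, C, D]" "quad A B C D = quad A B C' D'"
  shows "C' = C \<and> D' = D"
proof -
  have d: "A \<noteq> B" "A \<noteq> C" "A \<noteq> D" "B \<noteq> C" "B \<noteq> D" "C \<noteq> D" using assms(1) by auto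
  have "{D, A} \<in> quad A B C D" "{B, C} \<in> quad A B C D" "{C, D} \<in> quad A B C D"
    by (simp_all add: quad_def)
  hence "{D, A} \<in> quad A B C' D'" "{B, C} \<in> quad A B C' D'" "{C, D} \<in> quad A B C' D'"
    by (simp_all only: assms(2))
  hence 1: "{D, A} = {A, B} \<or> {D, A} = {B, C'} \<or> {D, A} = {C', D'} \<or> {D, A} = {D', A}"
    and 2: "{B, C} = {A, B} \<or> {B, C} = {B, C'} \<or> {B, C} = {C', D'} \<or> {B, C} = {D', A}"
    and 3: "{C, D} = {A, B} \<or> {C, D} = {B, C'} \<or> {C, D} = {C', D'} \<or> {C, D} = {D', A}"
    unfolding quad_def by simp_all
  from 1 2 3 d show ?thesis unfolding doubleton_eq_iff by metis
qed

lemma transport_eq: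
  assumes "square A B C D"
  shows "transport J (quad A B C D) A B T =
    (if T = D then A else if T = B then C else if T = J C then J D else J T)"
proof -
  have "(THE (V3, V4). quad A B C D = quad A B V3 V4) = (C, D)"
  proof (rule the_equality)
    fix x :: "'a \<times> 'a" assume "case x of (V3, V4) \<Rightarrow> quad A B C D = quad A B V3 V4"
    thus "x = (C, D)" using quad_determined[OF square_distinct[OF assms]] by (cases x) auto
  qed simp
  thus ?thesis unfolding transport_def by (simp add: Let_def)
qed

text \<open>Conjugation alone nearly works: it carries \<open>N A\<close> to the side of
  \<open>A\<close> without \<open>A\<close>, whereas \<open>N B\<close> is that side without
  \<open>J B\<close>. The exceptional values D to A, B to C and J C to J D exchange
  \<open>J B\<close> for \<open>A\<close>.\<close>

lemma transport_in:
  assumes s: "square A B C D" and T: "T \<in> N A"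
  shows "transport J (quad A B C D) A B T \<in> N B"
proof -
  have A: "A \<in> V" "B \<in> V" "C \<in> V" "D \<in> V" using s by (auto simp: square_def)
  have T': "T \<in> V" "side T \<noteq> side A" "T \<noteq> J A" using T in_N_iff[OF A(1)] by auto
  have j: "J T \<in> V" "side (J T) \<noteq> side T" "J D \<in> V" "side (J D) \<noteq> side D"
    using J_in T'(1) side_J A(4) by auto
  show ?thesis
    using s A T' j unfolding transport_eq[OF s] in_N_iff[OF A(2)] square_def by (auto simp: J_eq_iff)
qed

text \<open>Along the reversed edge the face reads B, A, D, C, so the rule sends A to D, C to B and
  J D to J C, undoing each exceptional value.\<close>

lemma transport_inverse:
  assumes s: "square A B C D" and T: "T \<in> N A"
  shows "transport J (quad A B C D) B A (transport J (quad A B C D) A B T) = T"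
proof -
  have A: "A \<in> V" "B \<in> V" "C \<in> V" "D \<in> V" using s by (auto simp: square_def)
  have T': "T \<in> V" "side T \<noteq> side A" "T \<noteq> J A" using T in_N_iff[OF A(1)] by auto
  have j: "side (J T) \<noteq> side T" "side (J D) \<noteq> side D" "side (J C) \<noteq> side C"
    using T'(1) side_J A by auto
  show ?thesis
    unfolding transport_eq[OF s] quad_reflect[of A B C D] transport_eq[OF square_reflect[OF s]]
    using s T' j unfolding square_def by (auto simp: quad_reflect transport_eq[OF s])
qed

subsection \<open>Transport along paths\<close>

text \<open>Keeps only the composed map of a walk with faces, not the lists, so that concatenation
  and reversal become simple inductions. Unlike \<open>spin_chain\<close> it admits the empty
  walk.\<close>

inductive path_transport :: "'a \<Rightarrow> 'a \<Rightarrow> ('a \<Rightarrow> 'a) \<Rightarrow> bool" where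
  refl: "path_transport Q Q id"
| step: "square A B C D \<Longrightarrow> path_transport B R f \<Longrightarrow>
          path_transport A R (f \<circ> transport J (quad A B C D) A B)"

lemma path_transport_trans:
  "path_transport Q R f \<Longrightarrow> path_transport R S h \<Longrightarrow> path_transport Q S (h \<circ> f)"
proof (induction rule: path_transport.induct)
  case (step A B C D R f)
  have "path_transport B S (h \<circ> f)" using step by blast
  from path_transport.step[OF step(1) this] show ?case by (simp only: comp_assoc)
qed simp

lemma path_transport_single:
  "square A B C D \<Longrightarrow> path_transport A B (transport J (quad A B C D) A B)"
  using path_transport.step[OF _ path_transport.refl] by simp

lemma path_transport_in: "path_transport Q R f \<Longrightarrow> T \<in> N Q \<Longrightarrow> f T \<in> N R"
  by (induction arbitrary: T rule: path_transport.induct) (auto simp: transport_in)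

text \<open>Reversal of the walk. The two maps are inverse only on the sets of neighbours; off these
  sets nothing is claimed.\<close>

lemma path_transport_inverse:
  "path_transport Q R f \<Longrightarrow> \<exists>h. path_transport R Q h \<and> (\<forall>T\<in>N Q. h (f T) = T) \<and> (\<forall>T\<in>N R. f (h T) = T)"
proof (induction rule: path_transport.induct)
  case (refl Q)
  show ?case by (intro exI[of _ id] conjI path_transport.refl) auto
next
  case (step A B C D R f)
  then obtain h where h: "path_transport R B h" "\<forall>T\<in>N B. h (f T) = T" "\<forall>T\<in>N R. f (h T) = T" by blast
  let ?t = "transport J (quad B A D C) B A" and ?u = "transport J (quad A B C D) A B"
  have s: "square B A D C" using square_reflect[OF step(1)] .
  have q: "quad B A D C = quad A B C D" by (rule quad_reflect)
  have "path_transport R A (?t \<circ> h)"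
    by (rule path_transport_trans[OF h(1) path_transport_single[OF s]])
  moreover have "(?t \<circ> h) ((f \<circ> ?u) T) = T" if "T \<in> N A" for T
    using h(2) transport_in[OF step(1) that] transport_inverse[OF step(1) that] q by simp
  moreover have "(f \<circ> ?u) ((?t \<circ> h) T) = T" if "T \<in> N R" for T
    using h(3) that transport_inverse[OF s path_transport_in[OF h(1) that]] q by simp
  ultimately show ?case by blast
qed

lemma path_transport_bij: "path_transport Q R f \<Longrightarrow> bij_betw f (N Q) (N R)"
proof -
  assume f: "path_transport Q R f"
  obtain h where h: "path_transport R Q h" "\<forall>T\<in>N Q. h (f T) = T" "\<forall>T\<in>N R. f (h T) = T"
    using path_transport_inverse[OF f] by blast
  show ?thesis
    by (rule bij_betw_byWitness[of _ h]) (use h path_transport_in[OF f] path_transport_in[OF h(1)] in auto)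
qed

text \<open>\<open>J C\<close> lies on the side of \<open>Q\<close>, and its only nonneighbour on
  the other side is \<open>C\<close>, so it closes the path B, Q, D to a face. All canonical faces
  arise in this way.\<close>

lemma square_of_neighbours:
  assumes Q: "Q \<in> V" and in_N: "B \<in> N Q" "C \<in> N Q" "D \<in> N Q" and ne: "B \<noteq> C" "B \<noteq> D" "C \<noteq> D"
  shows "square Q B (J C) D"
proof -
  note B = in_ND[OF Q in_N(1)]
    and C = in_ND[OF Q in_N(2)]
    and D = in_ND[OF Q in_N(3)]
  have "J C \<noteq> Q" using C by (metis J_J)
  moreover have "side (J C) = side Q" using C side_J[of C] by blast
  moreover have "side D = side B" using B D by blast
  moreover have "J C \<in> V" using J_in C by blast
  ultimately show ?thesis
    unfolding square_def J_J using Q B D ne by blast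
qed

lemma square_exists:
  assumes "Q \<in> V" obtains B C D where "square Q B C D"
proof -
  obtain T where T: "T \<subseteq> N Q" "card T = 3"
    using obtain_subset_with_card_n[of 3 "N Q"] card_N[OF assms] g_ge by auto
  obtain B C D where "T = {B, C, D}" and ne: "B \<noteq> C" "B \<noteq> D" "C \<noteq> D"
    using T(2) card_3_iff[of T] by blast
  hence in_N: "B \<in> N Q" "C \<in> N Q" "D \<in> N Q" using T(1) by blast+
  show thesis by (rule that[OF square_of_neighbours[OF assms in_N ne]])
qed

text \<open>A \<open>spin_chain\<close> freed from being closed and from having an edge, as the
  induction on paths requires.\<close>

definition face_walk :: "'a list \<Rightarrow> 'a set set list \<Rightarrow> bool" where
  "face_walk Vs Fs \<longleftrightarrow> Vs \<noteq> [] \<and> length Vs = Suc (length Fs) \<and>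
     (\<forall>i<length Fs. {Vs ! i, Vs ! Suc i} \<in> spin_edges N P \<and>
                    is_face N J P (Fs ! i) \<and> {Vs ! i, Vs ! Suc i} \<in> Fs ! i)"

lemma path_transport_chain:
  assumes "path_transport Q R f" "Q \<in> V"
  shows "\<exists>Vs Fs. face_walk Vs Fs \<and> hd Vs = Q \<and> last Vs = R \<and> transport_along J Vs Fs = f"
  using assms
proof (induction rule: path_transport.induct)
  case (refl Q)
  show ?case by (intro exI[of _ "[Q]"] exI[of _ "[]"]) (auto simp: face_walk_def)
next
  case (step A B C D R f)
  have "B \<in> V" using step(1) by (simp add: square_def)
  then obtain Vs Fs where h: "face_walk Vs Fs" "hd Vs = B" "last Vs = R" "transport_along J Vs Fs = f"
    using step by blast
  obtain Ws where Vs: "Vs = B # Ws" using h(1,2) by (cases Vs) (auto simp: face_walk_def)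
  have "{A, B} \<in> spin_edges N P" "{A, B} \<in> quad A B C D"
    using step(1) by (auto simp: edge_iff in_N_iff square_def quad_def)
  moreover note square_is_face[OF step(1)]
  ultimately show ?case using h Vs
    by (intro exI[of _ "A # Vs"] exI[of _ "quad A B C D # Fs"])
       (auto simp: face_walk_def nth_Cons split: nat.splits)
qed

lemma chain_path_transport:
  assumes "Vs \<noteq> []" "length Vs = Suc (length Fs)"
     "\<forall>i<length Fs. is_face N J P (Fs ! i) \<and> {Vs ! i, Vs ! Suc i} \<in> Fs ! i"
  shows "path_transport (hd Vs) (last Vs) (transport_along J Vs Fs)"
  using assms
proof (induction Fs arbitrary: Vs)
  case Nil
  then obtain Q where Q: "Vs = [Q]" by (cases Vs) auto
  have "transport_along J [Q] [] = id" "hd [Q] = Q" "last [Q] = Q" by auto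
  thus ?case unfolding Q using path_transport.refl[of Q] by metis
next
  case (Cons F Fs)
  then obtain A B Ws where Vs: "Vs = A # B # Ws"
    by (metis Suc_length_conv length_Cons)
  have "path_transport (hd (B # Ws)) (last (B # Ws)) (transport_along J (B # Ws) Fs)"
    by (rule Cons.IH[of "B # Ws"]) (use Cons.prems Vs in \<open>auto simp: nth_Cons split: nat.splits\<close>)
  hence p: "path_transport B (last Vs) (transport_along J (B # Ws) Fs)" by (simp only: Vs list.sel last.simps) simp
  have "is_face N J P F" "{A, B} \<in> F" using Cons.prems(3)[rule_format, of 0] Vs by auto
  then obtain C D where F: "F = quad A B C D" "square A B C D" by (rule face_square)
  have "transport_along J Vs (F # Fs) = transport_along J (B # Ws) Fs \<circ> transport J (quad A B C D) A B" "hd Vs = A"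
    unfolding Vs F(1) by (simp_all only: transport_along.simps list.sel)
  with path_transport.step[OF F(2) p] show ?case by (simp only:)
qed

lemma spin_perms_eq:
  assumes "Q \<in> V"
  shows "spin_perms N J P Q = {restrict f (N Q) | f. path_transport Q Q f}"
proof (intro equalityI subsetI)
  fix x assume "x \<in> spin_perms N J P Q"
  then obtain Vs Fs where x: "x = restrict (transport_along J Vs Fs) (N Q)" "spin_chain N J P Q Vs Fs"
    unfolding spin_perms_def by blast
  have "path_transport (hd Vs) (last Vs) (transport_along J Vs Fs)"
    by (rule chain_path_transport) (use x(2) in \<open>auto simp: spin_chain_def\<close>)
  thus "x \<in> {restrict f (N Q) | f. path_transport Q Q f}" using x by (auto simp: spin_chain_def)
next
  fix x assume "x \<in> {restrict f (N Q) | f. path_transport Q Q f}"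
  then obtain f where x: "x = restrict f (N Q)" "path_transport Q Q f" by blast
  \<comment> \<open>A spin chain has at least one edge, so the constant path is replaced by a path to a neighbour and back.\<close>
  obtain B C D where s: "square Q B C D" by (rule square_exists[OF assms])
  let ?t = "transport J (quad Q B C D) Q B" and ?u = "transport J (quad B Q D C) B Q"
  have "path_transport B Q (f \<circ> ?u)"
    by (rule path_transport_trans[OF path_transport_single[OF square_reflect[OF s]] x(2)])
  moreover have "B \<in> V" using s by (simp add: square_def)
  ultimately obtain Vs Fs where h: "face_walk Vs Fs" "hd Vs = B" "last Vs = Q" "transport_along J Vs Fs = f \<circ> ?u"
    using path_transport_chain by blast
  obtain Ws where Vs: "Vs = B # Ws" using h(1,2) by (cases Vs) (auto simp: face_walk_def)
  have "{Q, B} \<in> spin_edges N P" "{Q, B} \<in> quad Q B C D"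
    using s by (auto simp: edge_iff in_N_iff square_def quad_def)
  hence "spin_chain N J P Q (Q # Vs) (quad Q B C D # Fs)"
    unfolding spin_chain_def using h Vs square_is_face[OF s]
    by (auto simp: face_walk_def nth_Cons split: nat.splits)
  moreover have "restrict (transport_along J (Q # Vs) (quad Q B C D # Fs)) (N Q) = x"
    unfolding x(1) Vs using h(4)[unfolded Vs] transport_inverse[OF s] quad_reflect[of B Q D C]
    by (auto simp: fun_eq_iff restrict_def)
  ultimately show "x \<in> spin_perms N J P Q" unfolding spin_perms_def by blast
qed

section \<open>Spin groups and conjugation by path transports\<close>

lemma spin_perms_subset_Bij: "Q \<in> V \<Longrightarrow> spin_perms N J P Q \<subseteq> Bij (N Q)"
  unfolding spin_perms_eq Bij_def using path_transport_bij bij_betw_restrict_eq by fastforce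

lemma compose_restrict:
  assumes "\<And>x. x \<in> S \<Longrightarrow> h x \<in> S"
  shows "compose S (restrict f S) (restrict h S) = restrict (f \<circ> h) S"
  by (rule ext) (simp add: compose_def restrict_def assms)

text \<open>With elements given by closed paths, products come from concatenation, inverses from
  reversal, and the identity from the empty path.\<close>

lemma spin_group_group:
  assumes "Q \<in> V" shows "group (spin_group N J P Q)"
proof -
  interpret B: group "BijGroup (N Q)" by (rule group_BijGroup)
  have sub: "spin_perms N J P Q \<subseteq> Bij (N Q)" by (rule spin_perms_subset_Bij[OF assms])
  have mult: "a \<otimes>\<^bsub>BijGroup (N Q)\<^esub> b = compose (N Q) a b"
    if "a \<in> spin_perms N J P Q" "b \<in> spin_perms N J P Q" for a b
    using that sub by (auto simp: BijGroup_def)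
  have car: "carrier (BijGroup (N Q)) = Bij (N Q)" by (simp add: BijGroup_def)
  have "subgroup (spin_perms N J P Q) (BijGroup (N Q))"
  proof (rule B.subgroupI)
    show "spin_perms N J P Q \<subseteq> carrier (BijGroup (N Q))" using sub car by simp
    show "spin_perms N J P Q \<noteq> {}" unfolding spin_perms_eq[OF assms] using path_transport.refl by blast
  next
    fix a assume a: "a \<in> spin_perms N J P Q"
    then obtain f where f: "a = restrict f (N Q)" "path_transport Q Q f"
      unfolding spin_perms_eq[OF assms] by blast
    obtain h where h: "path_transport Q Q h" "\<forall>T\<in>N Q. h (f T) = T" "\<forall>T\<in>N Q. f (h T) = T"
      using path_transport_inverse[OF f(2)] by blast
    have hm: "restrict h (N Q) \<in> spin_perms N J P Q" unfolding spin_perms_eq[OF assms] using h(1) by blast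
    have "restrict h (N Q) \<otimes>\<^bsub>BijGroup (N Q)\<^esub> a = restrict (h \<circ> f) (N Q)"
      using compose_restrict[where S = "N Q" and h = f and f = h, OF path_transport_in[OF f(2)]] mult[OF hm a] f(1) by simp
    also have "\<dots> = (\<lambda>x\<in>N Q. x)" by (rule restrict_ext) (simp add: h(2))
    also have "\<dots> = \<one>\<^bsub>BijGroup (N Q)\<^esub>" by (simp add: BijGroup_def)
    finally have "inv\<^bsub>BijGroup (N Q)\<^esub> a = restrict h (N Q)"
      by (rule B.inv_equality) (use a hm sub car in auto)
    thus "inv\<^bsub>BijGroup (N Q)\<^esub> a \<in> spin_perms N J P Q" using hm by simp
  next
    fix a b assume a: "a \<in> spin_perms N J P Q" and b: "b \<in> spin_perms N J P Q"
    obtain f where f: "a = restrict f (N Q)" "path_transport Q Q f"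
      using a unfolding spin_perms_eq[OF assms] by blast
    obtain h where h: "b = restrict h (N Q)" "path_transport Q Q h"
      using b unfolding spin_perms_eq[OF assms] by blast
    have "a \<otimes>\<^bsub>BijGroup (N Q)\<^esub> b = restrict (f \<circ> h) (N Q)"
      using compose_restrict[where S = "N Q" and h = h and f = f, OF path_transport_in[OF h(2)]] mult[OF a b] f(1) h(1) by simp
    thus "a \<otimes>\<^bsub>BijGroup (N Q)\<^esub> b \<in> spin_perms N J P Q"
      unfolding spin_perms_eq[OF assms] using path_transport_trans[OF h(2) f(2)] by blast
  qed
  thus ?thesis unfolding spin_group_def by (rule B.subgroup_imp_group)
qed

text \<open>Going back from \<open>R\<close> to \<open>Q\<close>, around the loop and forward again
  is a closed path at \<open>R\<close>.\<close>

lemma spin_perms_conj: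
  assumes "Q \<in> V" "R \<in> V" "path_transport Q R f" "a \<in> spin_perms N J P Q"
  shows "restrict (f \<circ> a \<circ> inv_into (N Q) f) (N R) \<in> spin_perms N J P R"
proof -
  obtain h where h: "path_transport R Q h" "\<forall>T\<in>N Q. h (f T) = T" "\<forall>T\<in>N R. f (h T) = T"
    using path_transport_inverse[OF assms(3)] by blast
  obtain k where k: "a = restrict k (N Q)" "path_transport Q Q k"
    using assms(4) unfolding spin_perms_eq[OF assms(1)] by blast
  have inv: "inv_into (N Q) f T = h T" if "T \<in> N R" for T
    using path_transport_bij[OF assms(3)] h that path_transport_in[OF h(1) that]
    by (metis bij_betw_imp_inj_on inv_into_f_f)
  have "restrict (f \<circ> a \<circ> inv_into (N Q) f) (N R) = restrict (f \<circ> k \<circ> h) (N R)"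
    using k inv path_transport_in[OF h(1)] by (auto simp: fun_eq_iff restrict_def)
  moreover have "path_transport R R (f \<circ> k \<circ> h)"
    using path_transport_trans[OF path_transport_trans[OF h(1) k(2)] assms(3)] by (simp add: comp_assoc)
  ultimately show ?thesis unfolding spin_perms_eq[OF assms(2)] by blast
qed

lemma spin_perms_conj_inverse:
  assumes Q: "Q \<in> V" and f: "path_transport Q R f" and h: "path_transport R Q h"
    and hf: "\<forall>T\<in>N Q. h (f T) = T" and \<sigma>: "\<sigma> \<in> spin_perms N J P Q"
  shows "restrict (h \<circ> restrict (f \<circ> \<sigma> \<circ> inv_into (N Q) f) (N R) \<circ> inv_into (N R) h) (N Q) = \<sigma>"
proof
  fix T
  \<comment> \<open>Group elements are \<open>undefined\<close> outside \<open>N Q\<close>;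
    extensionality settles the equality of functions there.\<close>
  have ext: "\<sigma> \<in> extensional (N Q)" "\<And>T. T \<in> N Q \<Longrightarrow> \<sigma> T \<in> N Q"
    using spin_perms_subset_Bij[OF Q] \<sigma> by (auto simp: Bij_def bij_betw_def)
  show "restrict (h \<circ> restrict (f \<circ> \<sigma> \<circ> inv_into (N Q) f) (N R) \<circ> inv_into (N R) h) (N Q) T = \<sigma> T"
  proof (cases "T \<in> N Q")
    case True
    have fT: "f T \<in> N R" by (rule path_transport_in[OF f True])
    have "inv_into (N R) h T = f T"
      using path_transport_bij[OF h] hf True fT by (metis bij_betw_imp_inj_on inv_into_f_f)
    moreover have "inv_into (N Q) f (f T) = T"
      using path_transport_bij[OF f] True by (metis bij_betw_imp_inj_on inv_into_f_f)
    ultimately show ?thesis using True fT hf ext(2)[OF True] by simp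
  next
    case False
    thus ?thesis using ext(1) by (simp add: extensional_def)
  qed
qed

text \<open>Nothing is special about the canonical path here: any path from \<open>Q\<close> to
  \<open>R\<close> works, and conjugation along the reversed path is the inverse map.\<close>

lemma spin_group_conj_iso:
  assumes Q: "Q \<in> V" and R: "R \<in> V" and f: "path_transport Q R f"
  defines "Ad \<equiv> (\<lambda>\<sigma>. restrict (f \<circ> \<sigma> \<circ> inv_into (N Q) f) (N R))"
  shows "Ad \<in> iso (spin_group N J P Q) (spin_group N J P R)"
    and "carrier (spin_group N J P R) = Ad ` carrier (spin_group N J P Q)"
proof -
  have bf: "bij_betw f (N Q) (N R)" by (rule path_transport_bij[OF f])
  obtain h where h: "path_transport R Q h" "\<forall>T\<in>N Q. h (f T) = T" "\<forall>T\<in>N R. f (h T) = T"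
    using path_transport_inverse[OF f] by blast
  have inv: "inv_into (N Q) f T = h T" if "T \<in> N R" for T
    using bf h that path_transport_in[OF h(1) that] by (metis bij_betw_imp_inj_on inv_into_f_f)
  let ?Bd = "\<lambda>\<sigma>. restrict (h \<circ> \<sigma> \<circ> inv_into (N R) h) (N Q)"
  have BA: "?Bd (Ad \<sigma>) = \<sigma>" if "\<sigma> \<in> spin_perms N J P Q" for \<sigma>
    unfolding Ad_def by (rule spin_perms_conj_inverse[OF Q f h(1,2) that])
  have AB: "Ad (?Bd \<sigma>) = \<sigma>" if "\<sigma> \<in> spin_perms N J P R" for \<sigma>
    unfolding Ad_def by (rule spin_perms_conj_inverse[OF R h(1) f h(3) that])
  have maps: "Ad \<sigma> \<in> spin_perms N J P R" if "\<sigma> \<in> spin_perms N J P Q" for \<sigma>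
    unfolding Ad_def by (rule spin_perms_conj[OF Q R f that])
  have maps': "?Bd \<sigma> \<in> spin_perms N J P Q" if "\<sigma> \<in> spin_perms N J P R" for \<sigma>
    by (rule spin_perms_conj[OF R Q h(1) that])
  have bij: "bij_betw Ad (spin_perms N J P Q) (spin_perms N J P R)"
    by (rule bij_betw_byWitness[of _ ?Bd]) (use AB BA maps maps' in auto)
  have "Ad (a \<otimes>\<^bsub>spin_group N J P Q\<^esub> b) = Ad a \<otimes>\<^bsub>spin_group N J P R\<^esub> Ad b"
    if a: "a \<in> spin_perms N J P Q" and b: "b \<in> spin_perms N J P Q" for a b
  proof -
    have "a \<in> Bij (N Q)" "b \<in> Bij (N Q)" "Ad a \<in> Bij (N R)" "Ad b \<in> Bij (N R)"
      using a b maps spin_perms_subset_Bij Q R by blast+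
    hence "a \<otimes>\<^bsub>spin_group N J P Q\<^esub> b = compose (N Q) a b"
      "Ad a \<otimes>\<^bsub>spin_group N J P R\<^esub> Ad b = compose (N R) (Ad a) (Ad b)"
      by (simp_all add: spin_group_def BijGroup_def)
    moreover have "Ad (compose (N Q) a b) T = compose (N R) (Ad a) (Ad b) T" for T
    proof (cases "T \<in> N R")
      case True
      have hT: "h T \<in> N Q" using path_transport_in[OF h(1) True] .
      have bT: "b (h T) \<in> N Q"
        using b spin_perms_subset_Bij[OF Q] hT by (auto simp: Bij_def bij_betw_def)
      have fT: "f (b (h T)) \<in> N R" using path_transport_in[OF f bT] .
      show ?thesis using True hT bT fT inv h(2) by (simp add: Ad_def compose_def)
    qed (simp add: Ad_def compose_def)
    ultimately show ?thesis by auto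
  qed
  hence "Ad \<in> hom (spin_group N J P Q) (spin_group N J P R)"
    by (intro homI) (use maps in \<open>auto simp: spin_group_def\<close>)
  with bij show "Ad \<in> iso (spin_group N J P Q) (spin_group N J P R)"
    by (simp add: iso_def spin_group_def)
  show "carrier (spin_group N J P R) = Ad ` carrier (spin_group N J P Q)"
    using bij by (simp add: spin_group_def bij_betw_def)
qed

section \<open>The faces of the canonical path\<close>

lemma conjugate_in_N: "Q \<in> V \<Longrightarrow> R \<in> N Q \<Longrightarrow> J R \<in> N (J Q)"
proof -
  assume Q: "Q \<in> V" and R: "R \<in> N Q"
  note h = in_ND[OF Q R]
  have "side (J R) \<noteq> side (J Q)" using h side_J[OF Q] side_J[of R] by blast
  moreover have "J R \<noteq> J (J Q)" using h by (metis J_J)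
  ultimately show "J R \<in> N (J Q)" using in_N_iff[OF J_in[OF Q]] h J_in by blast
qed

text \<open>With g at least 3, excluding at most two indices leaves one, so the minimum is taken
  over a nonempty set.\<close>

lemma min_avoiding_in:
  assumes "finite S" "card S \<le> 2" shows "min_avoiding g S \<in> {1..g} - S"
  unfolding min_avoiding_def
proof (rule Min_in)
  have "\<not> {1..g} \<subseteq> S" using card_mono[OF assms(1), of "{1..g}"] assms(2) g_ge by auto
  thus "{1..g} - S \<noteq> {}" by blast
qed simp

context
  fixes Q :: 'a and q :: "nat \<Rightarrow> 'a"
  assumes Q: "Q \<in> V" and q: "bij_betw q {1..g} (N Q)"
begin

lemma q_in: "i \<in> {1..g} \<Longrightarrow> q i \<in> N Q"
  using q bij_betwE by blast

lemma q_ne: "i \<in> {1..g} \<Longrightarrow> j \<in> {1..g} \<Longrightarrow> i \<noteq> j \<Longrightarrow> q i \<noteq> q j"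
  using q by (meson bij_betw_imp_inj_on inj_onD)

lemma q_V: "i \<in> {1..g} \<Longrightarrow> q i \<in> V"
  using q_in in_N_iff[OF Q] by blast

lemma canonical_square1:
  "i \<in> {1..g} \<Longrightarrow> k \<in> {1..g} \<Longrightarrow> l \<in> {1..g} \<Longrightarrow> i \<noteq> k \<Longrightarrow> i \<noteq> l \<Longrightarrow> k \<noteq> l \<Longrightarrow>
     square Q (q i) (J (q k)) (q l)"
  by (rule square_of_neighbours[OF Q q_in q_in q_in q_ne q_ne q_ne])

lemma q_conjugate_adjacent:
  assumes "i \<in> {1..g}" "j \<in> {1..g}" "i \<noteq> j"
  shows "J (q j) \<in> N (q i)"
proof -
  note hi = in_ND[OF Q q_in[OF assms(1)]]
    and hj = in_ND[OF Q q_in[OF assms(2)]]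
  have "side (J (q j)) \<noteq> side (q i)" using hi hj side_J[of "q j"] by blast
  moreover have "J (q j) \<noteq> J (q i)" using q_ne[OF assms] by simp
  ultimately show ?thesis using in_N_iff[OF q_V[OF assms(1)]] J_in hj by blast
qed

text \<open>The face spanned at \<open>q i\<close> by its three neighbours \<open>J (q j)\<close>,
  \<open>Q\<close> and \<open>J (q k)\<close>, the middle one being conjugated.\<close>

lemma canonical_square2:
  assumes "i \<in> {1..g}" "j \<in> {1..g}" "k \<in> {1..g}" "i \<noteq> j" "i \<noteq> k" "j \<noteq> k"
  shows "square (q i) (J (q j)) (J Q) (J (q k))"
proof (rule square_of_neighbours[OF q_V[OF assms(1)] q_conjugate_adjacent[OF assms(1,2,4)]
      N_sym[OF Q q_in[OF assms(1)]] q_conjugate_adjacent[OF assms(1,3,5)]])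
  show "J (q j) \<noteq> Q" "Q \<noteq> J (q k)"
    using in_ND[OF Q q_in[OF assms(2)]]
      in_ND[OF Q q_in[OF assms(3)]] by (metis J_J)+
  show "J (q j) \<noteq> J (q k)" using q_ne assms by simp
qed

text \<open>The face spanned at \<open>J (q j)\<close> by \<open>J Q\<close>, \<open>q i\<close> and
  \<open>q k\<close>, with \<open>q i\<close> conjugated.\<close>

lemma canonical_square3:
  assumes "i \<in> {1..g}" "j \<in> {1..g}" "k \<in> {1..g}" "i \<noteq> j" "i \<noteq> k" "j \<noteq> k"
  shows "square (J (q j)) (J Q) (J (q i)) (q k)"
proof (rule square_of_neighbours)
  show "J (q j) \<in> V" using q_V[OF assms(2)] J_in by blast
  show "J Q \<in> N (J (q j))" by (rule conjugate_in_N[OF q_V[OF assms(2)] N_sym[OF Q q_in[OF assms(2)]]])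
  show "q i \<in> N (J (q j))"
    by (rule N_sym[OF q_V[OF assms(1)] q_conjugate_adjacent[OF assms(1,2,4)]])
  show "q k \<in> N (J (q j))"
    by (rule N_sym[OF q_V[OF assms(3)] q_conjugate_adjacent[OF assms(3,2)]]) (use assms in simp)
  show "J Q \<noteq> q i" "J Q \<noteq> q k"
    using in_ND[OF Q q_in[OF assms(1)]]
      in_ND[OF Q q_in[OF assms(3)]] by auto
  show "q i \<noteq> q k" by (rule q_ne[OF assms(1,3,5)])
qed

end

lemma canonical_path_transport:
  assumes Q: "Q \<in> V" and R: "R \<in> V" "Q \<noteq> R" and q: "bij_betw (nbr J P Pt g Q) {1..g} (N Q)"
  shows "path_transport Q R (canonical_transport J P Pt g Q R)"
proof -
  define q where "q = nbr J P Pt g Q"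
  note q = q[folded q_def]
  have im: "q ` {1..g} = N Q" using q by (simp add: bij_betw_def)
  have one: "path_transport Q (q i) (transport J (canonical_face J g q Q i) Q (q i))" if i: "i \<in> {1..g}" for i
  proof -
    let ?l = "min_avoiding g {i}" and ?k = "min_avoiding g {i, min_avoiding g {i}}"
    have l: "?l \<in> {1..g}" "?l \<noteq> i" using min_avoiding_in[of "{i}"] by auto
    have k: "?k \<in> {1..g}" "?k \<noteq> i" "?k \<noteq> ?l"
      using min_avoiding_in[of "{i, ?l}"] l(2) by (auto simp: card_insert_if)
    have "square Q (q i) (J (q ?k)) (q ?l)"
      by (rule canonical_square1[OF Q q i k(1) l(1)]) (use l(2) k(2,3) in auto)
    thus ?thesis unfolding canonical_face_def Let_def by (rule path_transport_single)
  qed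
  show ?thesis
  proof (cases "R \<in> q ` {1..g}")
    case True
    let ?i = "inv_into {1..g} q R"
    have "?i \<in> {1..g}" "q ?i = R" using inv_into_into[OF True] f_inv_into_f[OF True] by auto
    with one[of ?i] True show ?thesis unfolding canonical_transport_def Let_def q_def[symmetric] by simp
  next
    case F1: False
    show ?thesis
    proof (cases "R \<in> (J \<circ> q) ` {1..g}")
      case True
      let ?j = "inv_into {1..g} (J \<circ> q) R"
      let ?i = "min_avoiding g {?j}"
      let ?k = "min_avoiding g {?i, ?j}"
      have j: "?j \<in> {1..g}" "J (q ?j) = R" using inv_into_into[OF True] f_inv_into_f[OF True] by auto
      have i: "?i \<in> {1..g}" "?i \<noteq> ?j" using min_avoiding_in[of "{?j}"] by auto
      have k: "?k \<in> {1..g}" "?k \<noteq> ?i" "?k \<noteq> ?j"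
        using min_avoiding_in[of "{?i, ?j}"] i(2) by (auto simp: card_insert_if)
      have "square (q ?i) (J (q ?j)) (J Q) (J (q ?k))"
        by (rule canonical_square2[OF Q q i(1) j(1) k(1) i(2)]) (use k(2,3) in auto)
      from path_transport_trans[OF one[OF i(1)] path_transport_single[OF this]]
      have "path_transport Q R (transport J (quad (q ?i) (J (q ?j)) (J Q) (J (q ?k))) (q ?i) (J (q ?j)) \<circ>
            transport J (canonical_face J g q Q ?i) Q (q ?i))" by (simp only: j(2))
      thus ?thesis using F1 True unfolding canonical_transport_def Let_def q_def[symmetric]
        by (simp only: if_True if_False)
    next
      case F2: False
      \<comment> \<open>A vertex on the other side is a neighbour of \<open>Q\<close> or
        \<open>J Q\<close>; one on the side of \<open>Q\<close> other than \<open>Q\<close> is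
        conjugate to a neighbour. Both alternatives except \<open>J Q\<close> have been
        excluded.\<close>
      have "R = J Q"
      proof (rule ccontr)
        assume n: "R \<noteq> J Q"
        have "R \<notin> N Q" using F1 im by blast
        hence "side R = side Q" using n R(1) in_N_iff[OF Q, of R] by blast
        hence "J R \<in> N Q" using in_N_iff[OF Q, of "J R"] side_J[OF R(1)] J_in[OF R(1)] R(2) by auto
        then obtain j where "j \<in> {1..g}" "J R = q j" unfolding im[symmetric] by blast
        hence "R = (J \<circ> q) j" by (metis J_J comp_apply)
        thus False using F2 \<open>j \<in> {1..g}\<close> by blast
      qed
      have g: "1 \<in> {1..g}" "2 \<in> {1..g}" "3 \<in> {1..g}" using g_ge by auto
      have s1: "square Q (q 1) (J (q 2)) (q 3)" by (rule canonical_square1[OF Q q g]) auto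
      have s2: "square (q 1) (J (q 2)) (J Q) (J (q 3))" by (rule canonical_square2[OF Q q g]) auto
      have s3: "square (J (q 2)) (J Q) (J (q 1)) (q 3)" by (rule canonical_square3[OF Q q g]) auto
      have "path_transport Q (J Q)
         (transport J (quad (J (q 2)) (J Q) (J (q 1)) (q 3)) (J (q 2)) (J Q) \<circ>
          (transport J (quad (q 1) (J (q 2)) (J Q) (J (q 3))) (q 1) (J (q 2)) \<circ>
           transport J (quad Q (q 1) (J (q 2)) (q 3)) Q (q 1)))"
        by (rule path_transport_trans[OF path_transport_trans[OF path_transport_single[OF s1]
              path_transport_single[OF s2]] path_transport_single[OF s3]])
      thus ?thesis using F1 F2 unfolding canonical_transport_def Let_def q_def[symmetric]
        by (simp only: if_False \<open>R = J Q\<close> comp_assoc)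
    qed
  qed
qed

end

section \<open>The graph of a standard point and its induced enumerations\<close>

lemma bij_betw_nth_shift:
  assumes "distinct xs" "length xs = g"
  shows "bij_betw (\<lambda>i. xs ! (i - 1)) {1..g} (set xs)"
proof -
  have "bij_betw (\<lambda>i. i - 1) {1..g} {..<g}"
    by (rule bij_betw_byWitness[of _ Suc]) auto
  from bij_betw_trans[OF this bij_betw_nth[of xs "{..<g}" "set xs"]] assms show ?thesis
    by (simp add: comp_def)
qed

text \<open>The set of P, J P, P_k, J P_k is closed under passing to neighbours, so it contains the
  graph; having at most 2g + 2 elements, it is the whole graph and its listed points are distinct.
  The side of \<open>P\<close> consists of \<open>P\<close> and the conjugates of its
  neighbours.\<close>

lemma standard_spin_graph:
  fixes N :: "'a \<Rightarrow> 'a set" and J :: "'a \<Rightarrow> 'a" and Pt :: "nat \<Rightarrow> 'a"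
  assumes J: "\<And>Q. J (J Q) = Q" and g: "3 \<le> g" and std: "standard_point N g P"
    and Pt: "bij_betw Pt {1..g} Z"
    and NP: "N P = Z" "P \<notin> Z" and NJP: "N (J P) = {R. J R \<in> Z}"
    and NK: "\<And>K. K \<in> Z \<Longrightarrow> N K = insert P {R. J R \<in> Z \<and> J R \<noteq> K}"
    and NJK: "\<And>K. K \<in> Z \<Longrightarrow> N (J K) = insert (J P) (Z - {K})"
  shows "spin_graph (spin_vertices N P) (\<lambda>Q. Q \<in> insert P (J ` Z)) J N P g"
    and "Q \<in> spin_vertices N P \<Longrightarrow> bij_betw (nbr J P Pt g Q) {1..g} (N Q)"
proof -
  have J_image: "J R \<in> S \<longleftrightarrow> R \<in> J ` S" for R S by (metis J image_iff)
  have img: "{R. J R \<in> Z} = J ` Z" unfolding J_image by simp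
  have img': "{R. J R \<in> Z \<and> J R \<noteq> K} = J ` (Z - {K})" for K
  proof -
    have "{R. J R \<in> Z \<and> J R \<noteq> K} = {R. J R \<in> Z - {K}}" by blast
    thus ?thesis unfolding J_image by simp
  qed
  have injJ: "inj_on J S" for S by (rule inj_onI) (metis J)
  define V where "V = {P, J P} \<union> Z \<union> J ` Z"
  have sub: "spin_vertices N P \<subseteq> V"
  proof
    fix x assume "x \<in> spin_vertices N P"
    thus "x \<in> V"
    proof induction
      case (step Q R)
      then consider "Q = P" | "Q = J P" | "Q \<in> Z" | K where "K \<in> Z" "Q = J K" unfolding V_def by blast
      thus ?case
        using step.hyps(2) by cases (auto simp: NP NJP img NK NJK img' V_def)
    qed (simp add: V_def)
  qed
  have Pt_im: "Pt ` {1..g} = Z" using Pt by (simp add: bij_betw_def)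
  have card_Z: "card Z = g" using bij_betw_same_card[OF Pt] by simp
  have finZ: "finite Z" using card_Z g card.infinite by fastforce
  obtain zs where zs: "set zs = Z" "length zs = g"
    using finite_distinct_list[OF finZ] card_Z distinct_card by metis
  \<comment> \<open>A list of length 2g + 2 with set \<open>V\<close>; equality of cardinality and
    length turns the count of vertices into distinctness.\<close>
  let ?xs = "P # J P # zs @ map J zs"
  have setx: "set ?xs = V" using zs by (auto simp: V_def)
  have cv: "card (spin_vertices N P) = 2 * g + 2" using std by (simp add: standard_point_def)
  have "card V \<le> length ?xs" using card_length[of ?xs] setx by simp
  hence "card V \<le> 2 * g + 2" using zs(2) by simp
  moreover have "finite V" using setx by (metis List.finite_set)
  ultimately have eq: "spin_vertices N P = V" using card_seteq[OF _ sub] cv by simp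
  hence "card (set ?xs) = length ?xs" using setx cv zs(2) by simp
  hence dist: "distinct ?xs" by (rule card_distinct)
  have d: "P \<noteq> J P" "J P \<notin> Z" "P \<notin> J ` Z" "J P \<notin> J ` Z" "Z \<inter> J ` Z = {}"
    using dist zs(1) by auto
  show graph: "spin_graph (spin_vertices N P) (\<lambda>Q. Q \<in> insert P (J ` Z)) J N P g"
    unfolding eq
  proof unfold_locales
    show "J (J Q) = Q" for Q by (rule J)
    show "spin_vertices N P = V" by (rule eq)
    show "finite V" by fact
    show "3 \<le> g" by fact
  next
    fix Q assume QV: "Q \<in> V"
    then consider (a) "Q = P" | (b) "Q = J P" | (c) "Q \<in> Z" | (d) K where "K \<in> Z" "Q = J K"
      unfolding V_def by blast
    note cases = this
    show "J Q \<in> V" using cases by cases (auto simp: V_def J)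
    show "J Q \<in> insert P (J ` Z) \<longleftrightarrow> Q \<notin> insert P (J ` Z)"
      using cases
    proof cases
      case c
      hence "Q \<noteq> P" "Q \<notin> J ` Z" using NP(2) d(5) by blast+
      thus ?thesis using c by blast
    next
      case (d K)
      hence "J Q = K" using J by simp
      moreover have "K \<noteq> P" "K \<notin> J ` Z" using d NP(2) \<open>Z \<inter> J ` Z = {}\<close> by blast+
      ultimately show ?thesis using d by blast
    qed (use \<open>P \<noteq> J P\<close> \<open>J P \<notin> J ` Z\<close> J in auto)
    show "N Q = {R \<in> V. (R \<in> insert P (J ` Z)) \<noteq> (Q \<in> insert P (J ` Z)) \<and> R \<noteq> J Q}"
      using cases
    proof cases
      case a
      thus ?thesis using d NP by (auto simp: V_def)
    next
      case b
      have "N Q = J ` Z" using b NJP img by simp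
      moreover have "Q \<notin> insert P (J ` Z)" "J Q = P" using b d J by auto
      moreover have "{R \<in> V. R \<in> insert P (J ` Z) \<and> R \<noteq> P} = J ` Z" using d(3) unfolding V_def by blast
      ultimately show ?thesis by simp
    next
      case c
      have "N Q = insert P (J ` (Z - {Q}))" using NK[OF c] img' by simp
      also have "\<dots> = insert P (J ` Z) - {J Q}"
        using c d(3) inj_on_image_set_diff[OF injJ[of Z], of Z "{Q}"] by auto
      finally have "N Q = insert P (J ` Z) - {J Q}" .
      moreover have "Q \<notin> insert P (J ` Z)" using c NP(2) d(5) by blast
      ultimately show ?thesis by (auto simp: V_def)
    next
      case (d K)
      have "N Q = insert (J P) (Z - {K})" using NJK d by simp
      moreover have "Q \<in> insert P (J ` Z)" "J Q = K" using d J by auto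
      moreover have "K \<noteq> J P" using d(1) \<open>J P \<notin> Z\<close> by metis
      moreover have "R \<notin> insert P (J ` Z)" if "R \<in> insert (J P) Z" for R
      proof (cases "R = J P")
        case True
        thus ?thesis using \<open>P \<noteq> J P\<close> \<open>J P \<notin> J ` Z\<close> by simp
      next
        case False
        hence "R \<in> Z" using that by simp
        thus ?thesis using NP(2) \<open>Z \<inter> J ` Z = {}\<close> by auto
      qed
      ultimately show ?thesis unfolding V_def by blast
    qed
    show "card (N Q) = g"
      using cases
    proof cases
      case b
      thus ?thesis using NJP img card_image[OF injJ] card_Z by simp
    next
      case c
      have "P \<notin> J ` (Z - {Q})" using d(3) by blast
      thus ?thesis using c NK[OF c] img' card_image[OF injJ] card_Z finZ g by simp
    next
      case (d K)
      have "J P \<notin> Z - {K}" using \<open>J P \<notin> Z\<close> by blast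
      thus ?thesis using d NJK card_Z finZ g by simp
    qed (use NP card_Z in simp)
  qed
  interpret G: spin_graph "spin_vertices N P" "\<lambda>Q. Q \<in> insert P (J ` Z)" J N P g by (rule graph)
  have others_set: "set (others g k) = {1..g} - {k}" for k by (auto simp: others_def)
  have others_len: "length (others g k) = g - 1" if "k \<in> {1..g}" for k
  proof -
    have "length (others g k) = card (set (others g k))"
      by (rule distinct_card[symmetric]) (simp add: others_def)
    thus ?thesis using that by (simp add: others_set)
  qed
  have Pt_others: "Pt ` ({1..g} - {k}) = Z - {Pt k}" if "k \<in> {1..g}" for k
    using Pt that inj_on_image_set_diff[of Pt "{1..g}" "{1..g}" "{k}"] by (auto simp: bij_betw_def)
  \<comment> \<open>A list of length g whose set has g elements is distinct, so it suffices to
    compare sets and lengths.\<close>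
  have bij_list: "bij_betw (\<lambda>i. xs ! (i - 1)) {1..g} (N Q)"
    if "Q \<in> spin_vertices N P" "set xs = N Q" "length xs = g" for xs Q
    using bij_betw_nth_shift[of xs g] card_distinct[of xs] that G.card_N by simp
  assume Q: "Q \<in> spin_vertices N P"
  then consider (a) "Q = P" | (b) "Q = J P" | (c) "Q \<in> Z" | (d) K where "K \<in> Z" "Q = J K"
    unfolding eq V_def by blast
  thus "bij_betw (nbr J P Pt g Q) {1..g} (N Q)"
  proof cases
    case a
    have "nbr J P Pt g Q = Pt" using a by (simp add: nbr_def fun_eq_iff)
    thus ?thesis using a Pt NP by simp
  next
    case b
    have "nbr J P Pt g Q = J \<circ> Pt" using b d(1) by (simp add: nbr_def fun_eq_iff)
    moreover have "bij_betw J Z (J ` Z)" using injJ by (simp add: bij_betw_def)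
    ultimately show ?thesis using b bij_betw_trans[OF Pt] NJP img by metis
  next
    case c
    let ?k = "inv_into {1..g} Pt Q"
    have Q': "Q \<in> Pt ` {1..g}" using c Pt_im by simp
    have k: "?k \<in> {1..g}" "Pt ?k = Q" using inv_into_into[OF Q'] f_inv_into_f[OF Q'] by auto
    let ?xs = "P # map (\<lambda>j. J (Pt j)) (others g ?k)"
    have ne: "Q \<noteq> P" "Q \<noteq> J P" using c d NP(2) by blast+
    have "nbr J P Pt g Q = (\<lambda>i. ?xs ! (i - 1))"
      unfolding nbr_def Let_def using ne Q' by (simp only: if_False if_True)
    moreover have "set ?xs = N Q"
    proof -
      have "set ?xs = insert P (J ` (Pt ` ({1..g} - {?k})))"
        by (simp only: list.set set_map others_set image_image)
      thus ?thesis unfolding Pt_others[OF k(1)] k(2) NK[OF c] img' .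
    qed
    moreover have "length ?xs = g" using others_len[OF k(1)] g by simp
    ultimately show ?thesis using bij_list[OF Q] by simp
  next
    case (d K)
    let ?k = "inv_into {1..g} (J \<circ> Pt) Q"
    have Q': "Q \<in> (J \<circ> Pt) ` {1..g}" using d Pt_im by (auto simp: image_comp[symmetric])
    have k: "?k \<in> {1..g}" "J (Pt ?k) = Q" using inv_into_into[OF Q'] f_inv_into_f[OF Q'] by auto
    have kK: "Pt ?k = K" using k(2) d(2) J by metis
    let ?xs = "J P # map Pt (others g ?k)"
    \<comment> \<open>Distinctness of the vertices guarantees that \<open>nbr\<close> reaches its
      last branch.\<close>
    have ne: "Q \<noteq> P" "Q \<noteq> J P" "Q \<notin> Pt ` {1..g}"
      using d \<open>P \<notin> J ` Z\<close> \<open>J P \<notin> J ` Z\<close> \<open>Z \<inter> J ` Z = {}\<close> Pt_im by blast+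
    have "nbr J P Pt g Q = (\<lambda>i. ?xs ! (i - 1))"
      unfolding nbr_def Let_def using ne by (simp only: if_False)
    moreover have "set ?xs = N Q"
    proof -
      have "set ?xs = insert (J P) (Pt ` ({1..g} - {?k}))"
        by (simp only: list.set set_map others_set)
      thus ?thesis unfolding Pt_others[OF k(1)] kK using NJK d by simp
    qed
    moreover have "length ?xs = g" using others_len[OF k(1)] g by simp
    ultimately show ?thesis using bij_list[OF Q] by simp
  qed
qed

theorem mainTheorem3:
  fixes A :: "('a::t2_space) chart set"
    and J :: "'a \<Rightarrow> 'a"
    and \<xi> :: "'a chart \<Rightarrow> 'a chart \<Rightarrow> 'a \<Rightarrow> complex"
    and g :: nat
    and P Q R :: 'a
    and Pt :: "nat \<Rightarrow> 'a"
  defines "N \<equiv> zero_points A \<xi>"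
  defines "\<sigma>C \<equiv> canonical_transport J P Pt g Q R"
  defines "Ad \<equiv> (\<lambda>\<sigma>. restrict (\<sigma>C \<circ> \<sigma> \<circ> inv_into (N Q) \<sigma>C) (N R))"
  assumes "compact_riemann_surface A"
    and "has_genus A g"
    and "g \<ge> 3"
    and "hyperelliptic_involution A J"
    and "nonsingular_even_spin_bundle A \<xi>"
    and "standard_point N g P"
    and "bij_betw Pt {1..g} (N P)"
    and "Q \<in> spin_vertices N P"
    and "R \<in> spin_vertices N P"
    and "Q \<noteq> R"
  shows "bij_betw \<sigma>C (N Q) (N R) \<and>
         group (spin_group N J P Q) \<and> group (spin_group N J P R) \<and>
         Ad \<in> iso (spin_group N J P Q) (spin_group N J P R) \<and>
         carrier (spin_group N J P R) = Ad ` carrier (spin_group N J P Q)"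
proof -
  interpret spin_surface A J \<xi>
    using assms(4,7,8) by unfold_locales
  have J: "J (J p) = p" for p by simp
  \<comment> \<open>The enumeration is the source of the g distinct zeros that the multiplicity
    bound forces to be simple.\<close>
  have card: "card (N P) = g" using bij_betw_same_card[OF assms(10)] by simp
  have g: "0 < g" using assms(6) by simp
  note nb = spin_neighbours[OF assms(5) g card[unfolded N_def], folded N_def]
  note graph = standard_spin_graph[OF J assms(6) assms(9) assms(10) refl nb(1) nb(2) nb(3) nb(4)]
  interpret G: spin_graph "spin_vertices N P" "\<lambda>Q. Q \<in> insert P (J ` N P)" J N P g
    by (rule graph(1)) blast+
  have path: "G.path_transport Q R \<sigma>C"
    unfolding \<sigma>C_def
    by (rule G.canonical_path_transport[OF assms(11,12,13) graph(2)[OF _ _ assms(11)]]) blast+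
  show ?thesis
    using G.path_transport_bij[OF path] G.spin_group_group[OF assms(11)] G.spin_group_group[OF assms(12)]
      G.spin_group_conj_iso[OF assms(11,12) path, folded Ad_def]
    by blast
qed

end
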